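(* Consider, for each $N,T$, the model $Y=\sum_{k=1}^K\beta^0_kX_k+\lambda^0f^{0\prime}+e$ with observed $N\times T$ matrices $Y,X_1,\dots,X_K$, unobserved $N\times R$ matrix $\lambda^0$, $T\times R$ matrix $f^0$, $N\times T$ error matrix $e$, and known $R$. Let $\mathbb B\subset\mathbb R^K$ be compact with $\beta^0\in\mathbb B$, and let $\widehat\beta=\mathrm{argmin}_{\beta\in\mathbb B}L_{NT}(\beta)$, where $L_{NT}(\beta)=\min_{\lambda\in\mathbb R^{N\times R},f\in\mathbb R^{T\times R}}\frac1{NT}\|Y-\beta\cdot X-\lambda f'\|_F^2$ and $\beta\cdot X=\sum_k\beta_kX_k$. Assume, as $N,T\to\infty$: (A1) $\mathrm{plim}(\lambda^{0\prime}\lambda^0/N)>0$ and $\mathrm{plim}(f^{0\prime}f^0/T)>0$; (A2) $\mathrm{plim}\,(NT)^{-1}\mathrm{Tr}(X_ke')=0$ for all $k$; (A3) $\mathrm{plim}\,\|e\|/\sqrt{NT}=0$; (A4)(i) $\mathrm{plim}\,(NT)^{-1}\sum_{i,t}X_{it}X_{it}'>0$, where $X_{it}=(X_{1,it},\dots,X_{K,it})'$; (ii)(a) for the high-rank regressors $X_m$, $m=K_1+1,\dots,K$, there is a constant $b>0$ such that $$\min_{\alpha\in\mathbb R^{K_2},\|\alpha\|=1}\ \sum_{r=2R+K_1+1}^N\mu_r\!\left[\frac{(\alpha\cdot X_{\rm high})(\alpha\cdot X_{\rm high})'}{NT}\right]\ge b\quad\text{wpa1},$$ with $\alpha\cdot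 X_{\rm high}=\sum_{m=K_1+1}^K\alpha_mX_m$ ($K_2=K-K_1$); (ii)(b) the low-rank regressors satisfy $\mathrm{rank}(X_l)=1$, i.e. $X_l=w_lv_l'$ with $w_l\in\mathbb R^N$, $v_l\in\mathbb R^T$, $l=1,\dots,K_1$, and with $w=(w_1,\dots,w_{K_1})$, $v=(v_1,\dots,v_{K_1})$ there is a constant $B>0$ such that $N^{-1}\lambda^{0\prime}M_w\lambda^0>B\,\mathbb I_R$ and $T^{-1}f^{0\prime}M_vf^0>B\,\mathbb I_R$ wpa1. Then $\widehat\beta\to_p\beta^0$ as $N,T\to\infty$.
   Context: $\|A\|$ is the spectral norm, $\|A\|_F$ the Frobenius norm, $\mu_r(B)$ the $r$-th largest eigenvalue of a symmetric matrix $B$. $M_A=\mathbb I-A(A'A)^\dagger A'$ with $\dagger$ the Moore–Penrose pseudoinverse. "wpa1" means with probability approaching one. Inequalities between symmetric matrices refer to positive (semi)definiteness; "plim $>0$" means the probability limit exists and is positive definite. *)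

theory Defs
  imports "HOL-Probability.Probability" "Jordan_Normal_Form.Matrix" "Jordan_Normal_Form.Char_Poly"
begin

definition mat_tr :: "real mat \<Rightarrow> real" where
  "mat_tr A = (\<Sum>i<dim_row A. A $$ (i,i))"

definition frob_norm :: "real mat \<Rightarrow> real" where
  "frob_norm A = sqrt (\<Sum>i<dim_row A. \<Sum>j<dim_col A. (A $$ (i,j))^2)"

definition spec_norm :: "real mat \<Rightarrow> real" where
  "spec_norm A = Sup {sqrt ((A *\<^sub>v v) \<bullet> (A *\<^sub>v v)) | v. v \<in> carrier_vec (dim_col A) \<and> v \<bullet> v = 1}"

(* mu_r(A): r-th largest eigenvalue (r \<ge> 1, counted with multiplicity) of a symmetric matrix *)
definition eig_desc :: "real mat \<Rightarrow> nat \<Rightarrow> real" where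
  "eig_desc A r = rev (sorted_list_of_multiset (proots (char_poly A))) ! (r - 1)"

definition pinv :: "real mat \<Rightarrow> real mat" where
  "pinv A = (THE B. B \<in> carrier_mat (dim_col A) (dim_row A) \<and> A * B * A = A \<and> B * A * B = B
              \<and> transpose_mat (A * B) = A * B \<and> transpose_mat (B * A) = B * A)"

definition annih :: "real mat \<Rightarrow> real mat" where
  "annih A = 1\<^sub>m (dim_row A) - A * pinv (transpose_mat A * A) * transpose_mat A"

definition pd_mat :: "real mat \<Rightarrow> bool" where
  "pd_mat A \<longleftrightarrow> square_mat A \<and> transpose_mat A = A \<and>
     (\<forall>v \<in> carrier_vec (dim_row A). v \<noteq> 0\<^sub>v (dim_row A) \<longrightarrow> v \<bullet> (A *\<^sub>v v) > 0)"

definition bdotX :: "nat \<Rightarrow> (nat \<Rightarrow> real) \<Rightarrow> (nat \<Rightarrow> real mat) \<Rightarrow> nat \<Rightarrow> nat \<Rightarrow> real mat" where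
  "bdotX K b Xs N T = mat N T (\<lambda>(i,t). \<Sum>k<K. b k * Xs k $$ (i,t))"

definition LNT :: "nat \<Rightarrow> nat \<Rightarrow> nat \<Rightarrow> nat \<Rightarrow> real mat \<Rightarrow> (nat \<Rightarrow> real mat) \<Rightarrow> (nat \<Rightarrow> real) \<Rightarrow> real" where
  "LNT K R N T Y Xs b = Inf {(frob_norm (Y - bdotX K b Xs N T - lam * transpose_mat f))^2 / (real N * real T)
        | lam f. lam \<in> carrier_mat N R \<and> f \<in> carrier_mat T R}"

(* outer probability (no measurability assumptions are made on the random objects) *)
definition outer_prob :: "'a measure \<Rightarrow> 'a set \<Rightarrow> real" where
  "outer_prob M S = Inf (measure M ` {A \<in> sets M. S \<inter> space M \<subseteq> A})"

abbreviation NT_lim :: "(nat \<times> nat) filter" where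
  "NT_lim \<equiv> sequentially \<times>\<^sub>F sequentially"

definition plim_to :: "'a measure \<Rightarrow> (nat \<Rightarrow> nat \<Rightarrow> 'a \<Rightarrow> real) \<Rightarrow> real \<Rightarrow> bool" where
  "plim_to M Z c \<longleftrightarrow> (\<forall>\<epsilon>>0. ((\<lambda>(N,T). outer_prob M {\<omega> \<in> space M. \<bar>Z N T \<omega> - c\<bar> > \<epsilon>}) \<longlongrightarrow> 0) NT_lim)"

definition wpa1 :: "'a measure \<Rightarrow> (nat \<Rightarrow> nat \<Rightarrow> 'a \<Rightarrow> bool) \<Rightarrow> bool" where
  "wpa1 M P \<longleftrightarrow> ((\<lambda>(N,T). outer_prob M {\<omega> \<in> space M. \<not> P N T \<omega>}) \<longlongrightarrow> 0) NT_lim"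

definition plim_pd :: "'a measure \<Rightarrow> nat \<Rightarrow> (nat \<Rightarrow> nat \<Rightarrow> 'a \<Rightarrow> real mat) \<Rightarrow> bool" where
  "plim_pd M d Z \<longleftrightarrow> (\<exists>A \<in> carrier_mat d d. pd_mat A \<and>
      (\<forall>i<d. \<forall>j<d. plim_to M (\<lambda>N T \<omega>. Z N T \<omega> $$ (i,j)) (A $$ (i,j))))"

end

(* Write d = betahat - beta0. Since L(betahat) <= L(beta0) <= |e|_F^2 / (NT), the matrix
   d.X + lam f' - lam0 f0' has Frobenius norm o(sqrt(NT)) for some N x R and T x R matrices
   lam, f: the error e is nearly orthogonal to every X_k and, its spectral norm being small,
   to every matrix of rank at most 2R.
   High-rank part: d_high.X_high is within o(sqrt(NT)) of a matrix of rank at most 2R + K1, so the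
   tail eigenvalue sum forces d_high to 0 by the Eckart-Young bound.
   Low-rank part: what remains is lam f' + w D v' = lam0 f0' + o(sqrt(NT)) with D diagonal.
   Projecting out w and then v shows that, up to an invertible R x R matrix, (lam, f) is close to
   (lam0, f0); hence lam f' is close to lam0 f0', d.X is small, and d is small because the Gram
   matrix of the regressors has a positive definite limit. *)
theory Submission
  imports Defs "Jordan_Normal_Form.Spectral_Radius"
begin

section \<open>Frobenius inner product\<close>

text \<open>The obstacle is size. The minimizing pair (lam, f) is neither unique nor bounded, the
  infimum over it is only approached, and w and v carry no bound of their own, so no estimate may
  use the norms of these matrices. The near-orthogonality of e is therefore relative: |<e, L>| is at
  most ||e|| sqrt(2R) ||L||_F when L has rank at most 2R. This gives x^2 <= a (1 + x) for the
  residual norm x, with a small. For the factors, the invertible matrix is A = lam0' M_w lam. Its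
  inverse is never estimated, only shown to exist; lam A^-1 is then bounded through the very
  distance that it serves to bound, with a small factor that can be absorbed.

  All this is a deterministic inequality at one sample point. The stochastic assumptions enter as
  finitely many events with fixed tolerances, and subadditivity of outer probability is enough to
  intersect them. A rank bound always appears as a factorization C F' with few columns, and is
  exploited through the Frobenius norm of a projector.\<close>

lemma mult_mat_assoc_dim:
  fixes A B C :: "'a::semiring_0 mat"
  shows "dim_col A = dim_row B \<Longrightarrow> dim_col B = dim_row C \<Longrightarrow> (A * B) * C = A * (B * C)"
  by (rule assoc_mult_mat) auto

lemma transpose_mult_dim:
  fixes A B :: "'a::comm_semiring_0 mat"
  shows "dim_col A = dim_row B \<Longrightarrow> (A * B)\<^sup>T = B\<^sup>T * A\<^sup>T"
  by (rule transpose_mult) auto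

definition frob_inner :: "real mat \<Rightarrow> real mat \<Rightarrow> real" where
  "frob_inner A B = (\<Sum>i<dim_row A. \<Sum>j<dim_col A. A $$ (i,j) * B $$ (i,j))"

lemma frob_norm_square: "(frob_norm A)\<^sup>2 = frob_inner A A"
  unfolding frob_norm_def frob_inner_def
  by (subst real_sqrt_pow2) (auto intro!: sum_nonneg simp: power2_eq_square)

lemma frob_norm_nonneg [simp]: "0 \<le> frob_norm A"
  unfolding frob_norm_def by (auto intro!: sum_nonneg)

lemma frob_inner_commute:
  "A \<in> carrier_mat n m \<Longrightarrow> B \<in> carrier_mat n m \<Longrightarrow> frob_inner A B = frob_inner B A"
  unfolding frob_inner_def by (auto simp: mult.commute)

lemma frob_inner_minus_left:
  "A \<in> carrier_mat n m \<Longrightarrow> B \<in> carrier_mat n m \<Longrightarrow> C \<in> carrier_mat n m \<Longrightarrow>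
    frob_inner (A - B) C = frob_inner A C - frob_inner B C"
  unfolding frob_inner_def by (auto simp: algebra_simps sum_subtractf)

lemma frob_inner_add_right:
  "A \<in> carrier_mat n m \<Longrightarrow> B \<in> carrier_mat n m \<Longrightarrow> C \<in> carrier_mat n m \<Longrightarrow>
    frob_inner C (A + B) = frob_inner C A + frob_inner C B"
  unfolding frob_inner_def by (auto simp: algebra_simps sum.distrib)

lemma frob_inner_minus_right:
  "A \<in> carrier_mat n m \<Longrightarrow> B \<in> carrier_mat n m \<Longrightarrow> C \<in> carrier_mat n m \<Longrightarrow>
    frob_inner C (A - B) = frob_inner C A - frob_inner C B"
  unfolding frob_inner_def by (auto simp: algebra_simps sum_subtractf)

lemma frob_inner_smult_left: "A \<in> carrier_mat n m \<Longrightarrow> frob_inner (c \<cdot>\<^sub>m A) B = c * frob_inner A B"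
  unfolding frob_inner_def by (auto simp: sum_distrib_left mult.assoc)

lemma frob_inner_transpose:
  "A \<in> carrier_mat n m \<Longrightarrow> B \<in> carrier_mat n m \<Longrightarrow> frob_inner (A\<^sup>T) (B\<^sup>T) = frob_inner A B"
  unfolding frob_inner_def by (auto intro: sum.swap)

text \<open>Left multiplication by A has adjoint A'. This and its counterpart for right
  multiplication take the place of the cyclic trace identity in later computations.\<close>

lemma frob_inner_mult_left:
  assumes "A \<in> carrier_mat n m" "B \<in> carrier_mat m p" "C \<in> carrier_mat n p"
  shows "frob_inner (A * B) C = frob_inner B (A\<^sup>T * C)"
proof -
  have "frob_inner (A * B) C = (\<Sum>i<n. \<Sum>j<p. \<Sum>k<m. A $$ (i,k) * B $$ (k,j) * C $$ (i,j))"
    unfolding frob_inner_def using assms by (auto simp: scalar_prod_def sum_distrib_right lessThan_atLeast0)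
  also have "\<dots> = (\<Sum>i<n. \<Sum>k<m. \<Sum>j<p. A $$ (i,k) * B $$ (k,j) * C $$ (i,j))"
    by (intro sum.cong refl sum.swap)
  also have "\<dots> = (\<Sum>k<m. \<Sum>i<n. \<Sum>j<p. A $$ (i,k) * B $$ (k,j) * C $$ (i,j))"
    by (rule sum.swap)
  also have "\<dots> = (\<Sum>k<m. \<Sum>j<p. \<Sum>i<n. A $$ (i,k) * B $$ (k,j) * C $$ (i,j))"
    by (intro sum.cong refl sum.swap)
  also have "\<dots> = frob_inner B (A\<^sup>T * C)"
    unfolding frob_inner_def using assms
    by (auto simp: scalar_prod_def sum_distrib_left lessThan_atLeast0 ac_simps intro!: sum.cong)
  finally show ?thesis .
qed

lemma frob_inner_mult_right:
  assumes A: "A \<in> carrier_mat n m" and B: "B \<in> carrier_mat m p" and C: "C \<in> carrier_mat n p"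
  shows "frob_inner (A * B) C = frob_inner A (C * B\<^sup>T)"
proof -
  have "frob_inner (A * B) C = frob_inner (B\<^sup>T * A\<^sup>T) (C\<^sup>T)"
    using frob_inner_transpose[of "A * B" n p C] A B C by (simp add: transpose_mult[OF A B])
  also have "\<dots> = frob_inner (A\<^sup>T) (B\<^sup>T\<^sup>T * C\<^sup>T)"
    using A B C by (intro frob_inner_mult_left) auto
  also have "B\<^sup>T\<^sup>T * C\<^sup>T = (C * B\<^sup>T)\<^sup>T"
    using transpose_mult[of C n p "B\<^sup>T" m] B C by simp
  also have "frob_inner (A\<^sup>T) ((C * B\<^sup>T)\<^sup>T) = frob_inner A (C * B\<^sup>T)"
    using A B C by (intro frob_inner_transpose[of _ n m]) auto
  finally show ?thesis .
qed

lemma frob_inner_zero_right: "A \<in> carrier_mat n m \<Longrightarrow> frob_inner A (0\<^sub>m n m) = 0"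
  by (auto simp: frob_inner_def)

lemma minus_zero_mat: "A \<in> carrier_mat n m \<Longrightarrow> A - 0\<^sub>m n m = (A :: 'a::group_add mat)"
  by (intro eq_matI) auto

lemma frob_norm_L2_set:
  "A \<in> carrier_mat n m \<Longrightarrow> frob_norm A = L2_set (\<lambda>p. A $$ p) ({..<n} \<times> {..<m})"
  unfolding frob_norm_def L2_set_def by (auto simp: sum.cartesian_product case_prod_beta)

lemma frob_norm_triangle:
  assumes "A \<in> carrier_mat n m" "B \<in> carrier_mat n m"
  shows "frob_norm (A + B) \<le> frob_norm A + frob_norm B"
proof -
  have "frob_norm (A + B) = L2_set (\<lambda>p. A $$ p + B $$ p) ({..<n} \<times> {..<m})"
    using assms by (subst frob_norm_L2_set[of _ n m]) (auto intro!: L2_set_cong)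
  also have "\<dots> \<le> frob_norm A + frob_norm B"
    using L2_set_triangle_ineq by (simp add: frob_norm_L2_set[OF assms(1)] frob_norm_L2_set[OF assms(2)])
  finally show ?thesis .
qed

lemma frob_norm_smult: "frob_norm (c \<cdot>\<^sub>m A) = \<bar>c\<bar> * frob_norm A"
  unfolding frob_norm_def by (simp add: power_mult_distrib flip: sum_distrib_left real_sqrt_mult)
    (simp add: real_sqrt_mult)

lemma frob_norm_minus_le:
  assumes "A \<in> carrier_mat n m" "B \<in> carrier_mat n m"
  shows "frob_norm (A - B) \<le> frob_norm A + frob_norm B"
proof -
  have "A - B = A + (- 1) \<cdot>\<^sub>m B" using assms by (intro eq_matI) auto
  then show ?thesis using frob_norm_triangle[of A n m "(- 1) \<cdot>\<^sub>m B"] assms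
    by (simp add: frob_norm_smult)
qed

lemma frob_inner_Cauchy_Schwarz:
  assumes "A \<in> carrier_mat n m" "B \<in> carrier_mat n m"
  shows "\<bar>frob_inner A B\<bar> \<le> frob_norm A * frob_norm B"
proof -
  have "frob_inner A B = (\<Sum>p\<in>{..<n} \<times> {..<m}. A $$ p * B $$ p)"
    using assms by (auto simp: frob_inner_def sum.cartesian_product case_prod_beta)
  also have "\<bar>\<dots>\<bar> \<le> (\<Sum>p\<in>{..<n} \<times> {..<m}. \<bar>A $$ p\<bar> * \<bar>B $$ p\<bar>)"
    by (rule order.trans[OF sum_abs]) (simp add: abs_mult)
  also have "\<dots> \<le> frob_norm A * frob_norm B"
    unfolding frob_norm_L2_set[OF assms(1)] frob_norm_L2_set[OF assms(2)]
    by (rule L2_set_mult_ineq)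
  finally show ?thesis .
qed

lemma frob_norm_transpose [simp]: "frob_norm (A\<^sup>T) = frob_norm A"
proof -
  have "(frob_norm (A\<^sup>T))\<^sup>2 = (frob_norm A)\<^sup>2"
    unfolding frob_norm_square by (rule frob_inner_transpose) auto
  then show ?thesis by (simp add: power2_eq_iff_nonneg)
qed

text \<open>Cauchy-Schwarz bounds each squared entry of the product by the squared norm of a row of
  \<open>A\<close> times that of a column of \<open>B\<close>, and these bounds sum to a
  product.\<close>

lemma frob_norm_mult:
  assumes A: "A \<in> carrier_mat n m" and B: "B \<in> carrier_mat m p"
  shows "frob_norm (A * B) \<le> frob_norm A * frob_norm B"
proof -
  have row: "(\<Sum>j<p. ((A * B) $$ (i,j))\<^sup>2) \<le>
      (\<Sum>k<m. (A $$ (i,k))\<^sup>2) * (\<Sum>k<m. \<Sum>j<p. (B $$ (k,j))\<^sup>2)" if "i < n" for i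
  proof -
    have "((A * B) $$ (i,j))\<^sup>2 \<le> (\<Sum>k<m. (A $$ (i,k))\<^sup>2) * (\<Sum>k<m. (B $$ (k,j))\<^sup>2)"
      if "j < p" for j
    proof -
      have "(A * B) $$ (i,j) = (\<Sum>k<m. A $$ (i,k) * B $$ (k,j))"
        using assms \<open>i < n\<close> that by (auto simp: scalar_prod_def lessThan_atLeast0)
      then show ?thesis by (simp add: Cauchy_Schwarz_ineq_sum)
    qed
    then have "(\<Sum>j<p. ((A * B) $$ (i,j))\<^sup>2) \<le>
        (\<Sum>j<p. (\<Sum>k<m. (A $$ (i,k))\<^sup>2) * (\<Sum>k<m. (B $$ (k,j))\<^sup>2))"
      by (intro sum_mono) auto
    then show ?thesis
      by (simp flip: sum_distrib_left add: sum.swap[of _ "{..<p}" "{..<m}"])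
  qed
  have "(\<Sum>i<n. \<Sum>j<p. ((A * B) $$ (i,j))\<^sup>2) \<le>
      (\<Sum>i<n. (\<Sum>k<m. (A $$ (i,k))\<^sup>2) * (\<Sum>k<m. \<Sum>j<p. (B $$ (k,j))\<^sup>2))"
    using row by (intro sum_mono) auto
  then have "(\<Sum>i<n. \<Sum>j<p. ((A * B) $$ (i,j))\<^sup>2) \<le>
      (\<Sum>i<n. \<Sum>k<m. (A $$ (i,k))\<^sup>2) * (\<Sum>k<m. \<Sum>j<p. (B $$ (k,j))\<^sup>2)"
    by (simp flip: sum_distrib_right)
  then show ?thesis
    using assms unfolding frob_norm_def by (simp flip: real_sqrt_mult)
qed

lemma frob_norm_eq_0_iff: "frob_norm A = 0 \<longleftrightarrow> A = 0\<^sub>m (dim_row A) (dim_col A)"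
proof
  assume "frob_norm A = 0"
  then have "\<forall>i<dim_row A. \<forall>j<dim_col A. A $$ (i,j) = 0"
    unfolding frob_norm_def by (simp add: sum_nonneg_eq_0_iff sum_nonneg)
  then show "A = 0\<^sub>m (dim_row A) (dim_col A)" by (intro eq_matI) auto
next
  assume "A = 0\<^sub>m (dim_row A) (dim_col A)"
  moreover have "frob_norm (0\<^sub>m n m) = 0" for n m by (simp add: frob_norm_def)
  ultimately show "frob_norm A = 0" by metis
qed

lemma frob_inner_self_eq_0: "A \<in> carrier_mat n m \<Longrightarrow> frob_inner A A = 0 \<Longrightarrow> A = 0\<^sub>m n m"
  using frob_norm_eq_0_iff[of A] by (auto simp flip: frob_norm_square)

lemma minus_eq_zero_matD:
  fixes A :: "'a::group_add mat"
  assumes "A \<in> carrier_mat n m" "B \<in> carrier_mat n m" "A - B = 0\<^sub>m n m"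
  shows "A = B"
proof (intro eq_matI)
  fix i j assume "i < dim_row B" "j < dim_col B"
  then show "A $$ (i,j) = B $$ (i,j)"
    using assms(1,2) arg_cong[OF assms(3), of "\<lambda>C. C $$ (i,j)"] by simp
qed (use assms in auto)

lemma add_eq_add_imp_minus_eq_mat:
  fixes A :: "real mat"
  assumes "A \<in> carrier_mat n m" "B \<in> carrier_mat n m" "C \<in> carrier_mat n m" "D \<in> carrier_mat n m"
    and eq: "A + B = C + D"
  shows "A - C = D - B"
proof (intro eq_matI)
  fix i j assume "i < dim_row (D - B)" "j < dim_col (D - B)"
  then show "(A - C) $$ (i,j) = (D - B) $$ (i,j)"
    using assms(1-4) arg_cong[OF eq, of "\<lambda>M. M $$ (i,j)"] by auto
qed (use assms in auto)

section \<open>Spectral theorem for real symmetric matrices\<close>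

text \<open>A complex eigenpair satisfies \<open>k |z|\<^sup>2 = z\<^sup>* A z = cnj k |z|\<^sup>2\<close>.\<close>

lemma symmetric_real_eigenvalue_exists:
  fixes A :: "real mat"
  assumes A: "A \<in> carrier_mat n n" and sym: "A\<^sup>T = A" and n: "0 < n"
  shows "\<exists>k. eigenvalue A k"
proof -
  let ?c = "complex_of_real"
  let ?A = "map_mat ?c A"
  have cA: "?A \<in> carrier_mat n n" using A by simp
  have hom: "comm_ring_hom ?c" by unfold_locales auto
  obtain k where "eigenvalue ?A k"
    using spectrum_non_empty[OF cA n] by (auto simp: spectrum_def)
  then obtain z where z: "z \<in> carrier_vec n" "z \<noteq> 0\<^sub>v n" "?A *\<^sub>v z = k \<cdot>\<^sub>v z"
    using cA by (auto simp: eigenvalue_def eigenvector_def)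
  have sA: "A $$ (i,j) = A $$ (j,i)" if "i < n" "j < n" for i j
    using sym that A by (metis carrier_matD index_transpose_mat(1))
  have ev: "(\<Sum>j<n. ?c (A $$ (i,j)) * z $ j) = k * z $ i" if "i < n" for i
  proof -
    have "(?A *\<^sub>v z) $ i = (k \<cdot>\<^sub>v z) $ i" using z by simp
    then show ?thesis using A z(1) that by (simp add: scalar_prod_def lessThan_atLeast0)
  qed
  have "(\<Sum>i<n. cnj (z $ i) * (\<Sum>j<n. ?c (A $$ (i,j)) * z $ j))
      = (\<Sum>i<n. \<Sum>j<n. cnj (z $ i) * (?c (A $$ (i,j)) * z $ j))"
    by (simp add: sum_distrib_left)
  also have "\<dots> = (\<Sum>j<n. \<Sum>i<n. cnj (z $ i) * (?c (A $$ (i,j)) * z $ j))"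
    by (rule sum.swap)
  also have "\<dots> = (\<Sum>j<n. z $ j * cnj (\<Sum>i<n. ?c (A $$ (j,i)) * z $ i))"
    by (auto simp: sum_distrib_left intro!: sum.cong dest: sA)
  finally have "(\<Sum>i<n. cnj (z $ i) * (k * z $ i)) = (\<Sum>j<n. z $ j * cnj (k * z $ j))"
    using ev by simp
  then have "k * (\<Sum>i<n. z $ i * cnj (z $ i)) = cnj k * (\<Sum>i<n. z $ i * cnj (z $ i))"
    by (simp add: sum_distrib_left ac_simps)
  moreover have "(\<Sum>i<n. z $ i * cnj (z $ i)) \<noteq> 0"
  proof
    assume "(\<Sum>i<n. z $ i * cnj (z $ i)) = 0"
    then have "?c (\<Sum>i<n. (cmod (z $ i))\<^sup>2) = 0"
      by (simp only: of_real_sum complex_norm_square of_real_0)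
    then have "(\<Sum>i<n. (cmod (z $ i))\<^sup>2) = 0" by (simp only: of_real_eq_0_iff)
    then have "\<forall>i<n. z $ i = 0" by (simp add: sum_nonneg_eq_0_iff)
    then have "z = 0\<^sub>v n" using z by (intro eq_vecI) auto
    then show False using z by simp
  qed
  ultimately have "cnj k = k" by simp
  then obtain r where r: "k = ?c r" by (metis Reals_cases Reals_cnj_iff)
  have "poly (char_poly ?A) k = 0"
    using \<open>eigenvalue ?A k\<close> eigenvalue_root_char_poly[OF cA] by simp
  also have "char_poly ?A = map_poly ?c (char_poly A)"
    by (rule comm_ring_hom.char_poly_hom[OF hom A])
  finally have "poly (char_poly A) r = 0"
    unfolding r by simp
  then show ?thesis using eigenvalue_root_char_poly[OF A] by blast
qed

lemma orthogonal_mat_commute: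
  fixes U :: "real mat"
  assumes "U \<in> carrier_mat n n" "U\<^sup>T * U = 1\<^sub>m n"
  shows "U * U\<^sup>T = 1\<^sub>m n"
  using mat_mult_left_right_inverse[of "U\<^sup>T" n U] assms by simp

text \<open>The reflection in the hyperplane orthogonal to u - e, with e the first basis vector,
  exchanges the unit vectors u and e, so its first column is u. It completes u to an orthonormal
  basis without Gram-Schmidt. The reflection degenerates when u = e, where the identity serves
  instead.\<close>

lemma householder_exists:
  fixes u :: "real mat"
  assumes u: "u \<in> carrier_mat n 1" and nu: "u\<^sup>T * u = 1\<^sub>m 1" and n: "0 < n"
  shows "\<exists>H \<in> carrier_mat n n. H\<^sup>T = H \<and> H * H = 1\<^sub>m n \<and> col H 0 = col u 0"
proof -
  define e where "e = mat n 1 (\<lambda>(i,j). if i = 0 then 1 else 0 :: real)"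
  define z where "z = u - e"
  define s where "s = frob_inner z z"
  define H where "H = 1\<^sub>m n - (2 / s) \<cdot>\<^sub>m (z * z\<^sup>T)"
  have e: "e \<in> carrier_mat n 1" by (simp add: e_def)
  have z: "z \<in> carrier_mat n 1" using e by (simp add: z_def minus_carrier_mat)
  have H: "H \<in> carrier_mat n n" using z by (auto simp: H_def)
  have scal: "A\<^sup>T * B = frob_inner A B \<cdot>\<^sub>m 1\<^sub>m 1" if "A \<in> carrier_mat n 1" "B \<in> carrier_mat n 1" for A B
    using that by (intro eq_matI) (auto simp: frob_inner_def scalar_prod_def lessThan_atLeast0)
  have uu: "frob_inner u u = 1"
    using arg_cong[OF nu[unfolded scal[OF u u]], of "\<lambda>A. A $$ (0,0)"] by simp
  have ee: "frob_inner e e = 1"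
    using n by (simp add: frob_inner_def e_def if_distrib cong: if_cong)
  have ue: "frob_inner u e = u $$ (0,0)"
    using n u by (simp add: frob_inner_def e_def if_distrib cong: if_cong)
  have eu: "frob_inner e u = u $$ (0,0)" using ue frob_inner_commute[OF u e] by simp
  have s: "s = 2 - 2 * u $$ (0,0)"
    using frob_inner_minus_left[OF u e z] frob_inner_minus_right[OF u e u] frob_inner_minus_right[OF u e e]
    by (simp add: s_def uu ee ue eu flip: z_def)
  have sym: "H\<^sup>T = H"
    using z by (intro eq_matI) (auto simp: H_def scalar_prod_def)
  show ?thesis
  proof (cases "s = 0")
    case True
    then have "z = 0\<^sub>m n 1" using z s_def by (intro frob_inner_self_eq_0) auto
    then have "u = e" using u e by (intro minus_eq_zero_matD[of u n 1]) (auto simp: z_def)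
    then have "col (1\<^sub>m n) 0 = col u 0"
      using n by (intro eq_vecI) (auto simp: e_def)
    then show ?thesis by (intro bexI[of _ "1\<^sub>m n"]) auto
  next
    case False
    have zz: "z\<^sup>T * z = s \<cdot>\<^sub>m 1\<^sub>m 1" using scal[OF z z] by (simp add: s_def)
    have zzzz: "(z * z\<^sup>T) * (z * z\<^sup>T) = s \<cdot>\<^sub>m (z * z\<^sup>T)"
    proof -
      have "(z * z\<^sup>T) * (z * z\<^sup>T) = z * ((z\<^sup>T * z) * z\<^sup>T)"
        using z by (simp add: assoc_mult_mat[of _ n 1 _ n _ n] assoc_mult_mat[of _ 1 n _ 1 _ n])
      also have "\<dots> = s \<cdot>\<^sub>m (z * z\<^sup>T)"
        unfolding zz using z
        by (simp add: mult_smult_assoc_mat[of _ 1 1 _ n] mult_smult_distrib[of _ n 1 _ n])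
      finally show ?thesis .
    qed
    define Z where "Z = z * z\<^sup>T"
    have Z: "Z \<in> carrier_mat n n" using z by (simp add: Z_def)
    have "H * H = 1\<^sub>m n"
    proof -
      have "H * H = (1\<^sub>m n - (2/s) \<cdot>\<^sub>m Z) - (((2/s) \<cdot>\<^sub>m Z) - ((2/s) \<cdot>\<^sub>m Z) * ((2/s) \<cdot>\<^sub>m Z))"
        unfolding H_def Z_def[symmetric] using Z
        by (subst minus_mult_distrib_mat[of _ n n _ _ n], auto,
            subst mult_minus_distrib_mat[of _ n n _ n], auto)
      also have "((2/s) \<cdot>\<^sub>m Z) * ((2/s) \<cdot>\<^sub>m Z) = (4/s) \<cdot>\<^sub>m Z"
      proof -
        have "((2/s) \<cdot>\<^sub>m Z) * ((2/s) \<cdot>\<^sub>m Z) = (2/s) \<cdot>\<^sub>m ((2/s) \<cdot>\<^sub>m (Z * Z))"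
          using Z by (simp add: mult_smult_assoc_mat[of _ n n _ n] mult_smult_distrib[of _ n n _ n])
        then show ?thesis unfolding Z_def zzzz using False Z unfolding Z_def
          by (intro eq_matI) auto
      qed
      also have "(1\<^sub>m n - (2/s) \<cdot>\<^sub>m Z) - (((2/s) \<cdot>\<^sub>m Z) - (4/s) \<cdot>\<^sub>m Z) = 1\<^sub>m n"
        using Z by (intro eq_matI) (auto simp: field_simps)
      finally show ?thesis .
    qed
    moreover have "col H 0 = col u 0"
    proof (rule eq_vecI)
      fix i assume "i < dim_vec (col u 0)"
      then have i: "i < n" using u by simp
      \<comment> \<open>By this value the coefficient of z in H e = e - (2/s) z_0 z is exactly 1,
        and e + z = u.\<close>
      have "z $$ (0,0) = - s / 2" using n u e s by (simp add: z_def e_def)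
      then have "H $$ (i,0) = (if i = 0 then 1 else 0) + z $$ (i,0)"
        using i n z False by (simp add: H_def scalar_prod_def)
      also have "\<dots> = u $$ (i,0)" using i u by (simp add: z_def e_def)
      finally show "col H 0 $ i = col u 0 $ i" using i n u H by simp
    qed (use u H in auto)
    ultimately show ?thesis using H sym by blast
  qed
qed

text \<open>Deflation: conjugation by a Householder reflection whose first column is a unit
  eigenvector clears the first column below the diagonal and, by symmetry, the first row. The
  induction hypothesis diagonalizes the remaining symmetric block.\<close>

theorem symmetric_spectral_decomposition:
  fixes A :: "real mat"
  assumes "A \<in> carrier_mat n n" "A\<^sup>T = A"
  shows "\<exists>U \<in> carrier_mat n n. \<exists>d. U\<^sup>T * U = 1\<^sub>m n \<and> A = U * mat_diag n d * U\<^sup>T"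
  using assms
proof (induction n arbitrary: A)
  case 0
  then show ?case
    by (intro bexI[of _ "1\<^sub>m 0"] exI[of _ "\<lambda>_. 0"]) (auto intro!: eq_matI)
next
  case (Suc n)
  let ?n = "Suc n"
  note A = Suc.prems(1) and sym = Suc.prems(2)
  obtain k where "eigenvalue A k"
    using symmetric_real_eigenvalue_exists[OF A sym] by auto
  then obtain x where x: "x \<in> carrier_vec ?n" "x \<noteq> 0\<^sub>v ?n" "A *\<^sub>v x = k \<cdot>\<^sub>v x"
    using A by (auto simp: eigenvalue_def eigenvector_def)
  define c where "c = sqrt (\<Sum>i<?n. (x $ i)\<^sup>2)"
  have c2: "c\<^sup>2 = (\<Sum>i<?n. (x $ i)\<^sup>2)"
    unfolding c_def by (intro real_sqrt_pow2 sum_nonneg zero_le_power2)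
  have c0: "c \<noteq> 0"
  proof
    assume "c = 0"
    then have "\<forall>i<?n. x $ i = 0" using c2 by (subst (asm) eq_commute)
        (simp add: sum_nonneg_eq_0_iff del: sum.lessThan_Suc)
    then have "x = 0\<^sub>v ?n" using x(1) by (intro eq_vecI) auto
    then show False using x by simp
  qed
  define u where "u = mat ?n 1 (\<lambda>(i,j). x $ i / c)"
  have u: "u \<in> carrier_mat ?n 1" by (simp add: u_def)
  have "u\<^sup>T * u = 1\<^sub>m 1"
  proof (intro eq_matI, goal_cases)
    case (1 i j)
    then have "(u\<^sup>T * u) $$ (i,j) = (\<Sum>i<?n. (x $ i / c) * (x $ i / c))"
      by (simp add: u_def scalar_prod_def lessThan_atLeast0 del: sum.lessThan_Suc sum.op_ivl_Suc)
    also have "\<dots> = (\<Sum>i<?n. (x $ i)\<^sup>2) / c\<^sup>2"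
      unfolding sum_divide_distrib by (simp only: times_divide_times_eq power2_eq_square)
    finally show ?case using 1 c0 unfolding c2[symmetric] by simp
  qed (auto simp: u_def)
  then obtain H where H: "H \<in> carrier_mat ?n ?n" "H\<^sup>T = H" "H * H = 1\<^sub>m ?n" "col H 0 = col u 0"
    using householder_exists[OF u] by auto
  have Au: "A * u = k \<cdot>\<^sub>m u"
  proof (intro eq_matI, goal_cases)
    case (1 i j)
    then have i: "i < ?n" by (simp add: u_def)
    have "(A *\<^sub>v x) $ i = k * x $ i" using x i by simp
    then have "(\<Sum>j<?n. A $$ (i,j) * x $ j) = k * x $ i"
      using A x(1) i by (simp add: scalar_prod_def lessThan_atLeast0 del: sum.lessThan_Suc sum.op_ivl_Suc)
    then have "(\<Sum>j<?n. A $$ (i,j) * x $ j / c) = k * x $ i / c"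
      by (simp only: flip: sum_divide_distrib)
    then show ?case using 1 A
      by (simp add: u_def scalar_prod_def lessThan_atLeast0 del: sum.lessThan_Suc sum.op_ivl_Suc)
  qed (use A in \<open>auto simp: u_def\<close>)
  define e where "e = mat ?n 1 (\<lambda>(i,j). if i = 0 then 1 else 0 :: real)"
  have e: "e \<in> carrier_mat ?n 1" by (simp add: e_def)
  have mult_e: "(B * e) $$ (i,0) = B $$ (i,0)" if "B \<in> carrier_mat ?n ?n" "i < ?n" for B i
    using that by (simp add: e_def scalar_prod_def if_distrib cong: if_cong del: sum.op_ivl_Suc)
  have He: "H * e = u"
  proof (intro eq_matI, goal_cases)
    case (1 i j)
    then show ?case
      using mult_e[OF H(1), of i] u H(1) arg_cong[OF H(4), of "\<lambda>v. v $ i"] by simp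
  qed (use H e u in auto)
  have Hu: "H * u = e"
    using assoc_mult_mat[OF H(1) H(1) e] e by (simp add: H(3) He)
  define S where "S = H * A * H"
  have S: "S \<in> carrier_mat ?n ?n" using H A by (simp add: S_def)
  have "S * e = H * (A * (H * e))"
    unfolding S_def using H(1) A e by (simp add: assoc_mult_mat[of _ ?n ?n _ ?n _ 1] assoc_mult_mat[of _ ?n ?n _ ?n _ ?n])
  also have "\<dots> = k \<cdot>\<^sub>m e"
    unfolding He Au using H(1) u by (simp add: mult_smult_distrib[of _ ?n ?n _ 1] Hu)
  finally have Se: "S * e = k \<cdot>\<^sub>m e" .
  have S0: "S $$ (i,0) = (if i = 0 then k else 0)" if "i < ?n" for i
    using mult_e[OF S that] that unfolding Se by (auto simp: e_def)
  have symS: "S\<^sup>T = S"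
    unfolding S_def using H(1,2) A sym
    by (simp add: transpose_mult[of _ ?n ?n _ ?n] assoc_mult_mat[of _ ?n ?n _ ?n _ ?n])
  have S0': "S $$ (0,i) = (if i = 0 then k else 0)" if "i < ?n" for i
    using S0[OF that] that S arg_cong[OF symS, of "\<lambda>B. B $$ (0,i)"] by simp
  define S2 where "S2 = mat n n (\<lambda>(i,j). S $$ (Suc i, Suc j))"
  have S2: "S2 \<in> carrier_mat n n" by (simp add: S2_def)
  have "S2\<^sup>T = S2"
  proof (intro eq_matI, goal_cases)
    case (1 i j)
    then show ?case using S arg_cong[OF symS, of "\<lambda>B. B $$ (Suc i, Suc j)"] by (simp add: S2_def)
  qed (auto simp: S2_def)
  then obtain V d where V: "V \<in> carrier_mat n n" "V\<^sup>T * V = 1\<^sub>m n" "S2 = V * mat_diag n d * V\<^sup>T"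
    using Suc.IH[OF S2] by auto
  define k1 where "k1 = mat 1 1 (\<lambda>_. k)"
  have k1: "k1 \<in> carrier_mat 1 1" by (simp add: k1_def)
  define V1 where "V1 = four_block_mat (1\<^sub>m 1) (0\<^sub>m 1 n) (0\<^sub>m n 1) V"
  define D where "D = mat_diag ?n (\<lambda>i. if i = 0 then k else d (i - 1))"
  have V1: "V1 \<in> carrier_mat ?n ?n"
    using four_block_carrier_mat[of "1\<^sub>m 1" 1 1 V n n] V(1) unfolding V1_def by simp
  have V1T: "V1\<^sup>T = four_block_mat (1\<^sub>m 1) (0\<^sub>m 1 n) (0\<^sub>m n 1) (V\<^sup>T)"
    unfolding V1_def using V(1) by (subst transpose_four_block_mat[of _ 1 1 _ n _ n]) auto
  have D: "D = four_block_mat k1 (0\<^sub>m 1 n) (0\<^sub>m n 1) (mat_diag n d)"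
    by (intro eq_matI) (auto simp: D_def k1_def mat_diag_def)
  have Dc: "D \<in> carrier_mat ?n ?n" by (simp add: D_def)
  have VD: "V * mat_diag n d \<in> carrier_mat n n" using V(1) by simp
  have "S = four_block_mat k1 (0\<^sub>m 1 n) (0\<^sub>m n 1) S2"
    using S S0 S0' by (intro eq_matI) (auto simp: k1_def S2_def)
  moreover have "V1 * D = four_block_mat k1 (0\<^sub>m 1 n) (0\<^sub>m n 1) (V * mat_diag n d)"
    unfolding V1_def D using V(1) k1
    by (subst mult_four_block_mat[of _ 1 1 _ n _ n _ _ 1 _ n])
       (auto simp: left_mult_zero_mat[OF mat_diag_dim])
  moreover have "\<dots> * V1\<^sup>T = four_block_mat k1 (0\<^sub>m 1 n) (0\<^sub>m n 1) (V * mat_diag n d * V\<^sup>T)"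
    unfolding V1T using V(1) k1 VD
    by (subst mult_four_block_mat[of _ 1 1 _ n _ n _ _ 1 _ n])
       (auto simp: right_mult_zero_mat[OF VD] left_add_zero_mat[of _ n n])
  ultimately have S_eq: "S = V1 * D * V1\<^sup>T" using V(3) by simp
  have V1o: "V1\<^sup>T * V1 = 1\<^sub>m ?n"
    unfolding V1T unfolding V1_def using V(1,2)
    by (subst mult_four_block_mat[of _ 1 1 _ n _ n _ _ 1 _ n])
       (use four_block_one_mat[of 1 n, where 'a = real] in auto)
  define U where "U = H * V1"
  have U: "U \<in> carrier_mat ?n ?n" using H V1 by (simp add: U_def)
  have UT: "U\<^sup>T = V1\<^sup>T * H" using H V1 by (simp add: U_def transpose_mult[of _ ?n ?n _ ?n])
  have HH: "H * (H * B) = B" if "B \<in> carrier_mat ?n m" for B m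
    using assoc_mult_mat[OF H(1) H(1) that] that by (simp add: H(3))
  have "U\<^sup>T * U = 1\<^sub>m ?n"
    unfolding UT unfolding U_def using H V1 V1o
    by (simp add: assoc_mult_mat[of _ ?n ?n _ ?n _ ?n] HH[of _ ?n])
  moreover have "A = H * S * H"
    unfolding S_def using H A
    by (simp add: assoc_mult_mat[of _ ?n ?n _ ?n _ ?n] HH[of _ ?n])
  then have "A = U * D * U\<^sup>T"
    unfolding S_eq UT unfolding U_def using H V1 Dc
    by (simp add: assoc_mult_mat[of _ ?n ?n _ ?n _ ?n])
  ultimately show ?case using U D_def by blast
qed

text \<open>Connects \<open>eig_desc\<close>, which reads eigenvalues off the characteristic
  polynomial, with an arbitrary diagonalization. Only multisets are compared, so the order of the
  diagonal does not matter.\<close>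

lemma proots_char_poly_of_spectral:
  fixes A :: "real mat"
  assumes U: "U \<in> carrier_mat n n" "U\<^sup>T * U = 1\<^sub>m n" and A: "A = U * mat_diag n d * U\<^sup>T"
  shows "proots (char_poly A) = mset (map d [0..<n])"
proof -
  have "similar_mat A (mat_diag n d)"
    by (rule similar_matI[of _ _ U "U\<^sup>T" n])
       (use U A orthogonal_mat_commute[OF U] in auto)
  then have "char_poly A = char_poly (mat_diag n d)" by (rule char_poly_similar)
  also have "\<dots> = (\<Prod>a\<leftarrow>diag_mat (mat_diag n d). [:- a, 1:])"
    by (rule char_poly_upper_triangular[of _ n]) (auto simp: mat_diag_def)
  also have "diag_mat (mat_diag n d) = map d [0..<n]"
    by (auto simp: diag_mat_def mat_diag_def)
  also have "proots (\<Prod>a\<leftarrow>map d [0..<n]. [:- a, 1:]) = mset (map d [0..<n])"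
  proof -
    have "proots (\<Prod>a\<leftarrow>xs. [:- a, 1:]) = mset xs" for xs :: "real list"
    proof (induction xs)
      case (Cons a xs)
      have "(\<Prod>a\<leftarrow>xs. [:- a, 1:]) \<noteq> 0" by (auto simp: prod_list_zero_iff)
      then show ?case using Cons by (simp add: proots_mult del: mult_pCons_left)
    qed simp
    then show ?thesis .
  qed
  finally show ?thesis .
qed

section \<open>Pseudoinverse and projections\<close>

text \<open>The symmetry conditions force AB = AC and BA = CA, whence B = BAB = CAB = CAC = C.
  Uniqueness is what gives the definite description in \<open>pinv\<close> its meaning.\<close>

lemma moore_penrose_unique:
  fixes A B C :: "real mat"
  assumes A: "A \<in> carrier_mat n m" and B: "B \<in> carrier_mat m n" and C: "C \<in> carrier_mat m n"
    and B_inv: "A * B * A = A" "B * A * B = B" "(A * B)\<^sup>T = A * B" "(B * A)\<^sup>T = B * A"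
    and C_inv: "A * C * A = A" "C * A * C = C" "(A * C)\<^sup>T = A * C" "(C * A)\<^sup>T = C * A"
  shows "B = C"
proof -
  have AB: "A * B \<in> carrier_mat n n" and AC: "A * C \<in> carrier_mat n n"
    and BA: "B * A \<in> carrier_mat m m" and CA: "C * A \<in> carrier_mat m m" using A B C by auto
  have "A * B = ((A * C * A) * B)\<^sup>T" by (simp add: C_inv B_inv)
  also have "(A * C * A) * B = (A * C) * (A * B)" by (rule assoc_mult_mat[OF AC A B])
  also have "((A * C) * (A * B))\<^sup>T = (A * B) * (A * C)" by (simp add: transpose_mult[OF AC AB] B_inv C_inv)
  also have "\<dots> = (A * B * A) * C" by (rule assoc_mult_mat[OF AB A C, symmetric])
  finally have 1: "A * B = A * C" by (simp add: B_inv)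
  have "B * A = (B * (A * C * A))\<^sup>T" by (simp add: C_inv B_inv)
  also have "B * (A * C * A) = (B * A) * (C * A)"
    using A B C by (simp add: assoc_mult_mat[OF B A CA] assoc_mult_mat[OF A C A])
  also have "((B * A) * (C * A))\<^sup>T = (C * A) * (B * A)" by (simp add: transpose_mult[OF BA CA] B_inv C_inv)
  also have "\<dots> = C * (A * B * A)"
    using A B C by (simp add: assoc_mult_mat[OF C A BA] assoc_mult_mat[OF A B A])
  finally have 2: "B * A = C * A" by (simp add: B_inv)
  have "B = B * A * B" by (simp add: B_inv)
  also have "\<dots> = C * (A * B)" unfolding 2 by (rule assoc_mult_mat[OF C A B])
  also have "\<dots> = C * A * C" unfolding 1 by (rule assoc_mult_mat[OF C A C, symmetric])
  finally show ?thesis by (simp add: C_inv)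
qed

text \<open>Functions of one diagonalized matrix multiply pointwise on the spectrum, which turns the
  Penrose equations into scalar identities.\<close>

lemma mult_spectral:
  fixes U :: "real mat"
  assumes U: "U \<in> carrier_mat n n" "U\<^sup>T * U = 1\<^sub>m n"
  shows "(U * mat_diag n f * U\<^sup>T) * (U * mat_diag n g * U\<^sup>T) = U * mat_diag n (\<lambda>i. f i * g i) * U\<^sup>T"
proof -
  define F where "F = mat_diag n f"
  define G where "G = mat_diag n g"
  have FG: "F \<in> carrier_mat n n" "G \<in> carrier_mat n n" by (simp_all add: F_def G_def)
  have "(U * F * U\<^sup>T) * (U * G * U\<^sup>T) = U * F * ((U\<^sup>T * U) * (G * U\<^sup>T))"
    using U(1) FG by (simp add: mult_mat_assoc_dim)
  also have "\<dots> = U * (F * G) * U\<^sup>T"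
    using U FG by (simp add: mult_mat_assoc_dim)
  finally show ?thesis by (simp add: F_def G_def)
qed

lemma transpose_spectral:
  fixes U :: "real mat"
  assumes U: "U \<in> carrier_mat n n"
  shows "(U * mat_diag n f * U\<^sup>T)\<^sup>T = U * mat_diag n f * U\<^sup>T"
proof -
  have "(mat_diag n f)\<^sup>T = mat_diag n f" by (intro eq_matI) (auto simp: mat_diag_def)
  then show ?thesis
    using U by (simp add: transpose_mult_dim mult_mat_assoc_dim mat_diag_def)
qed

text \<open>Since \<open>inverse 0 = 0\<close>, inverting the diagonal entrywise already leaves zero
  eigenvalues at zero, as the pseudoinverse must.\<close>

lemma pinv_spectral:
  fixes U :: "real mat"
  assumes U: "U \<in> carrier_mat n n" "U\<^sup>T * U = 1\<^sub>m n"
  shows "pinv (U * mat_diag n d * U\<^sup>T) = U * mat_diag n (\<lambda>i. inverse (d i)) * U\<^sup>T"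
    (is "pinv ?S = ?P")
  unfolding pinv_def
proof (rule the_equality)
  have S: "?S \<in> carrier_mat n n" and P: "?P \<in> carrier_mat n n" using U by auto
  have dd: "d i * inverse (d i) * d i = d i" "inverse (d i) * d i * inverse (d i) = inverse (d i)" for i
    by (cases "d i = 0"; simp)+
  have 1: "?S * ?P * ?S = ?S" "?P * ?S * ?P = ?P"
    "(?S * ?P)\<^sup>T = ?S * ?P" "(?P * ?S)\<^sup>T = ?P * ?S"
    unfolding mult_spectral[OF U] transpose_spectral[OF U(1)] dd by auto
  then show "?P \<in> carrier_mat (dim_col ?S) (dim_row ?S) \<and> ?S * ?P * ?S = ?S \<and> ?P * ?S * ?P = ?P \<and>
      (?S * ?P)\<^sup>T = ?S * ?P \<and> (?P * ?S)\<^sup>T = ?P * ?S"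
    unfolding carrier_matD[OF S] using P by (intro conjI)
  fix B
  assume "B \<in> carrier_mat (dim_col ?S) (dim_row ?S) \<and> ?S * B * ?S = ?S \<and> B * ?S * B = B \<and>
      (?S * B)\<^sup>T = ?S * B \<and> (B * ?S)\<^sup>T = B * ?S"
  then show "B = ?P"
    unfolding carrier_matD[OF S] using P 1 by (elim conjE) (rule moore_penrose_unique[OF S])
qed

lemma pinv_symmetric:
  assumes "S \<in> carrier_mat n n" "S\<^sup>T = S"
  shows "pinv S \<in> carrier_mat n n" "(pinv S)\<^sup>T = pinv S" "S * pinv S * S = S"
    "pinv S * S * pinv S = pinv S" "(pinv S * S)\<^sup>T = pinv S * S"
proof -
  obtain U d where U: "U \<in> carrier_mat n n" "U\<^sup>T * U = 1\<^sub>m n" and S: "S = U * mat_diag n d * U\<^sup>T"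
    using symmetric_spectral_decomposition[OF assms] by auto
  have dd: "d i * inverse (d i) * d i = d i" "inverse (d i) * d i * inverse (d i) = inverse (d i)" for i
    by (cases "d i = 0"; simp)+
  show "pinv S \<in> carrier_mat n n" "(pinv S)\<^sup>T = pinv S" "S * pinv S * S = S"
    "pinv S * S * pinv S = pinv S" "(pinv S * S)\<^sup>T = pinv S * S"
    unfolding S pinv_spectral[OF U] mult_spectral[OF U] transpose_spectral[OF U(1)] dd
    using U by auto
qed

text \<open>The orthogonal projector onto the column space of \<open>A\<close>. The pseudoinverse
  keeps this true when the columns are linearly dependent.\<close>

definition col_proj :: "real mat \<Rightarrow> real mat" where
  "col_proj A = A * pinv (A\<^sup>T * A) * A\<^sup>T"

lemma annih_eq: "A \<in> carrier_mat n q \<Longrightarrow> annih A = 1\<^sub>m n - col_proj A"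
  by (simp add: annih_def col_proj_def)

context
  fixes A :: "real mat" and n q :: nat
  assumes A: "A \<in> carrier_mat n q"
begin

private lemma gram: "A\<^sup>T * A \<in> carrier_mat q q" "(A\<^sup>T * A)\<^sup>T = A\<^sup>T * A"
  using A by (auto simp: transpose_mult[of _ q n _ q])

private lemmas P = pinv_symmetric[OF gram]

lemma col_proj_carrier [simp]: "col_proj A \<in> carrier_mat n n"
  using A P(1) by (simp add: col_proj_def)

lemma col_proj_transpose: "(col_proj A)\<^sup>T = col_proj A"
proof -
  define P where "P = pinv (A\<^sup>T * A)"
  have P: "P \<in> carrier_mat q q" "P\<^sup>T = P" using P(1,2) by (simp_all add: P_def)
  have AT: "A\<^sup>T \<in> carrier_mat q n" and AP: "A * P \<in> carrier_mat n q" using A P by auto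
  show ?thesis
    unfolding col_proj_def P_def[symmetric] transpose_mult[OF AP AT] transpose_mult[OF A P(1)]
    using assoc_mult_mat[OF A P(1) AT] by (simp add: P(2))
qed

text \<open>For S = A'A, P its pseudoinverse and Z = A - A P S, the identity S P S = S gives A'Z =
  0. As Z is itself A times a matrix, Z is orthogonal to itself and vanishes; full column rank is
  not involved.\<close>

lemma col_proj_mult_self: "col_proj A * A = A"
proof -
  define S where "S = A\<^sup>T * A"
  define P where "P = pinv S"
  have S: "S \<in> carrier_mat q q" and P: "P \<in> carrier_mat q q" "S * P * S = S"
    using gram(1) P(1,3) by (simp_all add: S_def P_def)
  define Z where "Z = A - A * (P * S)"
  have PS: "P * S \<in> carrier_mat q q" using P(1) S by auto
  have Z: "Z \<in> carrier_mat n q"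
    unfolding Z_def by (rule minus_carrier_mat[OF mult_carrier_mat[OF A PS]])
  have "A\<^sup>T * Z = S - S * (P * S)"
    unfolding Z_def using A PS
    by (subst mult_minus_distrib_mat[of _ q n _ q]) (auto simp: S_def mult_mat_assoc_dim)
  also have "S * (P * S) = S"
    using P(2) assoc_mult_mat[OF S P(1) S] by simp
  finally have AZ: "A\<^sup>T * Z = 0\<^sub>m q q" using S by auto
  have "frob_inner (A * (P * S)) Z = frob_inner (P * S) (A\<^sup>T * Z)"
    using A PS Z by (intro frob_inner_mult_left)
  also have "\<dots> = 0" unfolding AZ by (rule frob_inner_zero_right[OF PS])
  finally have 1: "frob_inner (A * (P * S)) Z = 0" .
  have "frob_inner (A * 1\<^sub>m q) Z = frob_inner (1\<^sub>m q) (A\<^sup>T * Z)"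
    using A Z by (intro frob_inner_mult_left) auto
  also have "\<dots> = 0" unfolding AZ by (simp add: frob_inner_def)
  finally have "frob_inner A Z = 0" using A by simp
  with 1 have "frob_inner Z Z = 0"
    using frob_inner_minus_left[of A n q "A * (P * S)" Z] A PS Z by (simp flip: Z_def)
  then have "A - A * (P * S) = 0\<^sub>m n q" using frob_inner_self_eq_0[OF Z] by (simp add: Z_def)
  then have "A * (P * S) = A"
    using A PS minus_eq_zero_matD[of A n q "A * (P * S)"] by simp
  moreover have "A * P * A\<^sup>T * A = A * (P * S)"
    unfolding S_def using A P(1)
    by (simp add: assoc_mult_mat[of _ n q _ n _ q] assoc_mult_mat[of _ n q _ q _ q]
        assoc_mult_mat[of _ q q _ n _ q])
  ultimately show ?thesis by (simp add: col_proj_def P_def S_def)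
qed

lemma col_proj_idem: "col_proj A * col_proj A = col_proj A"
proof -
  have "col_proj A * (A * pinv (A\<^sup>T * A) * A\<^sup>T) = (col_proj A * A) * pinv (A\<^sup>T * A) * A\<^sup>T"
    using A P(1) by (simp add: assoc_mult_mat[of _ n n _ q _ n] assoc_mult_mat[of _ n n _ q _ q]
        assoc_mult_mat[of _ n q _ q _ n])
  then show ?thesis unfolding col_proj_mult_self by (simp add: col_proj_def)
qed

text \<open>The left side is the trace of the projector; symmetry and idempotence turn it into a
  squared norm.\<close>

lemma col_proj_trace: "frob_inner (1\<^sub>m n) (col_proj A) = (frob_norm (col_proj A))\<^sup>2"
  using frob_inner_mult_left[of "col_proj A" n n "1\<^sub>m n" n "col_proj A"]
  by (simp add: frob_norm_square right_mult_one_mat[OF col_proj_carrier] col_proj_transpose col_proj_idem)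

text \<open>A rank bound stated through the norm. The trace of the projector equals that of the
  \<open>q\<close> by \<open>q\<close> matrix G = P S, again a symmetric idempotent; then tr G =
  ||G||_F^2, and Cauchy-Schwarz against the identity gives at most q.\<close>

lemma frob_norm_col_proj_le: "(frob_norm (col_proj A))\<^sup>2 \<le> real q"
proof -
  define S where "S = A\<^sup>T * A"
  define P where "P = pinv S"
  have S: "S \<in> carrier_mat q q"
    and P: "P \<in> carrier_mat q q" "P\<^sup>T = P" "P * S * P = P" "(P * S)\<^sup>T = P * S"
    using gram(1) P(1,2,4,5) by (simp_all add: S_def P_def)
  define G where "G = P * S"
  have G: "G \<in> carrier_mat q q" "G\<^sup>T = G" using P(1,4) S by (auto simp: G_def)
  have "G * G = (P * S * P) * S"
    unfolding G_def using P(1) S by (simp add: assoc_mult_mat[of _ q q _ q _ q])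
  then have GG: "G * G = G" by (simp add: P(3) G_def)
  have "A * P * A\<^sup>T = A * (P * A\<^sup>T)"
    using A P(1) by (intro assoc_mult_mat) auto
  then have "frob_inner (col_proj A) (1\<^sub>m n) = frob_inner (A * (P * A\<^sup>T)) (1\<^sub>m n)"
    by (simp add: col_proj_def P_def S_def)
  also have "\<dots> = frob_inner (P * A\<^sup>T) (A\<^sup>T * 1\<^sub>m n)"
    using A P(1) by (intro frob_inner_mult_left) auto
  also have "\<dots> = frob_inner P S"
    using A P(1) by (subst frob_inner_mult_right[of _ q q _ n]) (auto simp: S_def)
  also have "\<dots> = frob_inner (1\<^sub>m q) G"
    using frob_inner_mult_left[of P q q S q "1\<^sub>m q"] P(1,2) S
      frob_inner_commute[of P q q S] frob_inner_commute[of G q q "1\<^sub>m q"] G(1)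
    by (simp add: G_def)
  finally have tr: "frob_inner (col_proj A) (1\<^sub>m n) = frob_inner (1\<^sub>m q) G" .
  have one: "(frob_norm (1\<^sub>m q))\<^sup>2 = real q"
    by (simp add: frob_norm_square frob_inner_def if_distrib cong: if_cong)
  have "frob_inner (1\<^sub>m q) G = frob_inner G G"
    using frob_inner_mult_left[of G q q "1\<^sub>m q" q G] G GG by simp
  also have "\<dots> = (frob_norm G)\<^sup>2" by (simp add: frob_norm_square)
  finally have tG: "frob_inner (1\<^sub>m q) G = (frob_norm G)\<^sup>2" .
  have "(frob_norm G)\<^sup>2 \<le> frob_norm (1\<^sub>m q) * frob_norm G"
    using frob_inner_Cauchy_Schwarz[of "1\<^sub>m q" q q G] G by (simp add: tG)
  then have "frob_norm G \<le> frob_norm (1\<^sub>m q)"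
    using frob_norm_nonneg[of G] frob_norm_nonneg[of "1\<^sub>m q"]
    by (cases "frob_norm G = 0") (auto simp: power2_eq_square)
  then have "(frob_norm G)\<^sup>2 \<le> real q"
    unfolding one[symmetric] by (intro power_mono) auto
  then show ?thesis
    using tr tG col_proj_trace frob_inner_commute[OF col_proj_carrier, of "1\<^sub>m n"] by simp
qed

lemma annih_carrier [simp]: "annih A \<in> carrier_mat n n"
  using minus_carrier_mat[OF col_proj_carrier] by (simp add: annih_eq[OF A])

lemma annih_transpose: "(annih A)\<^sup>T = annih A"
  using A transpose_minus[OF one_carrier_mat col_proj_carrier] by (simp add: annih_eq col_proj_transpose)

lemma annih_mult_self: "annih A * A = 0\<^sub>m n q"
  using A by (simp add: annih_eq minus_mult_distrib_mat[OF one_carrier_mat col_proj_carrier A] col_proj_mult_self)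

lemma annih_idem: "annih A * annih A = annih A"
proof -
  have "annih A * annih A = annih A - annih A * col_proj A"
    using A mult_minus_distrib_mat[OF annih_carrier one_carrier_mat col_proj_carrier]
      right_mult_one_mat[OF annih_carrier]
    by (simp add: annih_eq)
  also have "annih A * col_proj A = 0\<^sub>m n n"
    using A P(1) annih_mult_self unfolding col_proj_def
    by (simp flip: assoc_mult_mat[OF annih_carrier, of _ q _ n] assoc_mult_mat[OF annih_carrier, of _ q _ q])
  finally show ?thesis
    using annih_carrier by (simp add: minus_zero_mat[OF annih_carrier])
qed

lemma frob_norm_annih_mult_sq:
  assumes "Z \<in> carrier_mat n m"
  shows "(frob_norm (annih A * Z))\<^sup>2 = frob_inner Z (annih A * Z)"
proof -
  have "frob_inner (annih A * Z) (annih A * Z) = frob_inner Z ((annih A)\<^sup>T * (annih A * Z))"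
    by (intro frob_inner_mult_left[OF annih_carrier assms] mult_carrier_mat[OF annih_carrier assms])
  also have "(annih A)\<^sup>T * (annih A * Z) = (annih A * annih A) * Z"
    using assoc_mult_mat[OF annih_carrier annih_carrier assms] by (simp add: annih_transpose)
  finally show ?thesis by (simp add: frob_norm_square annih_idem)
qed

lemma frob_norm_annih_mult_le:
  assumes "Z \<in> carrier_mat n m"
  shows "frob_norm (annih A * Z) \<le> frob_norm Z"
proof -
  have "(frob_norm (annih A * Z))\<^sup>2 \<le> frob_norm Z * frob_norm (annih A * Z)"
    unfolding frob_norm_annih_mult_sq[OF assms]
    using frob_inner_Cauchy_Schwarz[of Z n m "annih A * Z"] assms mult_carrier_mat[OF annih_carrier assms] by simp
  then show ?thesis
    using frob_norm_nonneg[of "annih A * Z"] frob_norm_nonneg[of Z]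
    by (cases "frob_norm (annih A * Z) = 0") (auto simp: power2_eq_square)
qed

end

section \<open>Eigenvalue sums and low-rank approximation\<close>

text \<open>With \<open>t\<close> the entry of (zero-based) index \<open>q\<close> of the decreasing arrangement, the tail sum equals
  \<open>(\<Sum>i. min (d i) t) - q t\<close>, which does not depend on how the \<open>d i\<close> are ordered.\<close>

lemma sorted_tail_sum_le_weighted:
  fixes d m :: "nat \<Rightarrow> real"
  assumes d: "\<And>i. i < N \<Longrightarrow> 0 \<le> d i" and m: "\<And>i. i < N \<Longrightarrow> 0 \<le> m i" "\<And>i. i < N \<Longrightarrow> m i \<le> 1"
    and tot: "real N - real q \<le> (\<Sum>i<N. m i)"
  shows "(\<Sum>i\<in>{q..<N}. rev (sorted_list_of_multiset (mset (map d [0..<N]))) ! i) \<le> (\<Sum>i<N. d i * m i)"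
proof (cases "q < N")
  case False
  then show ?thesis using d m by (auto intro!: sum_nonneg)
next
  case True
  define s where "s = sorted_list_of_multiset (mset (map d [0..<N]))"
  define xs where "xs = rev s"
  define t where "t = xs ! q"
  have ms: "mset xs = mset (map d [0..<N])" by (simp add: xs_def s_def)
  then have len: "length xs = N" by (metis length_map length_upt minus_nat.diff_0 size_mset)
  have "sorted s" by (simp add: s_def)
  then have dec: "xs ! j \<le> xs ! i" if "i \<le> j" "j < N" for i j
    using that len by (auto simp: xs_def rev_nth intro!: sorted_nth_mono)
  have "t \<in> set xs" using True len by (simp add: t_def)
  then have "t \<in> set (map d [0..<N])" using ms by (metis set_mset_mset)
  then have t0: "0 \<le> t" using d by auto
  have "(\<Sum>i<N. min (d i) t) = sum_list (map (\<lambda>x. min x t) (map d [0..<N]))"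
    by (simp add: interv_sum_list_conv_sum_set_nat comp_def lessThan_atLeast0)
  also have "\<dots> = sum_mset (image_mset (\<lambda>x. min x t) (mset (map d [0..<N])))"
    by (simp only: sum_mset_sum_list flip: mset_map)
  also have "\<dots> = sum_list (map (\<lambda>x. min x t) xs)"
    unfolding ms[symmetric] by (simp only: sum_mset_sum_list flip: mset_map)
  also have "\<dots> = (\<Sum>i<N. min (xs ! i) t)"
    by (simp add: sum_list_sum_nth len lessThan_atLeast0)
  also have "\<dots> = (\<Sum>i<q. min (xs ! i) t) + (\<Sum>i\<in>{q..<N}. min (xs ! i) t)"
    using True by (simp add: lessThan_atLeast0 sum.atLeastLessThan_concat)
  also have "(\<Sum>i<q. min (xs ! i) t) = (\<Sum>i<q. t)"
    using dec True by (intro sum.cong) (auto simp: t_def min_absorb2)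
  also have "(\<Sum>i\<in>{q..<N}. min (xs ! i) t) = (\<Sum>i\<in>{q..<N}. xs ! i)"
    using dec by (intro sum.cong) (auto simp: t_def min_absorb1)
  finally have tail: "(\<Sum>i\<in>{q..<N}. xs ! i) = (\<Sum>i<N. min (d i) t) - real q * t" by simp
  \<comment> \<open>Splitting \<open>min (d i) t\<close> with weights \<open>m i\<close> and
    \<open>1 - m i\<close> bounds it by \<open>d i * m i + t * (1 - m i)\<close>. The weights
    \<open>1 - m i\<close> have total at most q, which matches the term q t of the tail.\<close>
  have "(\<Sum>i<N. min (d i) t - t * (1 - m i)) \<le> (\<Sum>i<N. d i * m i)"
  proof (rule sum_mono)
    fix i assume "i \<in> {..<N}"
    then have i: "i < N" by simp
    have "min (d i) t * (1 - m i) \<le> t * (1 - m i)" using m[OF i] by (intro mult_right_mono) auto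
    moreover have "min (d i) t * m i \<le> d i * m i" using m[OF i] by (intro mult_right_mono) auto
    ultimately show "min (d i) t - t * (1 - m i) \<le> d i * m i" by (simp add: algebra_simps)
  qed
  moreover have "t * (real N - (\<Sum>i<N. m i)) \<le> t * real q" using t0 tot by (intro mult_left_mono) auto
  ultimately show ?thesis
    unfolding tail[unfolded xs_def s_def]
    by (simp add: sum_subtractf flip: sum_distrib_left) (simp add: algebra_simps)
qed

lemma transpose_mult_self_diag:
  fixes A :: "real mat"
  assumes "A \<in> carrier_mat n m" "i < m"
  shows "(A\<^sup>T * A) $$ (i,i) = (\<Sum>k<n. (A $$ (k,i))\<^sup>2)"
  using assms by (simp add: scalar_prod_def power2_eq_square lessThan_atLeast0)

lemma frob_inner_diag: "frob_inner (mat_diag n d) B = (\<Sum>i<n. d i * B $$ (i,i))"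
  by (auto simp: frob_inner_def mat_diag_def if_distrib if_distribR intro!: sum.cong cong: if_cong)

text \<open>As in Ky Fan's inequality, \<open>annih C\<close> removes the low-rank part, and its
  diagonal in the eigenbasis of \<open>A A\<^sup>T\<close> has entries in \<open>[0,1]\<close> summing to at least \<open>N - q\<close>.\<close>

lemma sum_eig_desc_le_low_rank_error:
  fixes A C F :: "real mat"
  assumes A: "A \<in> carrier_mat N T" and C: "C \<in> carrier_mat N q" and F: "F \<in> carrier_mat T q"
  shows "(\<Sum>r\<in>{q+1..N}. eig_desc (A * A\<^sup>T) r) \<le> (frob_norm (A - C * F\<^sup>T))\<^sup>2"
proof -
  let ?S = "A * A\<^sup>T" and ?M = "annih C" and ?Q = "col_proj C"
  have S: "?S \<in> carrier_mat N N" "?S\<^sup>T = ?S"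
    using A by (auto simp: transpose_mult[of _ N T _ N])
  have M: "?M \<in> carrier_mat N N" and Q: "?Q \<in> carrier_mat N N"
    using C by (auto intro: annih_carrier col_proj_carrier)
  obtain U d where U: "U \<in> carrier_mat N N" "U\<^sup>T * U = 1\<^sub>m N" and SU: "?S = U * mat_diag N d * U\<^sup>T"
    using symmetric_spectral_decomposition[OF S] by auto
  have UU: "U\<^sup>T * (U * B) = B" if "B \<in> carrier_mat N N" for B
    using assoc_mult_mat[of "U\<^sup>T" N N U N B N] U that by simp
  \<comment> \<open>Diagonal entries of a conjugated Gram matrix are sums of squares. Besides A A'
    this applies to both projectors, each being its own Gram matrix.\<close>
  have quad: "(U\<^sup>T * (B * U)) $$ (i,i) = (\<Sum>k<p. ((G * U) $$ (k,i))\<^sup>2)"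
    if "B = G\<^sup>T * G" "G \<in> carrier_mat p N" "i < N" for B G p i
  proof -
    have "U\<^sup>T * (B * U) = (G * U)\<^sup>T * (G * U)"
      using that U by (simp add: transpose_mult_dim mult_mat_assoc_dim)
    then show ?thesis using transpose_mult_self_diag[of "G * U" p N i] that U by simp
  qed
  have "U\<^sup>T * ((U * D * U\<^sup>T) * U) = D" if "D \<in> carrier_mat N N" for D
    using U that by (simp add: mult_mat_assoc_dim UU)
  then have "U\<^sup>T * (?S * U) = mat_diag N d"
    unfolding SU by simp
  then have d: "0 \<le> d i" if "i < N" for i
    using quad[of ?S "A\<^sup>T" T i] A that by (simp add: mat_diag_def sum_nonneg)
  define m where "m i = (U\<^sup>T * (?M * U)) $$ (i,i)" for i
  have m0: "0 \<le> m i" if "i < N" for i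
    using quad[of ?M ?M N i] M that annih_transpose[OF C] annih_idem[OF C]
    by (simp add: m_def sum_nonneg)
  have mQ: "m i = 1 - (U\<^sup>T * (?Q * U)) $$ (i,i)" if "i < N" for i
  proof -
    have "U\<^sup>T * (?M * U) = 1\<^sub>m N - U\<^sup>T * (?Q * U)"
      using Q U unfolding annih_eq[OF C]
      by (simp add: minus_mult_distrib_mat[of _ N N _ _ N] mult_minus_distrib_mat[of _ N N _ N])
    then show ?thesis using that Q U by (simp add: m_def)
  qed
  have m1: "m i \<le> 1" if "i < N" for i
    using quad[of ?Q ?Q N i] Q that col_proj_transpose[OF C] col_proj_idem[OF C]
    by (simp add: mQ sum_nonneg)
  \<comment> \<open>The trace of \<open>?Q\<close> is invariant under conjugation by U and at most
    q, so the complementary weights \<open>m i\<close> sum to at least N - q.\<close>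
  have "(\<Sum>i<N. (U\<^sup>T * (?Q * U)) $$ (i,i)) = frob_inner (1\<^sub>m N) (U\<^sup>T * (?Q * U))"
    using frob_inner_diag[of N "\<lambda>_. 1"] by simp
  also have "\<dots> = frob_inner (U * 1\<^sub>m N) (?Q * U)"
    using U Q by (subst frob_inner_mult_left[of U N N _ N]) auto
  also have "\<dots> = frob_inner (?Q * U) U"
    using U Q by (simp add: frob_inner_commute[of _ N N])
  also have "\<dots> = frob_inner ?Q (1\<^sub>m N)"
    using U Q orthogonal_mat_commute[OF U] by (simp add: frob_inner_mult_right[of _ N N _ N])
  also have "\<dots> \<le> real q"
    using col_proj_trace[OF C] frob_norm_col_proj_le[OF C] frob_inner_commute[OF Q, of "1\<^sub>m N"] by simp
  finally have tot: "real N - real q \<le> (\<Sum>i<N. m i)"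
    by (simp add: mQ sum_subtractf)
  \<comment> \<open>\<open>eig_desc\<close> counts from one and list positions from zero, hence the
    shift.\<close>
  have "(\<Sum>r\<in>{q+1..N}. eig_desc ?S r) =
      (\<Sum>i\<in>{q..<N}. rev (sorted_list_of_multiset (mset (map d [0..<N]))) ! i)"
    unfolding eig_desc_def proots_char_poly_of_spectral[OF U SU]
    by (rule sum.reindex_bij_witness[of _ Suc "\<lambda>r. r - 1"]) auto
  also have "\<dots> \<le> (\<Sum>i<N. d i * m i)"
    by (rule sorted_tail_sum_le_weighted[OF d m0 m1 tot])
  also have "\<dots> = frob_inner (mat_diag N d) (U\<^sup>T * (?M * U))"
    by (simp add: frob_inner_diag m_def)
  also have "\<dots> = frob_inner (U * mat_diag N d) (?M * U)"
    using U M by (subst frob_inner_mult_left[of U N N _ N]) auto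
  also have "\<dots> = frob_inner (U * mat_diag N d * U\<^sup>T) ?M"
    using U M by (subst frob_inner_mult_right[of _ N N "U\<^sup>T" N]) auto
  also have "\<dots> = frob_inner (?M * A) A"
    unfolding SU[symmetric] using A M S by (simp add: frob_inner_mult_right[of _ N N _ T] frob_inner_commute[of _ N N])
  also have "\<dots> = frob_inner A (?M * A)"
    using A M by (intro frob_inner_commute) auto
  also have "\<dots> = (frob_norm (?M * A))\<^sup>2"
    by (rule frob_norm_annih_mult_sq[OF C A, symmetric])
  also have "?M * A = ?M * (A - C * F\<^sup>T)"
  proof -
    have "?M * (C * F\<^sup>T) = 0\<^sub>m N T"
      using assoc_mult_mat[OF M C, of "F\<^sup>T" T] F by (simp add: annih_mult_self[OF C])
    then show ?thesis using A C F M by (simp add: mult_minus_distrib_mat[OF M, of _ T] minus_zero_mat[OF mult_carrier_mat[OF M A]])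
  qed
  also have "(frob_norm (?M * (A - C * F\<^sup>T)))\<^sup>2 \<le> (frob_norm (A - C * F\<^sup>T))\<^sup>2"
    using A C F by (intro power_mono frob_norm_annih_mult_le[OF C]) auto
  finally show ?thesis .
qed

text \<open>Makes positive definiteness quantitative: the least eigenvalue bounds the form from
  below, uniformly in x. A fixed constant of this kind survives small perturbations of the
  matrix.\<close>

lemma pd_mat_lower_bound:
  assumes G: "G \<in> carrier_mat n n" and pd: "pd_mat G"
  shows "\<exists>\<kappa>>0. \<forall>x. \<kappa> * (\<Sum>i<n. (x i)\<^sup>2) \<le> (\<Sum>i<n. \<Sum>j<n. x i * G $$ (i,j) * x j)"
proof -
  have sym: "G\<^sup>T = G" using pd by (simp add: pd_mat_def)
  obtain U d where U: "U \<in> carrier_mat n n" "U\<^sup>T * U = 1\<^sub>m n" and GU: "G = U * mat_diag n d * U\<^sup>T"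
    using symmetric_spectral_decomposition[OF G sym] by auto
  define X where "X x = mat n 1 (\<lambda>(i,j). x i :: real)" for x
  define D where "D = mat_diag n d"
  have D: "D \<in> carrier_mat n n" by (simp add: D_def)
  have X: "X x \<in> carrier_mat n 1" for x by (simp add: X_def)
  have quad: "(\<Sum>i<n. \<Sum>j<n. x i * G $$ (i,j) * x j) = (\<Sum>i<n. d i * ((U\<^sup>T * X x) $$ (i,0))\<^sup>2)" for x
  proof -
    have "(\<Sum>i<n. \<Sum>j<n. x i * G $$ (i,j) * x j) = frob_inner (X x) (G * X x)"
      using G by (simp add: frob_inner_def X_def scalar_prod_def sum_distrib_left lessThan_atLeast0 ac_simps)
    also have "\<dots> = frob_inner (X x) (U * (D * (U\<^sup>T * X x)))"
      unfolding GU D_def[symmetric] using U D X[of x]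
      by (simp add: mult_mat_assoc_dim)
    also have "\<dots> = frob_inner (U * (D * (U\<^sup>T * X x))) (X x)"
      using U D X[of x] by (intro frob_inner_commute[of _ n 1] mult_carrier_mat[of _ n n]) auto
    also have "\<dots> = frob_inner (D * (U\<^sup>T * X x)) (U\<^sup>T * X x)"
      using U D X[of x] by (intro frob_inner_mult_left) (auto intro!: mult_carrier_mat[of _ n n])
    also have "\<dots> = (\<Sum>i<n. d i * ((U\<^sup>T * X x) $$ (i,0))\<^sup>2)"
      unfolding D_def mat_diag_mult_left[OF mult_carrier_mat[OF transpose_carrier_mat[THEN iffD2, OF U(1)] X]]
      by (simp add: frob_inner_def power2_eq_square X_def mult.assoc)
    finally show ?thesis .
  qed
  have norm: "(\<Sum>i<n. (x i)\<^sup>2) = (\<Sum>i<n. ((U\<^sup>T * X x) $$ (i,0))\<^sup>2)" for x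
  proof -
    have "U * (U\<^sup>T * X x) = X x"
      using assoc_mult_mat[of U n n "U\<^sup>T" n "X x" 1] U X[of x] orthogonal_mat_commute[OF U] by simp
    then have "frob_inner (U\<^sup>T * X x) (U\<^sup>T * X x) = frob_inner (X x) (X x)"
      using frob_inner_mult_left[of "U\<^sup>T" n n "X x" 1 "U\<^sup>T * X x"] U X[of x] by simp
    then show ?thesis using U by (simp add: frob_inner_def X_def power2_eq_square)
  qed
  have pos: "0 < d i" if i: "i < n" for i
  proof -
    \<comment> \<open>Tested on the i-th eigenvector the form takes the value \<open>d i\<close>,
      since U' x is the i-th basis vector.\<close>
    define x where "x k = U $$ (k,i)" for k
    have UX: "(U\<^sup>T * X x) $$ (j,0) = (if j = i then 1 else 0)" if "j < n" for j
    proof -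
      have "(U\<^sup>T * X x) $$ (j,0) = (U\<^sup>T * U) $$ (j,i)"
        using U(1) i that by (simp add: X_def x_def scalar_prod_def)
      then show ?thesis using U(2) i that by simp
    qed
    define v where "v = vec n x"
    have v: "v \<in> carrier_vec n" by (simp add: v_def)
    have "(\<Sum>k<n. (x k)\<^sup>2) = 1" unfolding norm[of x] using i by (simp add: UX if_distrib if_distribR cong: if_cong)
    moreover have "x k = 0" if "v = 0\<^sub>v n" "k < n" for k
      using arg_cong[OF that(1), of "\<lambda>u. u $ k"] that(2) by (simp add: v_def)
    ultimately have "v \<noteq> 0\<^sub>v n" by auto
    then have "0 < scalar_prod v (G *\<^sub>v v)"
      using pd v G by (auto simp: pd_mat_def)
    also have "\<dots> = (\<Sum>i<n. \<Sum>j<n. x i * G $$ (i,j) * x j)"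
      using G by (simp add: v_def scalar_prod_def sum_distrib_left lessThan_atLeast0 ac_simps)
    also have "\<dots> = d i" unfolding quad using i by (simp add: UX if_distrib if_distribR cong: if_cong)
    finally show ?thesis .
  qed
  \<comment> \<open>The inserted 1 keeps the set nonempty for n = 0; a smaller positive constant
    does no harm.\<close>
  define \<kappa> where "\<kappa> = Min (insert 1 (d ` {..<n}))"
  have "0 < \<kappa>" using pos by (auto simp: \<kappa>_def)
  moreover have "\<kappa> \<le> d i" if "i < n" for i using that by (simp add: \<kappa>_def)
  then have "\<kappa> * (\<Sum>i<n. (x i)\<^sup>2) \<le> (\<Sum>i<n. \<Sum>j<n. x i * G $$ (i,j) * x j)" for x
    unfolding quad[of x] norm[of x] by (auto simp: sum_distrib_left intro!: sum_mono mult_right_mono)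
  ultimately show ?thesis by blast
qed

section \<open>Recovery of the factor structure\<close>

definition col_mat :: "real mat \<Rightarrow> nat \<Rightarrow> real mat" where
  "col_mat A j = mat (dim_row A) 1 (\<lambda>(i,_). A $$ (i,j))"

lemma col_mat_carrier [simp]: "A \<in> carrier_mat n m \<Longrightarrow> col_mat A j \<in> carrier_mat n 1"
  by (auto simp: col_mat_def)

lemma col_mat_mult:
  "A \<in> carrier_mat n m \<Longrightarrow> B \<in> carrier_mat m p \<Longrightarrow> j < p \<Longrightarrow> col_mat (A * B) j = A * col_mat B j"
  by (intro eq_matI) (auto simp: col_mat_def scalar_prod_def)

lemma frob_norm_sq_cols:
  assumes "A \<in> carrier_mat n m"
  shows "(frob_norm A)\<^sup>2 = (\<Sum>j<m. (frob_norm (col_mat A j))\<^sup>2)"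
  using assms by (auto simp: frob_norm_square frob_inner_def col_mat_def intro: sum.swap)

text \<open>Normalizing \<open>x\<close> produces a member of the set whose supremum is the spectral
  norm. A zero \<open>x\<close> cannot be normalized and is treated apart.\<close>

lemma frob_norm_mult_column_le_spec_norm:
  assumes A: "A \<in> carrier_mat n m" and x: "x \<in> carrier_mat m 1"
  shows "frob_norm (A * x) \<le> spec_norm A * frob_norm x"
proof (cases "frob_norm x = 0")
  case True
  then have "x = 0\<^sub>m m 1" using x by (simp add: frob_norm_eq_0_iff)
  then have "A * x = 0\<^sub>m n 1" using A by simp
  then have "frob_norm (A * x) = 0" by (simp add: frob_norm_def)
  then show ?thesis using True by simp
next
  case False
  define S where "S = {sqrt (scalar_prod (A *\<^sub>v v) (A *\<^sub>v v)) | v. v \<in> carrier_vec (dim_col A) \<and> scalar_prod v v = 1}"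
  have spec: "spec_norm A = Sup S" by (simp add: spec_norm_def S_def)
  define X where "X v = mat m 1 (\<lambda>(i,_). v $ i :: real)" for v
  have X: "X v \<in> carrier_mat m 1" for v by (simp add: X_def)
  have img: "sqrt (scalar_prod (A *\<^sub>v v) (A *\<^sub>v v)) = frob_norm (A * X v)" if "v \<in> carrier_vec m" for v
    using A that by (simp add: frob_norm_def X_def scalar_prod_def power2_eq_square lessThan_atLeast0)
  have nrm: "scalar_prod v v = (frob_norm (X v))\<^sup>2" if "v \<in> carrier_vec m" for v
    using that by (simp add: frob_norm_square frob_inner_def X_def scalar_prod_def lessThan_atLeast0)
  \<comment> \<open>A real \<open>Sup\<close> is known to be an upper bound only for a bounded set;
    \<open>frob_norm A\<close> bounds this one.\<close>
  have "bdd_above S"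
  proof (rule bdd_aboveI)
    fix r assume "r \<in> S"
    then obtain v where v: "v \<in> carrier_vec m" "r = frob_norm (A * X v)" "(frob_norm (X v))\<^sup>2 = 1"
      using A img nrm by (auto simp: S_def)
    then have "frob_norm (X v) = 1"
      using frob_norm_nonneg[of "X v"] by (simp add: power2_eq_1_iff)
    then show "r \<le> frob_norm A" using frob_norm_mult[OF A X, of v] v(2) by simp
  qed
  define v where "v = vec m (\<lambda>i. x $$ (i,0) / frob_norm x)"
  have v: "v \<in> carrier_vec m" by (simp add: v_def)
  have Xv: "X v = (1 / frob_norm x) \<cdot>\<^sub>m x" using x by (intro eq_matI) (auto simp: X_def v_def)
  have "frob_norm (X v) = 1" unfolding Xv frob_norm_smult using False by simp
  then have "frob_norm (A * X v) \<in> S" using v A img[OF v] nrm[OF v] by (force simp: S_def)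
  then have "frob_norm (A * X v) \<le> spec_norm A"
    unfolding spec using \<open>bdd_above S\<close> by (rule cSup_upper)
  also have "A * X v = (1 / frob_norm x) \<cdot>\<^sub>m (A * x)"
    unfolding Xv by (rule mult_smult_distrib[OF A x])
  finally show ?thesis using False frob_norm_nonneg[of x]
    by (simp add: frob_norm_smult field_simps)
qed

text \<open>The vector bound is applied column by column. The absolute value covers a matrix without
  columns, where the supremum is over the empty set and has no known sign.\<close>

lemma frob_norm_mult_le_spec_norm:
  assumes A: "A \<in> carrier_mat n m" and B: "B \<in> carrier_mat m p"
  shows "frob_norm (A * B) \<le> \<bar>spec_norm A\<bar> * frob_norm B"
proof -
  have "(frob_norm (A * B))\<^sup>2 = (\<Sum>j<p. (frob_norm (A * col_mat B j))\<^sup>2)"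
    using frob_norm_sq_cols[OF mult_carrier_mat[OF A B]] by (simp add: col_mat_mult[OF A B])
  also have "\<dots> \<le> (\<Sum>j<p. (spec_norm A * frob_norm (col_mat B j))\<^sup>2)"
    by (intro sum_mono power_mono frob_norm_nonneg
        frob_norm_mult_column_le_spec_norm[OF A col_mat_carrier[OF B]])
  also have "\<dots> = (\<bar>spec_norm A\<bar> * frob_norm B)\<^sup>2"
    by (simp add: power_mult_distrib frob_norm_sq_cols[OF B] sum_distrib_left)
  finally show ?thesis by (rule power2_le_imp_le) simp
qed

text \<open>The projector Q onto the column space of \<open>F\<close> fixes C F' from the right, so
  it can be moved onto \<open>e\<close>. There ||e Q||_F is at most ||e|| ||Q||_F, and ||Q||_F at
  most sqrt q. The bound is relative to the norm of the product and needs none for its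
  factors.\<close>

lemma frob_inner_low_rank_le_spec_norm:
  assumes e: "e \<in> carrier_mat N T" and C: "C \<in> carrier_mat N q" and F: "F \<in> carrier_mat T q"
  shows "\<bar>frob_inner e (C * F\<^sup>T)\<bar> \<le> \<bar>spec_norm e\<bar> * sqrt (real q) * frob_norm (C * F\<^sup>T)"
proof -
  define L where "L = C * F\<^sup>T"
  let ?Q = "col_proj F"
  have Q: "?Q \<in> carrier_mat T T" by (rule col_proj_carrier[OF F])
  have L: "L \<in> carrier_mat N T" using C F by (simp add: L_def)
  have "F\<^sup>T * ?Q = (?Q * F)\<^sup>T"
    using transpose_mult[OF Q F] by (simp add: col_proj_transpose[OF F])
  then have "L * ?Q = L"
    unfolding L_def using assoc_mult_mat[OF C _ Q, of "F\<^sup>T"] F by (simp add: col_proj_mult_self[OF F])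
  then have "frob_inner e L = frob_inner (L * ?Q) e" using frob_inner_commute[OF e L] by simp
  also have "\<dots> = frob_inner L (e * ?Q)"
    using frob_inner_mult_right[OF L Q e] by (simp add: col_proj_transpose[OF F])
  also have "\<bar>\<dots>\<bar> \<le> frob_norm L * frob_norm (e * ?Q)"
    by (rule frob_inner_Cauchy_Schwarz[OF L mult_carrier_mat[OF e Q]])
  also have "\<dots> \<le> frob_norm L * (\<bar>spec_norm e\<bar> * sqrt (real q))"
  proof (intro mult_left_mono frob_norm_nonneg)
    have "frob_norm ?Q \<le> sqrt (real q)"
      using frob_norm_col_proj_le[OF F] by (rule real_le_rsqrt)
    then show "frob_norm (e * ?Q) \<le> \<bar>spec_norm e\<bar> * sqrt (real q)"
      using frob_norm_mult_le_spec_norm[OF e Q] by (meson abs_ge_zero mult_left_mono order.trans)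
  qed
  finally show ?thesis by (simp add: L_def mult.commute)
qed

section \<open>Recovery of the common component in the presence of low-rank regressors\<close>

lemma sqrt_mult_frob_norm_le:
  assumes "0 \<le> B" "B * (frob_norm Z)\<^sup>2 \<le> (frob_norm Y)\<^sup>2"
  shows "sqrt B * frob_norm Z \<le> frob_norm Y"
  by (rule power2_le_imp_le) (use assms in \<open>simp_all add: power_mult_distrib\<close>)

text \<open>\<open>A\<close> below is \<open>\<lambda>0' M_w \<lambda>\<close>. Annihilating \<open>w\<close> shows \<open>A f' \<approx> (\<lambda>0' M_w \<lambda>0) f0'\<close>, so \<open>A\<close> is
  invertible; annihilating \<open>v\<close> then shows \<open>\<lambda> A\<^sup>-\<^sup>1 (\<lambda>0' M_w \<lambda>0) \<approx> \<lambda>0\<close>.\<close>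

lemma low_rank_factor_recovery:
  fixes L0 F0 w v lam f J E :: "real mat" and c B \<eta> :: real
  assumes L0: "L0 \<in> carrier_mat N R" and F0: "F0 \<in> carrier_mat T R"
    and w: "w \<in> carrier_mat N k" and v: "v \<in> carrier_mat T k" and J: "J \<in> carrier_mat k k"
    and lam: "lam \<in> carrier_mat N R" and f: "f \<in> carrier_mat T R" and E: "E \<in> carrier_mat N T"
    and eq: "lam * f\<^sup>T + w * J * v\<^sup>T = L0 * F0\<^sup>T + E"
    and B: "0 < B"
    and L0_le: "frob_norm L0 \<le> c" and F0_le: "frob_norm F0 \<le> c"
    and L0_ge: "\<And>m Z. Z \<in> carrier_mat R m \<Longrightarrow> B * (frob_norm Z)\<^sup>2 \<le> (frob_norm (annih w * L0 * Z))\<^sup>2"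
    and F0_ge: "\<And>m Z. Z \<in> carrier_mat R m \<Longrightarrow> B * (frob_norm Z)\<^sup>2 \<le> (frob_norm (annih v * F0 * Z))\<^sup>2"
    and E_le: "frob_norm E \<le> \<eta>" and small: "2 * c * \<eta> \<le> B * sqrt B"
  shows "frob_norm (lam * f\<^sup>T - L0 * F0\<^sup>T) \<le> (2 * (1 + c\<^sup>2 / B) / sqrt B * c + 1 + 2 * c\<^sup>2 / B) * \<eta>"
proof -
  define Mw where "Mw = annih w"
  define Mv where "Mv = annih v"
  define W where "W = Mw * L0"
  define V where "V = Mv * F0"
  define P where "P = W\<^sup>T * W"
  define A where "A = W\<^sup>T * lam"
  define g where "g = P * F0\<^sup>T + W\<^sup>T * E"
  have Mw: "Mw \<in> carrier_mat N N" "Mw\<^sup>T = Mw" "Mw * Mw = Mw" "Mw * w = 0\<^sub>m N k"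
    unfolding Mw_def using annih_carrier[OF w] annih_transpose[OF w] annih_idem[OF w] annih_mult_self[OF w] by auto
  have Mv: "Mv \<in> carrier_mat T T" "Mv\<^sup>T = Mv" "Mv * v = 0\<^sub>m T k"
    unfolding Mv_def using annih_carrier[OF v] annih_transpose[OF v] annih_mult_self[OF v] by auto
  have Mv_le: "frob_norm (Mv * Z) \<le> frob_norm Z" if "Z \<in> carrier_mat T m" for Z m
    unfolding Mv_def by (rule frob_norm_annih_mult_le[OF v that])
  have W: "W \<in> carrier_mat N R" and V: "V \<in> carrier_mat T R" using Mw Mv L0 F0 by (auto simp: W_def V_def)
  have P: "P \<in> carrier_mat R R" "P\<^sup>T = P" and A: "A \<in> carrier_mat R R" and g: "g \<in> carrier_mat R T"
    using W lam F0 E by (auto simp: P_def A_def g_def transpose_mult_dim)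
  have c: "0 \<le> c" using L0_le frob_norm_nonneg[of L0] by linarith
  have \<eta>: "0 \<le> \<eta>" using E_le frob_norm_nonneg[of E] by linarith
  have W_le: "frob_norm W \<le> c"
    unfolding W_def Mw_def using frob_norm_annih_mult_le[OF w L0] L0_le by simp
  have WT: "W\<^sup>T = L0\<^sup>T * Mw" using Mw L0 by (simp add: W_def transpose_mult_dim)
  have VT: "V\<^sup>T = F0\<^sup>T * Mv" using Mv F0 by (simp add: V_def transpose_mult_dim)
  have WL0: "W\<^sup>T * L0 = P"
  proof -
    have "P = L0\<^sup>T * ((Mw * Mw) * L0)" unfolding P_def WT unfolding W_def using Mw(1) L0 by (simp add: mult_mat_assoc_dim)
    then show ?thesis unfolding WT Mw(3) using Mw(1) L0 by (simp add: mult_mat_assoc_dim)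
  qed
  have WE: "W\<^sup>T * E \<in> carrier_mat R T" and WE_le: "frob_norm (W\<^sup>T * E) \<le> c * \<eta>"
    using frob_norm_mult[of "W\<^sup>T" R N E T] W E W_le E_le c
    by (auto intro: order.trans[OF _ mult_mono])
  \<comment> \<open>Since <Z, P Z> = ||W Z||^2, Cauchy-Schwarz turns the lower bound for W into one
    for P.\<close>
  have P_ge: "B * frob_norm Z \<le> frob_norm (P * Z)" if Z: "Z \<in> carrier_mat R m" for Z m
  proof -
    have "P * Z = W\<^sup>T * (W * Z)" unfolding P_def using W Z by (simp add: mult_mat_assoc_dim)
    then have "(frob_norm (W * Z))\<^sup>2 = frob_inner Z (P * Z)"
      using frob_inner_mult_left[OF W Z mult_carrier_mat[OF W Z]] by (simp add: frob_norm_square)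
    also have "\<dots> \<le> frob_norm Z * frob_norm (P * Z)"
      using frob_inner_Cauchy_Schwarz[OF Z mult_carrier_mat[OF P(1) Z]] by simp
    finally have "B * (frob_norm Z)\<^sup>2 \<le> frob_norm Z * frob_norm (P * Z)"
      using L0_ge[OF Z] by (simp add: W_def Mw_def)
    then have "frob_norm Z * (B * frob_norm Z) \<le> frob_norm Z * frob_norm (P * Z)"
      by (simp add: power2_eq_square ac_simps)
    then show ?thesis
      using frob_norm_nonneg[of Z] frob_norm_nonneg[of "P * Z"]
      by (cases "frob_norm Z = 0") (auto simp: mult_le_cancel_left)
  qed
  have V_ge: "sqrt B * frob_norm Z \<le> frob_norm (V * Z)" if "Z \<in> carrier_mat R m" for Z m
    using F0_ge[OF that] B by (intro sqrt_mult_frob_norm_le) (auto simp: V_def Mv_def)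
  \<comment> \<open>The term with the unknown \<open>J\<close> vanishes exactly, whatever its size;
    \<open>wMv\<close> does the same from the other side.\<close>
  have Ww: "W\<^sup>T * (w * J * v\<^sup>T) = 0\<^sub>m R T"
  proof -
    have "W\<^sup>T * (w * J * v\<^sup>T) = L0\<^sup>T * ((Mw * w) * (J * v\<^sup>T))"
      unfolding WT using Mw(1) L0 w J v by (simp add: mult_mat_assoc_dim)
    then show ?thesis unfolding Mw(4) using L0 J v
      by (simp add: left_mult_zero_mat[of "J * v\<^sup>T" k T] right_mult_zero_mat[of "L0\<^sup>T" R N])
  qed
  have wMv: "(w * J * v\<^sup>T) * Mv = 0\<^sub>m N T"
  proof -
    have "v\<^sup>T * Mv = (Mv * v)\<^sup>T" using Mv(1,2) v by (simp add: transpose_mult_dim)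
    then have "v\<^sup>T * Mv = 0\<^sub>m k T" unfolding Mv(3) by simp
    then have "(w * J) * (v\<^sup>T * Mv) = 0\<^sub>m N T" using w J by simp
    then show ?thesis using w J v Mv(1) by (simp add: mult_mat_assoc_dim)
  qed
  have wJv: "w * J * v\<^sup>T \<in> carrier_mat N T" and lf: "lam * f\<^sup>T \<in> carrier_mat N T"
    and LF: "L0 * F0\<^sup>T \<in> carrier_mat N T" using w J v lam f L0 F0 by auto
  have WTc: "W\<^sup>T \<in> carrier_mat R N" using W by simp
  have Af: "A * f\<^sup>T = g"
  proof -
    have "W\<^sup>T * (lam * f\<^sup>T) = W\<^sup>T * (lam * f\<^sup>T + w * J * v\<^sup>T)"
      using mult_carrier_mat[OF WTc lf]
      by (simp add: mult_add_distrib_mat[OF WTc lf wJv] Ww)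
    also have "\<dots> = W\<^sup>T * (L0 * F0\<^sup>T) + W\<^sup>T * E"
      unfolding eq by (rule mult_add_distrib_mat[OF WTc LF E])
    also have "W\<^sup>T * (L0 * F0\<^sup>T) = P * F0\<^sup>T"
      using W L0 F0 by (simp add: mult_mat_assoc_dim flip: WL0)
    finally show ?thesis
      unfolding A_def g_def using W lam f by (simp add: mult_mat_assoc_dim)
  qed
  have gMv: "g * Mv = P * V\<^sup>T + W\<^sup>T * E * Mv"
    unfolding g_def VT using P F0 Mv(1) WE
    by (simp add: add_mult_distrib_mat[of _ R T _ _ T] mult_mat_assoc_dim)
  \<comment> \<open>A column Z with Z'A = 0 also has Z'g = 0, so after multiplication by
    \<open>Mv\<close> the vector V P Z is the negative of Mv (W'E)' Z. The first has norm at least B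
    sqrt B ||Z||, the second at most c \<eta> ||Z||, which \<open>small\<close> forbids unless Z =
    0.\<close>
  have "det A \<noteq> 0"
  proof
    assume "det A = 0"
    then have "det (A\<^sup>T) = 0" using det_transpose[OF A] by simp
    then obtain x where x: "x \<in> carrier_vec R" "x \<noteq> 0\<^sub>v R" "A\<^sup>T *\<^sub>v x = 0\<^sub>v R"
      using det_0_iff_vec_prod_zero[of "A\<^sup>T" R] A by auto
    define Z where "Z = mat R 1 (\<lambda>(i,_). x $ i)"
    have Z: "Z \<in> carrier_mat R 1" by (simp add: Z_def)
    have AZ: "A\<^sup>T * Z = 0\<^sub>m R 1"
    proof (intro eq_matI)
      fix i j assume "i < dim_row (0\<^sub>m R 1)" "j < dim_col (0\<^sub>m R 1)"
      then show "(A\<^sup>T * Z) $$ (i,j) = 0\<^sub>m R 1 $$ (i,j)"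
        using arg_cong[OF x(3), of "\<lambda>y. y $ i"] A x(1) by (simp add: Z_def scalar_prod_def)
    qed (use A Z in auto)
    have "frob_norm Z \<noteq> 0"
    proof
      assume "frob_norm Z = 0"
      then have "Z = 0\<^sub>m R 1" using Z by (simp add: frob_norm_eq_0_iff)
      moreover have "x $ i = Z $$ (i,0)" if "i < R" for i using that by (simp add: Z_def)
      ultimately have "x $ i = 0" if "i < R" for i using that by simp
      then show False using x by (auto simp: vec_eq_iff)
    qed
    then have Z0: "0 < frob_norm Z" using frob_norm_nonneg[of Z] by linarith
    have ZT: "Z\<^sup>T \<in> carrier_mat 1 R" using Z by simp
    have "Z\<^sup>T * A = (A\<^sup>T * Z)\<^sup>T" using A Z by (simp add: transpose_mult_dim)
    then have "Z\<^sup>T * A = 0\<^sub>m 1 R" by (simp add: AZ)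
    then have "Z\<^sup>T * A * (f\<^sup>T * Mv) = 0\<^sub>m 1 T"
      using f Mv(1) by (simp add: left_mult_zero_mat[of "f\<^sup>T * Mv" R T])
    then have "Z\<^sup>T * (g * Mv) = 0\<^sub>m 1 T"
      unfolding Af[symmetric] using Z A f Mv(1) by (simp add: mult_mat_assoc_dim)
    then have "Z\<^sup>T * (P * V\<^sup>T) + Z\<^sup>T * (W\<^sup>T * E * Mv) = 0\<^sub>m 1 T"
      unfolding gMv using ZT P V WE Mv(1)
      by (subst (asm) mult_add_distrib_mat[OF ZT, of _ T]) auto
    then have "(Z\<^sup>T * (P * V\<^sup>T))\<^sup>T + (Z\<^sup>T * (W\<^sup>T * E * Mv))\<^sup>T = 0\<^sub>m T 1"
      using ZT P V WE Mv(1) transpose_add[of "Z\<^sup>T * (P * V\<^sup>T)" 1 T "Z\<^sup>T * (W\<^sup>T * E * Mv)"] by simp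
    moreover have "(Z\<^sup>T * (P * V\<^sup>T))\<^sup>T = V * (P * Z)"
      using Z P V by (simp add: transpose_mult_dim mult_mat_assoc_dim)
    moreover have "(Z\<^sup>T * (W\<^sup>T * E * Mv))\<^sup>T = Mv * ((W\<^sup>T * E)\<^sup>T * Z)"
      using Z WE W E Mv(1,2) by (simp add: transpose_mult_dim mult_mat_assoc_dim)
    ultimately have sum0: "V * (P * Z) + Mv * ((W\<^sup>T * E)\<^sup>T * Z) = 0\<^sub>m T 1" by simp
    have c1: "V * (P * Z) \<in> carrier_mat T 1" using V P Z by auto
    have c2: "(W\<^sup>T * E)\<^sup>T * Z \<in> carrier_mat T 1" using WE Z by auto
    have c3: "Mv * ((W\<^sup>T * E)\<^sup>T * Z) \<in> carrier_mat T 1" using Mv(1) c2 by auto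
    have "V * (P * Z) - 0\<^sub>m T 1 = 0\<^sub>m T 1 - Mv * ((W\<^sup>T * E)\<^sup>T * Z)"
      using sum0 by (intro add_eq_add_imp_minus_eq_mat[OF c1 c3]) auto
    also have "\<dots> = (- 1) \<cdot>\<^sub>m (Mv * ((W\<^sup>T * E)\<^sup>T * Z))" using Mv(1) Z by (intro eq_matI) auto
    finally have "V * (P * Z) = (- 1) \<cdot>\<^sub>m (Mv * ((W\<^sup>T * E)\<^sup>T * Z))"
      unfolding minus_zero_mat[OF c1] .
    then have "frob_norm (V * (P * Z)) = frob_norm (Mv * ((W\<^sup>T * E)\<^sup>T * Z))"
      by (simp add: frob_norm_smult)
    also have "\<dots> \<le> frob_norm ((W\<^sup>T * E)\<^sup>T * Z)" by (rule Mv_le[OF c2])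
    also have "\<dots> \<le> frob_norm ((W\<^sup>T * E)\<^sup>T) * frob_norm Z"
      using WE Z by (intro frob_norm_mult) auto
    also have "\<dots> \<le> c * \<eta> * frob_norm Z"
      using WE_le by (intro mult_right_mono) auto
    finally have up: "frob_norm (V * (P * Z)) \<le> c * \<eta> * frob_norm Z" .
    have "sqrt B * (B * frob_norm Z) \<le> sqrt B * frob_norm (P * Z)"
      using P_ge[OF Z] B by (intro mult_left_mono) auto
    also have "\<dots> \<le> frob_norm (V * (P * Z))" by (rule V_ge[OF mult_carrier_mat[OF P(1) Z]])
    finally have "(B * sqrt B) * frob_norm Z \<le> (c * \<eta>) * frob_norm Z" using up by (simp add: ac_simps)
    then have "B * sqrt B \<le> c * \<eta>" using Z0 by simp
    moreover have "0 < B * sqrt B" using B by simp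
    ultimately show False using small by linarith
  qed
  then obtain Ai where Ai: "Ai \<in> carrier_mat R R" "Ai * A = 1\<^sub>m R"
    using det_non_zero_imp_unit[OF A, of "()"] by (auto simp: Units_def ring_mat_simps)
  \<comment> \<open>Only the product lam f' is determined. This normalization replaces f' by
    \<open>g\<close>, which is explicit and close to P F0', so that mu P should be close to
    \<open>L0\<close>.\<close>
  define mu where "mu = lam * Ai"
  have mu: "mu \<in> carrier_mat N R" using lam Ai by (simp add: mu_def)
  have mug: "mu * g = lam * f\<^sup>T"
  proof -
    have "mu * g = lam * ((Ai * A) * f\<^sup>T)"
      unfolding Af[symmetric] mu_def using lam Ai(1) A f by (simp add: mult_mat_assoc_dim)
    then show ?thesis using Ai f by simp
  qed
  define H where "H = mu * P - L0"
  have H: "H \<in> carrier_mat N R" unfolding H_def by (rule minus_carrier_mat[OF L0])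
  have mug': "mu * g = mu * P * F0\<^sup>T + mu * (W\<^sup>T * E)"
    unfolding g_def using mu P F0 WE
    by (subst mult_add_distrib_mat[OF mu, of _ T]) (auto simp: mult_mat_assoc_dim)
  have muP: "mu * P \<in> carrier_mat N R" and muWE: "mu * (W\<^sup>T * E) \<in> carrier_mat N T"
    using mu P WE by auto
  have HV: "H * V\<^sup>T = E * Mv - mu * (W\<^sup>T * E) * Mv"
  proof -
    have "(mu * P * F0\<^sup>T + mu * (W\<^sup>T * E) + w * J * v\<^sup>T) * Mv = (L0 * F0\<^sup>T + E) * Mv"
      using eq by (simp flip: mug mug')
    then have "mu * P * F0\<^sup>T * Mv + mu * (W\<^sup>T * E) * Mv = L0 * F0\<^sup>T * Mv + E * Mv"
      using muP F0 muWE wJv LF E Mv(1) wMv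
      by (simp add: add_mult_distrib_mat[of _ N T _ _ T] add_carrier_mat[of _ N T] right_add_zero_mat[of _ N T])
    moreover have "mu * P * F0\<^sup>T * Mv = mu * P * V\<^sup>T" "L0 * F0\<^sup>T * Mv = L0 * V\<^sup>T"
      unfolding VT using muP L0 F0 Mv(1) by (simp_all add: mult_mat_assoc_dim)
    ultimately have s: "mu * P * V\<^sup>T + mu * (W\<^sup>T * E) * Mv = L0 * V\<^sup>T + E * Mv" by simp
    have c: "mu * P * V\<^sup>T \<in> carrier_mat N T" "mu * (W\<^sup>T * E) * Mv \<in> carrier_mat N T"
      "L0 * V\<^sup>T \<in> carrier_mat N T" "E * Mv \<in> carrier_mat N T"
      using mu P V muWE Mv(1) L0 E by auto
    have "mu * P * V\<^sup>T - L0 * V\<^sup>T = E * Mv - mu * (W\<^sup>T * E) * Mv"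
      by (rule add_eq_add_imp_minus_eq_mat[OF c s])
    then show ?thesis unfolding H_def
      using muP L0 V by (simp add: minus_mult_distrib_mat[of _ N R _ _ T])
  qed
  define h where "h = frob_norm H"
  have h0: "0 \<le> h" by (simp add: h_def)
  \<comment> \<open>No bound on \<open>lam\<close> is available. The loading is controlled through
    mu P = H + L0 and the lower bound for P, at the price of the still unknown distance h.\<close>
  have mu_le: "B * frob_norm mu \<le> h + c"
  proof -
    have "B * frob_norm (mu\<^sup>T) \<le> frob_norm (P * mu\<^sup>T)" using mu by (intro P_ge) auto
    also have "P * mu\<^sup>T = (mu * P)\<^sup>T" using mu P by (simp add: transpose_mult_dim)
    also have "frob_norm \<dots> = frob_norm (H + L0)"
    proof -
      have "mu * P = H + L0" unfolding H_def using muP L0 by (intro eq_matI) auto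
      then show ?thesis by simp
    qed
    also have "\<dots> \<le> h + c" using frob_norm_triangle[OF H L0] L0_le by (simp add: h_def)
    finally show ?thesis by simp
  qed
  have muWE_le: "frob_norm (mu * (W\<^sup>T * E)) \<le> (h + c) / B * (c * \<eta>)"
  proof -
    have "frob_norm mu \<le> (h + c) / B" using mu_le B by (simp add: field_simps)
    then have "frob_norm mu * frob_norm (W\<^sup>T * E) \<le> (h + c) / B * (c * \<eta>)"
      using WE_le B h0 c by (intro mult_mono) auto
    then show ?thesis using frob_norm_mult[OF mu WE] by linarith
  qed
  have right_le: "frob_norm (Z * Mv) \<le> frob_norm Z" if "Z \<in> carrier_mat m T" for Z m
  proof -
    have "(Z * Mv)\<^sup>T = Mv * Z\<^sup>T" using that Mv(1,2) by (simp add: transpose_mult_dim)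
    then show ?thesis using Mv_le[of "Z\<^sup>T" m] that
      by (metis frob_norm_transpose transpose_carrier_mat)
  qed
  have "sqrt B * h = sqrt B * frob_norm (H\<^sup>T)" by (simp add: h_def)
  also have "\<dots> \<le> frob_norm (V * H\<^sup>T)" using H by (intro V_ge) auto
  also have "V * H\<^sup>T = (H * V\<^sup>T)\<^sup>T" using H V by (simp add: transpose_mult_dim)
  also have "frob_norm \<dots> \<le> frob_norm (E * Mv) + frob_norm (mu * (W\<^sup>T * E) * Mv)"
    unfolding frob_norm_transpose HV using E Mv(1) muWE by (intro frob_norm_minus_le) auto
  also have "\<dots> \<le> \<eta> + (h + c) / B * (c * \<eta>)"
    using right_le[OF E] right_le[OF muWE] E_le muWE_le by linarith
  finally have "sqrt B * h \<le> \<eta> + h * (c * \<eta> / B) + c\<^sup>2 / B * \<eta>"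
    by (simp add: algebra_simps add_divide_distrib power2_eq_square)
  \<comment> \<open>Here the circle closes: h is bounded by a term containing h, and the factor 2 in
    \<open>small\<close> lets half of the left side absorb it.\<close>
  moreover have sm: "h * (c * \<eta> / B) \<le> h * (sqrt B / 2)"
    using small B h0 by (intro mult_left_mono) (auto simp: field_simps)
  moreover have "(1 + c\<^sup>2 / B) * \<eta> = \<eta> + c\<^sup>2 / B * \<eta>" "h * (sqrt B / 2) = sqrt B * h / 2"
    by (simp_all add: distrib_right)
  ultimately have hs: "h * (sqrt B / 2) \<le> (1 + c\<^sup>2 / B) * \<eta>" by linarith
  then have h_le: "h \<le> 2 * (1 + c\<^sup>2 / B) / sqrt B * \<eta>"
    using B by (simp add: field_simps)
  have "lam * f\<^sup>T - L0 * F0\<^sup>T = H * F0\<^sup>T + mu * (W\<^sup>T * E)"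
  proof -
    have "H * F0\<^sup>T = mu * P * F0\<^sup>T - L0 * F0\<^sup>T"
      unfolding H_def using muP L0 F0 by (simp add: minus_mult_distrib_mat[of _ N R _ _ T])
    moreover have "Q + S - U = (Q - U) + S"
      if "Q \<in> carrier_mat N T" "S \<in> carrier_mat N T" "U \<in> carrier_mat N T" for Q S U :: "real mat"
      using that by (intro eq_matI) auto
    ultimately show ?thesis
      unfolding mug[symmetric] mug' using mult_carrier_mat[OF muP, of "F0\<^sup>T" T] F0 LF muWE by simp
  qed
  then have "frob_norm (lam * f\<^sup>T - L0 * F0\<^sup>T) \<le> frob_norm (H * F0\<^sup>T) + frob_norm (mu * (W\<^sup>T * E))"
    using H F0 muWE by (auto intro: frob_norm_triangle[of _ N T])
  also have "\<dots> \<le> h * c + (h + c) / B * (c * \<eta>)"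
  proof (intro add_mono muWE_le)
    have "frob_norm (H * F0\<^sup>T) \<le> h * frob_norm F0"
      using frob_norm_mult[of H N R "F0\<^sup>T" T] H F0 by (simp add: h_def)
    then show "frob_norm (H * F0\<^sup>T) \<le> h * c" using F0_le h0 by (meson mult_left_mono order.trans)
  qed
  also have "\<dots> = h * c + h * (c * \<eta> / B) + c\<^sup>2 / B * \<eta>"
    by (simp add: algebra_simps add_divide_distrib power2_eq_square)
  also have "\<dots> \<le> 2 * (1 + c\<^sup>2 / B) / sqrt B * \<eta> * c + (1 + c\<^sup>2 / B) * \<eta> + c\<^sup>2 / B * \<eta>"
    using mult_right_mono[OF h_le c] sm hs by linarith
  also have "\<dots> = (2 * (1 + c\<^sup>2 / B) / sqrt B * c + 1 + 2 * c\<^sup>2 / B) * \<eta>"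
    by (simp add: algebra_simps)
  finally show ?thesis .
qed

text \<open>Horizontal concatenation. It rewrites a sum of low-rank products as a single product C
  F', so that the widths, and with them the rank bounds, add up.\<close>

definition hcat :: "real mat \<Rightarrow> real mat \<Rightarrow> real mat" where
  "hcat A B = mat (dim_row A) (dim_col A + dim_col B)
     (\<lambda>(i,j). if j < dim_col A then A $$ (i,j) else B $$ (i, j - dim_col A))"

lemma hcat_carrier: "A \<in> carrier_mat n p \<Longrightarrow> B \<in> carrier_mat n q \<Longrightarrow> hcat A B \<in> carrier_mat n (p + q)"
  by (auto simp: hcat_def)

lemma hcat_mult_transpose:
  assumes "A \<in> carrier_mat n p" "B \<in> carrier_mat n q" "C \<in> carrier_mat m p" "D \<in> carrier_mat m q"
  shows "hcat A B * (hcat C D)\<^sup>T = A * C\<^sup>T + B * D\<^sup>T"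
proof (intro eq_matI)
  fix i j assume "i < dim_row (A * C\<^sup>T + B * D\<^sup>T)" "j < dim_col (A * C\<^sup>T + B * D\<^sup>T)"
  then have ij: "i < n" "j < m" using assms by auto
  let ?g = "\<lambda>k. hcat A B $$ (i,k) * hcat C D $$ (j,k)"
  have "(hcat A B * (hcat C D)\<^sup>T) $$ (i,j) = (\<Sum>k<p+q. ?g k)"
    using assms ij by (simp add: hcat_def scalar_prod_def lessThan_atLeast0)
  also have "\<dots> = (\<Sum>k<p. ?g k) + (\<Sum>k<q. ?g (p + k))"
    by (induction q) (auto simp: add.assoc)
  also have "\<dots> = (A * C\<^sup>T + B * D\<^sup>T) $$ (i,j)"
    using assms ij by (simp add: hcat_def scalar_prod_def lessThan_atLeast0)
  finally show "(hcat A B * (hcat C D)\<^sup>T) $$ (i,j) = (A * C\<^sup>T + B * D\<^sup>T) $$ (i,j)" .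
qed (use assms in \<open>auto simp: hcat_def\<close>)

section \<open>Linear combinations of regressors\<close>

lemma bdotX_carrier [simp]: "bdotX K b Xs N T \<in> carrier_mat N T"
  by (simp add: bdotX_def)

lemma bdotX_dim [simp]: "dim_row (bdotX K b Xs N T) = N" "dim_col (bdotX K b Xs N T) = T"
  by (simp_all add: bdotX_def)

lemma bdotX_add: "bdotX K (\<lambda>k. a k + b k) Xs N T = bdotX K a Xs N T + bdotX K b Xs N T"
  by (intro eq_matI) (auto simp: bdotX_def algebra_simps sum.distrib)

lemma bdotX_diff: "bdotX K (\<lambda>k. a k - b k) Xs N T = bdotX K a Xs N T - bdotX K b Xs N T"
  by (intro eq_matI) (auto simp: bdotX_def algebra_simps sum_subtractf)

lemma bdotX_scale: "bdotX K (\<lambda>k. s * b k) Xs N T = s \<cdot>\<^sub>m bdotX K b Xs N T"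
  by (intro eq_matI) (auto simp: bdotX_def sum_distrib_left mult.assoc)

lemma bdotX_smult:
  assumes "\<And>k. k < K \<Longrightarrow> Xs k \<in> carrier_mat N T"
  shows "bdotX K b (\<lambda>k. s \<cdot>\<^sub>m Xs k) N T = s \<cdot>\<^sub>m bdotX K b Xs N T"
proof (intro eq_matI)
  fix i j assume "i < dim_row (s \<cdot>\<^sub>m bdotX K b Xs N T)" "j < dim_col (s \<cdot>\<^sub>m bdotX K b Xs N T)"
  then have ij: "i < N" "j < T" by auto
  have "(\<Sum>k<K. b k * (s \<cdot>\<^sub>m Xs k) $$ (i,j)) = (\<Sum>k<K. s * (b k * Xs k $$ (i,j)))"
    using ij by (intro sum.cong) (auto simp: carrier_matD[OF assms])
  then show "bdotX K b (\<lambda>k. s \<cdot>\<^sub>m Xs k) N T $$ (i,j) = (s \<cdot>\<^sub>m bdotX K b Xs N T) $$ (i,j)"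
    using ij by (simp add: bdotX_def sum_distrib_left)
qed auto

lemma frob_inner_bdotX:
  assumes "\<And>k. k < K \<Longrightarrow> Xs k \<in> carrier_mat N T"
  shows "frob_inner (bdotX K b Xs N T) Z = (\<Sum>k<K. b k * frob_inner (Xs k) Z)"
proof -
  have "frob_inner (bdotX K b Xs N T) Z = (\<Sum>i<N. \<Sum>t<T. \<Sum>k<K. b k * (Xs k $$ (i,t) * Z $$ (i,t)))"
    by (simp add: frob_inner_def bdotX_def sum_distrib_right mult.assoc)
  also have "\<dots> = (\<Sum>i<N. \<Sum>k<K. \<Sum>t<T. b k * (Xs k $$ (i,t) * Z $$ (i,t)))"
    by (intro sum.cong refl sum.swap)
  also have "\<dots> = (\<Sum>k<K. \<Sum>i<N. \<Sum>t<T. b k * (Xs k $$ (i,t) * Z $$ (i,t)))"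
    by (rule sum.swap)
  also have "\<dots> = (\<Sum>k<K. b k * frob_inner (Xs k) Z)"
    by (intro sum.cong refl) (auto simp: frob_inner_def sum_distrib_left carrier_matD[OF assms])
  finally show ?thesis .
qed

lemma bdotX_Suc:
  assumes "Xs K \<in> carrier_mat N T"
  shows "bdotX (Suc K) b Xs N T = bdotX K b Xs N T + b K \<cdot>\<^sub>m Xs K"
  using assms by (intro eq_matI) (auto simp: bdotX_def)

lemma frob_norm_bdotX_le:
  assumes "\<And>k. k < K \<Longrightarrow> Xs k \<in> carrier_mat N T"
  shows "frob_norm (bdotX K b Xs N T) \<le> (\<Sum>k<K. \<bar>b k\<bar> * frob_norm (Xs k))"
  using assms
proof (induction K)
  case 0
  then show ?case by (simp add: frob_norm_def bdotX_def)
next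
  case (Suc K)
  have "frob_norm (bdotX (Suc K) b Xs N T) \<le> frob_norm (bdotX K b Xs N T) + frob_norm (b K \<cdot>\<^sub>m Xs K)"
    using Suc.prems[of K] by (auto simp: bdotX_Suc intro!: frob_norm_triangle[of _ N T])
  then show ?case using Suc.IH Suc.prems by (force simp: frob_norm_smult)
qed

lemma frob_norm_bdotX_le_uniform:
  assumes "\<And>k. k < K \<Longrightarrow> Xs k \<in> carrier_mat N T" "\<And>k. k < K \<Longrightarrow> frob_norm (Xs k) \<le> c"
    "\<And>k. k < K \<Longrightarrow> \<bar>b k\<bar> \<le> a"
  shows "frob_norm (bdotX K b Xs N T) \<le> real K * (a * c)"
proof -
  have "\<bar>b k\<bar> * frob_norm (Xs k) \<le> a * c" if "k < K" for k
    using assms(2,3)[OF that] by (intro mult_mono) auto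
  then have "(\<Sum>k<K. \<bar>b k\<bar> * frob_norm (Xs k)) \<le> (\<Sum>k<K. a * c)"
    by (intro sum_mono) auto
  then show ?thesis using frob_norm_bdotX_le[of K Xs N T b] assms(1) by simp
qed

section \<open>From near-minimality to a small residual\<close>

lemma quadratic_le_imp_small:
  fixes x a \<eta> :: real
  assumes "0 \<le> x" "x\<^sup>2 \<le> a * (1 + x)" "2 * a \<le> \<eta>\<^sup>2" "0 \<le> \<eta>" "\<eta> \<le> 1" "0 \<le> a"
  shows "x \<le> \<eta>"
proof (cases "x \<le> 1")
  case True
  then have "a * (1 + x) \<le> a * 2" using assms by (intro mult_left_mono) auto
  then have "x\<^sup>2 \<le> \<eta>\<^sup>2" using assms by linarith
  then show ?thesis using assms by (rule_tac power2_le_imp_le)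
next
  case False
  \<comment> \<open>This case is void: x > 1 would give x <= 2 a <= 1.\<close>
  then have "a * (1 + x) \<le> a * (2 * x)" using assms by (intro mult_left_mono) auto
  then have "x * x \<le> (2 * a) * x" using assms by (simp add: power2_eq_square)
  then have "x \<le> 2 * a" using False by simp
  also have "\<dots> \<le> 1" using assms power_le_one[of \<eta> 2] by linarith
  finally show ?thesis using False by simp
qed

text \<open>Expanding the square cancels ||e||^2 and bounds x^2, with x = ||Q + L||, by the slack
  and the cross terms. The size of \<open>L\<close> is unknown and is replaced by x + q0, which is
  why x returns on the right with the small factor 2 \<delta>2.\<close>

lemma near_minimizer_small:
  assumes e: "e \<in> carrier_mat N T" and Q: "Q \<in> carrier_mat N T" and L: "L \<in> carrier_mat N T"
    and fit: "(frob_norm (e - (Q + L)))\<^sup>2 \<le> (frob_norm e)\<^sup>2 + \<tau>"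
    and eQ: "\<bar>frob_inner e Q\<bar> \<le> \<delta>1" and eL: "\<bar>frob_inner e L\<bar> \<le> \<delta>2 * frob_norm L"
    and Q_le: "frob_norm Q \<le> q0" and \<delta>2: "0 \<le> \<delta>2"
    and a: "\<tau> + 2 * \<delta>1 + 2 * \<delta>2 * q0 \<le> a" "2 * \<delta>2 \<le> a" "2 * a \<le> \<eta>\<^sup>2" and \<eta>: "0 \<le> \<eta>" "\<eta> \<le> 1"
  shows "frob_norm (Q + L) \<le> \<eta>"
proof (rule quadratic_le_imp_small[OF _ _ a(3) \<eta>])
  let ?x = "frob_norm (Q + L)"
  have QL: "Q + L \<in> carrier_mat N T" using L by simp
  have "(frob_norm (e - (Q + L)))\<^sup>2 = (frob_norm e)\<^sup>2 - 2 * frob_inner e (Q + L) + ?x\<^sup>2"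
    unfolding frob_norm_square
      frob_inner_minus_left[OF e QL minus_carrier_mat[OF QL]] frob_inner_minus_right[OF e QL e] frob_inner_minus_right[OF e QL QL]
    using frob_inner_commute[OF e QL] by simp
  moreover have "frob_inner e (Q + L) = frob_inner e Q + frob_inner e L" by (rule frob_inner_add_right[OF Q L e])
  ultimately have 1: "?x\<^sup>2 \<le> \<tau> + 2 * frob_inner e Q + 2 * frob_inner e L" using fit by linarith
  have "L = (Q + L) - Q" using Q L by (intro eq_matI) auto
  then have "frob_norm L \<le> ?x + q0" using frob_norm_minus_le[OF QL Q] Q_le by simp
  then have "\<delta>2 * frob_norm L \<le> \<delta>2 * ?x + \<delta>2 * q0"
    using \<delta>2 by (metis mult_left_mono distrib_left)
  then have "?x\<^sup>2 \<le> \<tau> + 2 * \<delta>1 + 2 * \<delta>2 * q0 + 2 * \<delta>2 * ?x"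
    using 1 eQ eL by linarith
  also have "\<dots> \<le> a + a * ?x"
    using a by (intro add_mono mult_right_mono) auto
  finally show "?x\<^sup>2 \<le> a * (1 + ?x)" by (simp add: algebra_simps)
  show "0 \<le> a" using a \<delta>2 by linarith
qed auto

text \<open>The algebraic core in units where \<open>X\<close>, \<open>L0\<close> and
  \<open>F0\<close> have bounded norm. The factor \<open>s\<close> is the scaling of the regressors;
  \<open>w\<close> and \<open>v\<close> stay unscaled. Each stage multiplies \<eta> by a constant:
  the high-rank coefficients cost 1/sqrt b, moving their part into the error gives 1 + K c / sqrt b,
  and the factor recovery supplies the rest.\<close>

lemma deviation_bound:
  fixes X :: "nat \<Rightarrow> real mat" and L0 F0 w v lam f :: "real mat" and c B b \<kappa> s \<eta> :: real and d :: "nat \<Rightarrow> real"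
  assumes K1: "K1 \<le> K"
    and X: "\<And>k. k < K \<Longrightarrow> X k \<in> carrier_mat N T" and X_le: "\<And>k. k < K \<Longrightarrow> frob_norm (X k) \<le> c"
    and gram: "\<kappa> * (\<Sum>k<K. (d k)\<^sup>2) \<le> (frob_norm (bdotX K d X N T))\<^sup>2"
    and L0: "L0 \<in> carrier_mat N R" and F0: "F0 \<in> carrier_mat T R"
    and w: "w \<in> carrier_mat N K1" and v: "v \<in> carrier_mat T K1"
    and lam: "lam \<in> carrier_mat N R" and f: "f \<in> carrier_mat T R"
    and L0_le: "frob_norm L0 \<le> c" and F0_le: "frob_norm F0 \<le> c" and B: "0 < B" and b: "0 < b"
    and L0_ge: "\<And>m Z. Z \<in> carrier_mat R m \<Longrightarrow> B * (frob_norm Z)\<^sup>2 \<le> (frob_norm (annih w * L0 * Z))\<^sup>2"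
    and F0_ge: "\<And>m Z. Z \<in> carrier_mat R m \<Longrightarrow> B * (frob_norm Z)\<^sup>2 \<le> (frob_norm (annih v * F0 * Z))\<^sup>2"
    and low: "\<And>l i t. l < K1 \<Longrightarrow> i < N \<Longrightarrow> t < T \<Longrightarrow> X l $$ (i,t) = s * (w $$ (i,l) * v $$ (t,l))"
    and high: "\<And>\<alpha>. (\<forall>k. k < K1 \<or> K \<le> k \<longrightarrow> \<alpha> k = 0) \<Longrightarrow> (\<Sum>k<K. (\<alpha> k)\<^sup>2) = 1 \<Longrightarrow>
        b \<le> (\<Sum>r\<in>{2*R+K1+1..N}. eig_desc (bdotX K \<alpha> X N T * (bdotX K \<alpha> X N T)\<^sup>T) r)"
    and D_le: "frob_norm (bdotX K d X N T + (lam * f\<^sup>T - L0 * F0\<^sup>T)) \<le> \<eta>"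
    and small: "2 * c * ((1 + real K * c / sqrt b) * \<eta>) \<le> B * sqrt B"
  shows "sqrt \<kappa> * sqrt (\<Sum>k<K. (d k)\<^sup>2) \<le>
      ((2 * (1 + c\<^sup>2 / B) / sqrt B * c + 1 + 2 * c\<^sup>2 / B) * (1 + real K * c / sqrt b) + 1) * \<eta>"
proof -
  define D where "D = bdotX K d X N T + (lam * f\<^sup>T - L0 * F0\<^sup>T)"
  define dl where "dl k = (if k < K1 then d k else 0)" for k
  define dh where "dh k = (if k < K1 \<or> K \<le> k then 0 else d k)" for k
  \<comment> \<open>The low-rank coefficients form a diagonal matrix that also absorbs the scaling
    \<open>s\<close>.\<close>
  define J where "J = mat_diag K1 (\<lambda>l. s * d l)"
  have J: "J \<in> carrier_mat K1 K1" by (simp add: J_def)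
  let ?Xl = "bdotX K dl X N T" and ?Xh = "bdotX K dh X N T"
  have lf: "lam * f\<^sup>T \<in> carrier_mat N T" and LF: "L0 * F0\<^sup>T \<in> carrier_mat N T"
    and wJv: "w * J * v\<^sup>T \<in> carrier_mat N T" using lam f L0 F0 w v J by auto
  have rearr: "H - (G0 + (- 1) \<cdot>\<^sub>m G + (- 1) \<cdot>\<^sub>m S) = (S + H) + (G - G0)"
    "G + S = G0 + ((S + H) + (G - G0) - H)" "H = H + (G - G0) - (G - G0)"
    if "H \<in> carrier_mat N T" "G \<in> carrier_mat N T" "G0 \<in> carrier_mat N T" "S \<in> carrier_mat N T"
    for H G G0 S :: "real mat"
    using that by (auto intro!: eq_matI)
  have Dc: "D \<in> carrier_mat N T" unfolding D_def using minus_carrier_mat[OF LF] by simp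
  have D_le': "frob_norm D \<le> \<eta>" using D_le by (simp add: D_def)
  have \<eta>: "0 \<le> \<eta>" using D_le' frob_norm_nonneg[of D] by linarith
  have c: "0 \<le> c" using L0_le frob_norm_nonneg[of L0] by linarith
  have split: "bdotX K d X N T = ?Xl + ?Xh"
    unfolding bdotX_add[symmetric]
    by (intro eq_matI) (auto simp: bdotX_def dl_def dh_def intro!: sum.cong)
  have Xl: "?Xl = w * J * v\<^sup>T"
  proof (intro eq_matI)
    fix i t assume "i < dim_row (w * J * v\<^sup>T)" "t < dim_col (w * J * v\<^sup>T)"
    then have it: "i < N" "t < T" using w v by auto
    have "?Xl $$ (i,t) = (\<Sum>k<K. if k < K1 then d k * X k $$ (i,t) else 0)"
      using it by (auto simp: bdotX_def dl_def intro!: sum.cong)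
    also have "\<dots> = (\<Sum>k<K1. d k * X k $$ (i,t))"
      using K1 by (intro sum.mono_neutral_cong_right) auto
    also have "\<dots> = (\<Sum>k<K1. w $$ (i,k) * (s * d k) * v $$ (t,k))"
      using low[OF _ it] by (intro sum.cong) auto
    also have "\<dots> = (w * J * v\<^sup>T) $$ (i,t)"
      unfolding J_def mat_diag_mult_right[OF w] using it w v
      by (simp add: scalar_prod_def lessThan_atLeast0)
    finally show "?Xl $$ (i,t) = (w * J * v\<^sup>T) $$ (i,t)" .
  qed (use w v in auto)
  define n where "n = sqrt (\<Sum>k<K. (dh k)\<^sup>2)"
  have n2: "n\<^sup>2 = (\<Sum>k<K. (dh k)\<^sup>2)" unfolding n_def by (intro real_sqrt_pow2 sum_nonneg) auto
  have n0: "0 \<le> n" unfolding n_def by (intro real_sqrt_ge_zero sum_nonneg) auto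
  have n_le: "sqrt b * n \<le> \<eta>"
  proof (cases "n = 0")
    case True
    then show ?thesis using \<eta> by simp
  next
    case False
    \<comment> \<open>The eigenvalue condition concerns unit vectors, so the high-rank coefficients
      are normalized; the residual is divided by n as well.\<close>
    define \<alpha> where "\<alpha> k = (1 / n) * dh k" for k
    have "(\<Sum>k<K. (\<alpha> k)\<^sup>2) = (1 / n)\<^sup>2 * n\<^sup>2"
      unfolding \<alpha>_def n2 by (simp add: power_mult_distrib power_divide sum_distrib_left)
    then have \<alpha>1: "(\<Sum>k<K. (\<alpha> k)\<^sup>2) = 1" using False by (simp add: power_divide)
    have \<alpha>0: "\<forall>k. k < K1 \<or> K \<le> k \<longrightarrow> \<alpha> k = 0" by (auto simp: \<alpha>_def dh_def)
    \<comment> \<open>Two common components of width R and the low-rank regressors of width K1 make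
      up the 2 R + K1 columns at which the eigenvalue sum is cut off.\<close>
    define C where "C = hcat (hcat L0 ((- 1) \<cdot>\<^sub>m lam)) ((- 1) \<cdot>\<^sub>m (w * J))"
    define F where "F = hcat (hcat F0 f) v"
    have C: "C \<in> carrier_mat N (2 * R + K1)" and F: "F \<in> carrier_mat T (2 * R + K1)"
      unfolding C_def F_def mult_2 using L0 lam w J F0 f v by (auto intro!: hcat_carrier)
    have CF: "C * F\<^sup>T = L0 * F0\<^sup>T + (- 1) \<cdot>\<^sub>m (lam * f\<^sup>T) + (- 1) \<cdot>\<^sub>m (w * J * v\<^sup>T)"
    proof -
      have "C * F\<^sup>T = hcat L0 ((- 1) \<cdot>\<^sub>m lam) * (hcat F0 f)\<^sup>T + ((- 1) \<cdot>\<^sub>m (w * J)) * v\<^sup>T"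
        unfolding C_def F_def
        by (rule hcat_mult_transpose[of _ N "R + R" _ K1 _ T])
           (use L0 lam w J F0 f v in \<open>auto intro: hcat_carrier\<close>)
      also have "hcat L0 ((- 1) \<cdot>\<^sub>m lam) * (hcat F0 f)\<^sup>T = L0 * F0\<^sup>T + ((- 1) \<cdot>\<^sub>m lam) * f\<^sup>T"
        by (rule hcat_mult_transpose[of _ N R _ R _ T]) (use L0 lam F0 f in auto)
      also have "((- 1) \<cdot>\<^sub>m lam) * f\<^sup>T = (- 1) \<cdot>\<^sub>m (lam * f\<^sup>T)"
        by (rule mult_smult_assoc_mat[of _ N R _ T]) (use lam f in auto)
      also have "((- 1) \<cdot>\<^sub>m (w * J)) * v\<^sup>T = (- 1) \<cdot>\<^sub>m (w * J * v\<^sup>T)"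
        by (rule mult_smult_assoc_mat[of _ N K1 _ T]) (use w J v in auto)
      finally show ?thesis .
    qed
    have "?Xh - C * F\<^sup>T = D"
      unfolding CF D_def split Xl by (rule rearr(1)[OF bdotX_carrier lf LF wJv])
    moreover have "(1 / n) \<cdot>\<^sub>m G - (1 / n) \<cdot>\<^sub>m S = (1 / n) \<cdot>\<^sub>m (G - S)"
      if "G \<in> carrier_mat N T" "S \<in> carrier_mat N T" for G S :: "real mat"
      using that by (intro eq_matI) (auto simp: algebra_simps)
    ultimately have "bdotX K \<alpha> X N T - ((1 / n) \<cdot>\<^sub>m C) * F\<^sup>T = (1 / n) \<cdot>\<^sub>m D"
      unfolding \<alpha>_def bdotX_scale using mult_smult_assoc_mat[OF C, of "F\<^sup>T" T "1 / n"] F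
        mult_carrier_mat[OF C, of "F\<^sup>T" T] by simp
    then have "(\<Sum>r\<in>{2*R+K1+1..N}. eig_desc (bdotX K \<alpha> X N T * (bdotX K \<alpha> X N T)\<^sup>T) r)
        \<le> (frob_norm ((1 / n) \<cdot>\<^sub>m D))\<^sup>2"
      using sum_eig_desc_le_low_rank_error[of "bdotX K \<alpha> X N T" N T "(1 / n) \<cdot>\<^sub>m C" "2 * R + K1" F] C F
      by simp
    also have "\<dots> = (frob_norm D)\<^sup>2 / n\<^sup>2" by (simp add: frob_norm_smult power_divide)
    also have "\<dots> \<le> \<eta>\<^sup>2 / n\<^sup>2" using D_le' by (intro divide_right_mono power_mono) auto
    finally have "b \<le> \<eta>\<^sup>2 / n\<^sup>2" using high[OF \<alpha>0 \<alpha>1] by linarith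
    then have "b * n\<^sup>2 \<le> \<eta>\<^sup>2" using False by (simp add: pos_le_divide_eq)
    then show ?thesis
      by (intro power2_le_imp_le[OF _ \<eta>]) (use b in \<open>simp add: power_mult_distrib\<close>)
  qed
  have "frob_norm ?Xh \<le> real K * (n * c)"
  proof (rule frob_norm_bdotX_le_uniform[OF X X_le])
    fix k assume "k < K"
    then have "(dh k)\<^sup>2 \<le> n\<^sup>2" unfolding n2 by (intro member_le_sum) auto
    then show "\<bar>dh k\<bar> \<le> n" using n0 by (metis power2_le_iff_abs_le)
  qed
  also have "\<dots> \<le> real K * (\<eta> / sqrt b * c)"
    using n_le b c by (intro mult_left_mono mult_right_mono) (auto simp: field_simps)
  finally have Xh_le: "frob_norm ?Xh \<le> real K * c / sqrt b * \<eta>" by (simp add: ac_simps)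
  \<comment> \<open>Once its coefficients are known to be small, the high-rank part is counted as
    error, which leaves an equation between low-rank matrices.\<close>
  define E where "E = D - ?Xh"
  have E: "E \<in> carrier_mat N T" unfolding E_def by (rule minus_carrier_mat) simp
  have "frob_norm E \<le> (1 + real K * c / sqrt b) * \<eta>"
    using frob_norm_minus_le[OF Dc bdotX_carrier, of K dh X] D_le' Xh_le
    by (simp add: E_def algebra_simps)
  moreover have "lam * f\<^sup>T + w * J * v\<^sup>T = L0 * F0\<^sup>T + E"
    unfolding E_def D_def split Xl by (rule rearr(2)[OF bdotX_carrier lf LF wJv])
  ultimately have rec: "frob_norm (lam * f\<^sup>T - L0 * F0\<^sup>T) \<le>
      (2 * (1 + c\<^sup>2 / B) / sqrt B * c + 1 + 2 * c\<^sup>2 / B) * ((1 + real K * c / sqrt b) * \<eta>)"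
    using small by (intro low_rank_factor_recovery[OF L0 F0 w v J lam f E _ B L0_le F0_le L0_ge F0_ge])
  have "bdotX K d X N T = D - (lam * f\<^sup>T - L0 * F0\<^sup>T)"
    unfolding D_def by (rule rearr(3)[OF bdotX_carrier lf LF wJv])
  then have "frob_norm (bdotX K d X N T) \<le> frob_norm D + frob_norm (lam * f\<^sup>T - L0 * F0\<^sup>T)"
    using frob_norm_minus_le[OF Dc minus_carrier_mat[OF LF]] by simp
  also have "\<dots> \<le> ((2 * (1 + c\<^sup>2 / B) / sqrt B * c + 1 + 2 * c\<^sup>2 / B) * (1 + real K * c / sqrt b) + 1) * \<eta>"
    using D_le' rec by (simp add: algebra_simps)
  finally have "frob_norm (bdotX K d X N T) \<le> \<dots>" .
  moreover have "sqrt \<kappa> * sqrt (\<Sum>k<K. (d k)\<^sup>2) \<le> frob_norm (bdotX K d X N T)"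
    using real_sqrt_le_mono[OF gram] by (simp add: real_sqrt_mult)
  ultimately show ?thesis by linarith
qed

section \<open>Convergence in outer probability\<close>

lemma outer_prob_bdd_below: "bdd_below (measure M ` {A \<in> sets M. S \<inter> space M \<subseteq> A})"
  by (rule bdd_belowI[of _ 0]) auto

lemma outer_prob_le: "A \<in> sets M \<Longrightarrow> S \<inter> space M \<subseteq> A \<Longrightarrow> outer_prob M S \<le> measure M A"
  unfolding outer_prob_def by (intro cInf_lower outer_prob_bdd_below) auto

lemma outer_prob_nonneg: "0 \<le> outer_prob M S"
  unfolding outer_prob_def by (rule cInf_greatest) auto

lemma outer_prob_mono: "S \<inter> space M \<subseteq> S' \<Longrightarrow> outer_prob M S \<le> outer_prob M S'"
  unfolding outer_prob_def
  by (intro cInf_superset_mono outer_prob_bdd_below image_mono) auto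

text \<open>Measurable covers within \<epsilon>/2 of the two infima are united. This subadditivity
  is what lets events be intersected without measurability.\<close>

lemma (in prob_space) outer_prob_Un: "outer_prob M (S \<union> S') \<le> outer_prob M S + outer_prob M S'"
proof (rule field_le_epsilon)
  fix \<epsilon> :: real assume "0 < \<epsilon>"
  have ex: "\<exists>A\<in>sets M. S \<inter> space M \<subseteq> A \<and> prob A < outer_prob M S + \<epsilon> / 2" for S
    using cInf_lessD[of "measure M ` {A \<in> sets M. S \<inter> space M \<subseteq> A}" "outer_prob M S + \<epsilon> / 2"] \<open>0 < \<epsilon>\<close>
    unfolding outer_prob_def by auto
  obtain A A' where A: "A \<in> sets M" "S \<inter> space M \<subseteq> A" "prob A < outer_prob M S + \<epsilon> / 2"
    and A': "A' \<in> sets M" "S' \<inter> space M \<subseteq> A'" "prob A' < outer_prob M S' + \<epsilon> / 2"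
    using ex[of S] ex[of S'] by blast
  have "outer_prob M (S \<union> S') \<le> prob (A \<union> A')"
    using A A' by (intro outer_prob_le) auto
  also have "\<dots> \<le> prob A + prob A'" using A A' by (intro measure_Un_le)
  finally show "outer_prob M (S \<union> S') \<le> outer_prob M S + outer_prob M S' + \<epsilon>"
    using A A' by linarith
qed

text \<open>Turns a limit in probability into events, one for each tolerance, that can be combined
  with the other conditions.\<close>

lemma plim_to_iff_wpa1:
  "plim_to M Z c \<longleftrightarrow> (\<forall>\<epsilon>>0. wpa1 M (\<lambda>N T \<omega>. \<bar>Z N T \<omega> - c\<bar> \<le> \<epsilon>))"
  unfolding plim_to_def wpa1_def by (simp add: not_le)

lemma eventually_NT_lim_pos: "\<forall>\<^sub>F (N,T) in NT_lim. 0 < N \<and> 0 < T"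
  unfolding eventually_prod_sequentially by (rule exI[of _ 1]) auto

text \<open>The implication is asked only for positive N and T, because the limit ignores the other
  indices; there the divisions by N and T are genuine.\<close>

lemma wpa1_mono:
  assumes P: "wpa1 M P"
    and imp: "\<And>N T \<omega>. 0 < N \<Longrightarrow> 0 < T \<Longrightarrow> \<omega> \<in> space M \<Longrightarrow> P N T \<omega> \<Longrightarrow> Q N T \<omega>"
  shows "wpa1 M Q"
  unfolding wpa1_def
proof (rule tendsto_sandwich[OF _ _ tendsto_const P[unfolded wpa1_def]])
  show "\<forall>\<^sub>F x in NT_lim. 0 \<le> (case x of (N, T) \<Rightarrow> outer_prob M {\<omega> \<in> space M. \<not> Q N T \<omega>})"
    by (auto simp: outer_prob_nonneg intro!: always_eventually)
  show "\<forall>\<^sub>F x in NT_lim. (case x of (N, T) \<Rightarrow> outer_prob M {\<omega> \<in> space M. \<not> Q N T \<omega>})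
      \<le> (case x of (N, T) \<Rightarrow> outer_prob M {\<omega> \<in> space M. \<not> P N T \<omega>})"
    by (rule eventually_mono[OF eventually_NT_lim_pos]) (auto intro!: outer_prob_mono dest: imp)
qed

lemma (in prob_space) wpa1_conj:
  assumes "wpa1 M P" "wpa1 M Q"
  shows "wpa1 M (\<lambda>N T \<omega>. P N T \<omega> \<and> Q N T \<omega>)"
proof -
  have lim: "((\<lambda>(N,T). outer_prob M {\<omega> \<in> space M. \<not> P N T \<omega>} + outer_prob M {\<omega> \<in> space M. \<not> Q N T \<omega>})
      \<longlongrightarrow> 0) NT_lim"
    using tendsto_add[OF assms[unfolded wpa1_def]] by (simp add: case_prod_unfold)
  show ?thesis
    unfolding wpa1_def
  proof (rule tendsto_sandwich[OF _ _ tendsto_const lim])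
    show "\<forall>\<^sub>F x in NT_lim. 0 \<le> (case x of (N, T) \<Rightarrow> outer_prob M {\<omega> \<in> space M. \<not> (P N T \<omega> \<and> Q N T \<omega>)})"
      by (auto simp: outer_prob_nonneg intro!: always_eventually)
    have "outer_prob M {\<omega> \<in> space M. \<not> (P N T \<omega> \<and> Q N T \<omega>)}
        \<le> outer_prob M {\<omega> \<in> space M. \<not> P N T \<omega>} + outer_prob M {\<omega> \<in> space M. \<not> Q N T \<omega>}" for N T
      by (rule order.trans[OF outer_prob_mono outer_prob_Un]) auto
    then show "\<forall>\<^sub>F x in NT_lim. (case x of (N, T) \<Rightarrow> outer_prob M {\<omega> \<in> space M. \<not> (P N T \<omega> \<and> Q N T \<omega>)})
      \<le> (case x of (N, T) \<Rightarrow> outer_prob M {\<omega> \<in> space M. \<not> P N T \<omega>} + outer_prob M {\<omega> \<in> space M. \<not> Q N T \<omega>})"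
      by (auto intro!: always_eventually)
  qed
qed

lemma (in prob_space) wpa1_True: "wpa1 M (\<lambda>N T \<omega>. True)"
proof -
  have "outer_prob M {} \<le> 0" using outer_prob_le[of "{}" M "{}"] by simp
  then have "outer_prob M {} = 0" using outer_prob_nonneg[of M "{}"] by linarith
  then show ?thesis by (simp add: wpa1_def case_prod_unfold)
qed

lemma (in prob_space) wpa1_all_less:
  assumes "\<And>k. k < (n::nat) \<Longrightarrow> wpa1 M (P k)"
  shows "wpa1 M (\<lambda>N T \<omega>. \<forall>k<n. P k N T \<omega>)"
  using assms
proof (induction n)
  case 0
  then show ?case using wpa1_True by simp
next
  case (Suc n)
  have "wpa1 M (\<lambda>N T \<omega>. (\<forall>k<n. P k N T \<omega>) \<and> P n N T \<omega>)"
    using Suc by (intro wpa1_conj) auto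
  then show ?case by (rule wpa1_mono) (auto simp: less_Suc_eq)
qed

lemma (in prob_space) plim_pd_wpa1:
  assumes "\<forall>i<d. \<forall>j<d. plim_to M (\<lambda>N T \<omega>. Z N T \<omega> $$ (i,j)) (A $$ (i,j))" "0 < \<epsilon>"
  shows "wpa1 M (\<lambda>N T \<omega>. \<forall>i<d. \<forall>j<d. \<bar>Z N T \<omega> $$ (i,j) - A $$ (i,j)\<bar> \<le> \<epsilon>)"
  using assms by (intro wpa1_all_less) (simp add: plim_to_iff_wpa1)

section \<open>Consistency\<close>

text \<open>Positive definiteness is applied to each column of \<open>Z\<close> and summed. A zero
  column is treated separately, since \<open>pd_mat\<close> is silent about it.\<close>

lemma pd_mat_minus_smult_one_lower_bound:
  assumes S: "S \<in> carrier_mat R R" and pd: "pd_mat (S - B \<cdot>\<^sub>m 1\<^sub>m R)" and Z: "Z \<in> carrier_mat R m"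
  shows "B * (frob_norm Z)\<^sup>2 \<le> frob_inner Z (S * Z)"
proof -
  have col: "B * (\<Sum>i<R. (Z $$ (i,j))\<^sup>2) \<le> (\<Sum>i<R. \<Sum>k<R. Z $$ (i,j) * S $$ (i,k) * Z $$ (k,j))"
    if j: "j < m" for j
  proof -
    define x where "x = vec R (\<lambda>i. Z $$ (i,j))"
    have x: "x \<in> carrier_vec R" by (simp add: x_def)
    have "0 \<le> scalar_prod x ((S - B \<cdot>\<^sub>m 1\<^sub>m R) *\<^sub>v x)"
    proof (cases "x = 0\<^sub>v R")
      case True
      then show ?thesis using S by (simp add: scalar_prod_def)
    next
      case False
      then show ?thesis using pd x S by (auto simp: pd_mat_def intro: less_imp_le)
    qed
    also have "\<dots> = (\<Sum>i<R. \<Sum>k<R. Z $$ (i,j) * (S $$ (i,k) - B * (if i = k then 1 else 0)) * Z $$ (k,j))"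
      using S by (simp add: x_def scalar_prod_def lessThan_atLeast0 sum_distrib_left mult.assoc)
    also have "\<dots> = (\<Sum>i<R. (\<Sum>k<R. Z $$ (i,j) * S $$ (i,k) * Z $$ (k,j)) - B * (Z $$ (i,j))\<^sup>2)"
    proof (intro sum.cong refl)
      fix i assume "i \<in> {..<R}"
      then have "(\<Sum>k<R. Z $$ (i,j) * (B * (if i = k then 1 else 0)) * Z $$ (k,j)) = B * (Z $$ (i,j))\<^sup>2"
        by (simp add: if_distrib if_distribR power2_eq_square cong: if_cong)
      then show "(\<Sum>k<R. Z $$ (i,j) * (S $$ (i,k) - B * (if i = k then 1 else 0)) * Z $$ (k,j)) =
          (\<Sum>k<R. Z $$ (i,j) * S $$ (i,k) * Z $$ (k,j)) - B * (Z $$ (i,j))\<^sup>2"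
        by (simp only: right_diff_distrib left_diff_distrib sum_subtractf)
    qed
    finally show ?thesis by (simp add: sum_subtractf sum_distrib_left)
  qed
  have "B * (frob_norm Z)\<^sup>2 = B * (\<Sum>i<R. \<Sum>j<m. (Z $$ (i,j))\<^sup>2)"
    unfolding frob_norm_square using Z by (simp add: frob_inner_def power2_eq_square)
  also have "\<dots> = (\<Sum>j<m. B * (\<Sum>i<R. (Z $$ (i,j))\<^sup>2))"
    by (subst sum.swap) (rule sum_distrib_left)
  also have "\<dots> \<le> (\<Sum>j<m. \<Sum>i<R. \<Sum>k<R. Z $$ (i,j) * S $$ (i,k) * Z $$ (k,j))"
    using col by (intro sum_mono) auto
  also have "\<dots> = (\<Sum>i<R. \<Sum>j<m. \<Sum>k<R. Z $$ (i,j) * S $$ (i,k) * Z $$ (k,j))"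
    by (rule sum.swap)
  also have "\<dots> = frob_inner Z (S * Z)"
    using Z S by (simp add: frob_inner_def scalar_prod_def lessThan_atLeast0 sum_distrib_left mult.assoc)
  finally show ?thesis .
qed

text \<open>Brings the assumption on the projected factors into the form required for the recovery:
  by symmetry and idempotence of the annihilator, the quadratic form of lam0' M_w lam0 / N is the
  squared norm of M_w applied to the scaled loading.\<close>

lemma scaled_annih_factor_lower_bound:
  assumes L0: "L0 \<in> carrier_mat N R" and w: "w \<in> carrier_mat N k" and N: "0 < N"
    and pd: "pd_mat ((1 / real N) \<cdot>\<^sub>m (L0\<^sup>T * annih w * L0) - B \<cdot>\<^sub>m 1\<^sub>m R)" and Z: "Z \<in> carrier_mat R m"
  shows "B * (frob_norm Z)\<^sup>2 \<le> (frob_norm (annih w * ((1 / sqrt (real N)) \<cdot>\<^sub>m L0) * Z))\<^sup>2"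
proof -
  define Mw where "Mw = annih w"
  have Mw: "Mw \<in> carrier_mat N N" using annih_carrier[OF w] by (simp add: Mw_def)
  define S where "S = L0\<^sup>T * Mw * L0"
  have S: "S \<in> carrier_mat R R" using L0 Mw by (simp add: S_def)
  have L0Z: "L0 * Z \<in> carrier_mat N m" using L0 Z by simp
  have "B * (frob_norm Z)\<^sup>2 \<le> frob_inner Z (((1 / real N) \<cdot>\<^sub>m S) * Z)"
    using pd Z S by (intro pd_mat_minus_smult_one_lower_bound) (auto simp: S_def Mw_def)
  also have "((1 / real N) \<cdot>\<^sub>m S) * Z = (1 / real N) \<cdot>\<^sub>m (S * Z)"
    by (rule mult_smult_assoc_mat[OF S Z])
  also have "frob_inner Z ((1 / real N) \<cdot>\<^sub>m (S * Z)) = (1 / real N) * frob_inner (S * Z) Z"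
    using frob_inner_commute[OF Z smult_carrier_mat[OF mult_carrier_mat[OF S Z]]] frob_inner_smult_left[OF mult_carrier_mat[OF S Z]]
    by simp
  also have "frob_inner (S * Z) Z = frob_inner Z (L0\<^sup>T * (Mw * (L0 * Z)))"
    unfolding S_def using frob_inner_commute[OF mult_carrier_mat[OF S Z] Z] L0 Mw Z
    by (simp add: S_def mult_mat_assoc_dim)
  also have "\<dots> = frob_inner (L0 * Z) (Mw * (L0 * Z))"
    by (rule frob_inner_mult_left[OF L0 Z mult_carrier_mat[OF Mw L0Z], symmetric])
  also have "\<dots> = (frob_norm (Mw * (L0 * Z)))\<^sup>2"
    unfolding Mw_def by (rule frob_norm_annih_mult_sq[OF w L0Z, symmetric])
  also have "(1 / real N) * \<dots> = (frob_norm ((1 / sqrt (real N)) \<cdot>\<^sub>m (Mw * (L0 * Z))))\<^sup>2"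
    by (simp add: frob_norm_smult power_divide)
  also have "(1 / sqrt (real N)) \<cdot>\<^sub>m (Mw * (L0 * Z)) = Mw * ((1 / sqrt (real N)) \<cdot>\<^sub>m L0) * Z"
  proof -
    have "Mw * ((1 / sqrt (real N)) \<cdot>\<^sub>m L0) * Z = ((1 / sqrt (real N)) \<cdot>\<^sub>m (Mw * L0)) * Z"
      by (simp only: mult_smult_distrib[OF Mw L0])
    also have "\<dots> = (1 / sqrt (real N)) \<cdot>\<^sub>m ((Mw * L0) * Z)"
      by (rule mult_smult_assoc_mat[OF mult_carrier_mat[OF Mw L0] Z])
    also have "(Mw * L0) * Z = Mw * (L0 * Z)" by (rule assoc_mult_mat[OF Mw L0 Z])
    finally show ?thesis by simp
  qed
  finally show ?thesis by (simp add: Mw_def)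
qed

section \<open>The estimate at one sample point\<close>

lemma mat_tr_mult_transpose:
  "A \<in> carrier_mat n m \<Longrightarrow> B \<in> carrier_mat n m \<Longrightarrow> mat_tr (A * B\<^sup>T) = frob_inner A B"
  by (simp add: mat_tr_def frob_inner_def scalar_prod_def lessThan_atLeast0)

text \<open>A pair whose value lies within \<delta> of the infimum is enough, so attainment need not
  be discussed; the slack \<delta> joins the other errors.\<close>

lemma LNT_near_minimizer:
  assumes N: "0 < N" and T: "0 < T"
    and e: "e \<in> carrier_mat N T" and lam0: "lam0 \<in> carrier_mat N R" and f0: "f0 \<in> carrier_mat T R"
    and model: "Y = bdotX K b0 X N T + lam0 * f0\<^sup>T + e"
    and argmin: "LNT K R N T Y X b \<le> LNT K R N T Y X b0" and \<delta>: "0 < \<delta>"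
  obtains lam f where "lam \<in> carrier_mat N R" "f \<in> carrier_mat T R"
    "(frob_norm (e - (bdotX K (\<lambda>k. b k - b0 k) X N T + (lam * f\<^sup>T - lam0 * f0\<^sup>T))))\<^sup>2 / (real N * real T)
      < (frob_norm e)\<^sup>2 / (real N * real T) + \<delta>"
proof -
  define V where "V b = {(frob_norm (Y - bdotX K b X N T - lam * f\<^sup>T))\<^sup>2 / (real N * real T)
        | lam f. lam \<in> carrier_mat N R \<and> f \<in> carrier_mat T R}" for b
  have LNT: "LNT K R N T Y X b = Inf (V b)" for b by (simp add: LNT_def V_def)
  have ident: "Bb0 + G0 + e - Bb - G = e - ((Bb - Bb0) + (G - G0))"
    if "Bb0 \<in> carrier_mat N T" "Bb \<in> carrier_mat N T" "G0 \<in> carrier_mat N T" "G \<in> carrier_mat N T" for Bb0 Bb G0 G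
    using that e by (intro eq_matI) auto
  have G: "lam * f\<^sup>T \<in> carrier_mat N T" if "lam \<in> carrier_mat N R" "f \<in> carrier_mat T R" for lam f :: "real mat"
    using that by simp
  have resid: "Y - bdotX K b X N T - lam * f\<^sup>T =
      e - (bdotX K (\<lambda>k. b k - b0 k) X N T + (lam * f\<^sup>T - lam0 * f0\<^sup>T))"
    if "lam \<in> carrier_mat N R" "f \<in> carrier_mat T R" for lam f b
    unfolding model bdotX_diff by (rule ident[OF bdotX_carrier bdotX_carrier G[OF lam0 f0] G[OF that]])
  have bdd: "bdd_below (V b)" for b by (rule bdd_belowI[of _ 0]) (auto simp: V_def)
  \<comment> \<open>At the true parameters the residual is exactly \<open>e\<close>, which bounds
    the infimum at \<open>b0\<close> from above.\<close>
  have "e - (bdotX K (\<lambda>k. b0 k - b0 k) X N T + (lam0 * f0\<^sup>T - lam0 * f0\<^sup>T)) = e"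
  proof -
    have "bdotX K (\<lambda>k. b0 k - b0 k) X N T + (G - G) = 0\<^sub>m N T" if "G \<in> carrier_mat N T" for G :: "real mat"
      using that by (intro eq_matI) (auto simp: bdotX_def)
    from this[OF G[OF lam0 f0]] show ?thesis by (simp add: minus_zero_mat[OF e])
  qed
  then have "(frob_norm e)\<^sup>2 / (real N * real T) \<in> V b0"
    using resid[OF lam0 f0, of b0] lam0 f0 unfolding V_def by force
  then have "Inf (V b0) \<le> (frob_norm e)\<^sup>2 / (real N * real T)" by (rule cInf_lower[OF _ bdd])
  then have "Inf (V b) < (frob_norm e)\<^sup>2 / (real N * real T) + \<delta>"
    using argmin \<delta> by (simp add: LNT)
  moreover have "V b \<noteq> {}" using lam0 f0 by (auto simp: V_def)
  ultimately obtain r where "r \<in> V b" "r < (frob_norm e)\<^sup>2 / (real N * real T) + \<delta>"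
    using cInf_lessD by blast
  then show ?thesis using that resid by (auto simp: V_def)
qed

text \<open>Scaling regressors and error by 1/sqrt(NT), loadings by 1/sqrt N and factors by 1/sqrt T
  frees every constant of N and T. The single \<open>c\<close> bounds the coordinates of the
  deviation as well as all scaled norms, and \<delta> serves at once as slack of the minimization
  and as tolerance for the traces and the spectral norm.\<close>

lemma finite_sample_bound:
  fixes X :: "nat \<Rightarrow> real mat" and Y e lam0 f0 w v :: "real mat" and bh b0 :: "nat \<Rightarrow> real"
    and c B b \<kappa> \<delta> \<eta> a :: real
  assumes N: "0 < N" and T: "0 < T" and K1: "K1 \<le> K"
    and X: "\<And>k. k < K \<Longrightarrow> X k \<in> carrier_mat N T"
    and e: "e \<in> carrier_mat N T" and lam0: "lam0 \<in> carrier_mat N R" and f0: "f0 \<in> carrier_mat T R"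
    and w: "w \<in> carrier_mat N K1" and v: "v \<in> carrier_mat T K1"
    and model: "Y = bdotX K b0 X N T + lam0 * f0\<^sup>T + e"
    and argmin: "LNT K R N T Y X bh \<le> LNT K R N T Y X b0"
    and d_le: "\<And>k. k < K \<Longrightarrow> \<bar>bh k - b0 k\<bar> \<le> c"
    and lam0_le: "(frob_norm lam0)\<^sup>2 / real N \<le> c\<^sup>2" and f0_le: "(frob_norm f0)\<^sup>2 / real T \<le> c\<^sup>2"
    and X_le: "\<And>k. k < K \<Longrightarrow> (frob_norm (X k))\<^sup>2 / (real N * real T) \<le> c\<^sup>2"
    and gram: "\<kappa> * (\<Sum>k<K. (bh k - b0 k)\<^sup>2) \<le> (frob_norm (bdotX K (\<lambda>k. bh k - b0 k) X N T))\<^sup>2 / (real N * real T)"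
    and tr: "\<And>k. k < K \<Longrightarrow> \<bar>mat_tr (X k * e\<^sup>T) / (real N * real T)\<bar> \<le> \<delta>"
    and spec: "\<bar>spec_norm e / sqrt (real N * real T)\<bar> \<le> \<delta>"
    and low: "\<And>l i t. l < K1 \<Longrightarrow> i < N \<Longrightarrow> t < T \<Longrightarrow> X l $$ (i,t) = w $$ (i,l) * v $$ (t,l)"
    and high: "\<And>\<alpha>. (\<forall>k. k < K1 \<or> K \<le> k \<longrightarrow> \<alpha> k = 0) \<Longrightarrow> (\<Sum>k<K. (\<alpha> k)\<^sup>2) = 1 \<Longrightarrow>
        b \<le> (\<Sum>r\<in>{2*R+K1+1..N}. eig_desc ((1 / (real N * real T)) \<cdot>\<^sub>m (bdotX K \<alpha> X N T * (bdotX K \<alpha> X N T)\<^sup>T)) r)"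
    and pd_lam: "pd_mat ((1 / real N) \<cdot>\<^sub>m (lam0\<^sup>T * annih w * lam0) - B \<cdot>\<^sub>m 1\<^sub>m R)"
    and pd_f: "pd_mat ((1 / real T) \<cdot>\<^sub>m (f0\<^sup>T * annih v * f0) - B \<cdot>\<^sub>m 1\<^sub>m R)"
    and B: "0 < B" and b: "0 < b" and c: "0 \<le> c" and \<delta>: "0 < \<delta>"
    and a: "2 * \<delta> * (1 + real K * c + sqrt (real (2 * R)) + sqrt (real (2 * R)) * (real K * (c * c))) \<le> a"
    and \<eta>: "2 * a \<le> \<eta>\<^sup>2" "0 \<le> \<eta>" "\<eta> \<le> 1"
    and small: "2 * c * ((1 + real K * c / sqrt b) * \<eta>) \<le> B * sqrt B"
  shows "sqrt \<kappa> * sqrt (\<Sum>k<K. (bh k - b0 k)\<^sup>2) \<le>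
      ((2 * (1 + c\<^sup>2 / B) / sqrt B * c + 1 + 2 * c\<^sup>2 / B) * (1 + real K * c / sqrt b) + 1) * \<eta>"
proof -
  define d where "d k = bh k - b0 k" for k
  have d_eq: "d = (\<lambda>k. bh k - b0 k)" by (simp add: fun_eq_iff d_def)
  define s where "s = 1 / sqrt (real N * real T)"
  have s0: "0 < s" using N T by (simp add: s_def)
  have s2: "s\<^sup>2 = 1 / (real N * real T)" by (simp add: s_def power_divide)
  have s_split: "(1 / sqrt (real N)) * (1 / sqrt (real T)) = s" by (simp add: s_def real_sqrt_mult)
  define Xn where "Xn k = s \<cdot>\<^sub>m X k" for k
  have Xn: "Xn k \<in> carrier_mat N T" if "k < K" for k using X[OF that] by (simp add: Xn_def)
  have bXn: "bdotX K \<alpha> Xn N T = s \<cdot>\<^sub>m bdotX K \<alpha> X N T" for \<alpha>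
    unfolding Xn_def by (rule bdotX_smult[OF X])
  have scaled_le: "frob_norm (r \<cdot>\<^sub>m A) \<le> c" if "r\<^sup>2 * (frob_norm A)\<^sup>2 \<le> c\<^sup>2" for r A
    by (rule power2_le_imp_le[OF _ c]) (use that in \<open>simp add: frob_norm_smult power_mult_distrib\<close>)
  have Xn_le: "frob_norm (Xn k) \<le> c" if "k < K" for k
    unfolding Xn_def using X_le[OF that] by (intro scaled_le) (simp add: s2)
  define scN where "scN A = (1 / sqrt (real N)) \<cdot>\<^sub>m A" for A :: "real mat"
  define scT where "scT A = (1 / sqrt (real T)) \<cdot>\<^sub>m A" for A :: "real mat"
  have scN: "scN A \<in> carrier_mat N R" if "A \<in> carrier_mat N R" for A using that by (simp add: scN_def)
  have scT: "scT A \<in> carrier_mat T R" if "A \<in> carrier_mat T R" for A using that by (simp add: scT_def)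
  have sc: "scN l * (scT g)\<^sup>T = s \<cdot>\<^sub>m (l * g\<^sup>T)" if "l \<in> carrier_mat N R" "g \<in> carrier_mat T R" for l g
  proof -
    have gT: "g\<^sup>T \<in> carrier_mat R T" using that by simp
    have "(scT g)\<^sup>T = (1 / sqrt (real T)) \<cdot>\<^sub>m g\<^sup>T" by (intro eq_matI) (auto simp: scT_def)
    then have "scN l * (scT g)\<^sup>T = (1 / sqrt (real N)) \<cdot>\<^sub>m ((1 / sqrt (real T)) \<cdot>\<^sub>m (l * g\<^sup>T))"
      using mult_smult_assoc_mat[OF that(1) smult_carrier_mat[OF gT]] mult_smult_distrib[OF that(1) gT]
      by (simp add: scN_def)
    also have "\<dots> = s \<cdot>\<^sub>m (l * g\<^sup>T)"
      unfolding s_split[symmetric] by (intro eq_matI) (auto simp del: index_mult_mat(1))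
    finally show ?thesis .
  qed
  obtain lam f where lam: "lam \<in> carrier_mat N R" and f: "f \<in> carrier_mat T R" and
    fit: "(frob_norm (e - (bdotX K d X N T + (lam * f\<^sup>T - lam0 * f0\<^sup>T))))\<^sup>2 / (real N * real T)
      < (frob_norm e)\<^sup>2 / (real N * real T) + \<delta>"
    unfolding d_def by (rule LNT_near_minimizer[OF N T e lam0 f0 model argmin \<delta>])
  define en where "en = s \<cdot>\<^sub>m e"
  define Q where "Q = bdotX K d Xn N T"
  define L where "L = scN lam * (scT f)\<^sup>T - scN lam0 * (scT f0)\<^sup>T"
  have en: "en \<in> carrier_mat N T" using e by (simp add: en_def)
  have Q: "Q \<in> carrier_mat N T" by (simp add: Q_def)
  have lf: "lam * f\<^sup>T \<in> carrier_mat N T" and LF: "lam0 * f0\<^sup>T \<in> carrier_mat N T" using lam f lam0 f0 by auto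
  have L: "L \<in> carrier_mat N T" unfolding L_def sc[OF lam0 f0] using LF by (intro minus_carrier_mat) simp
  have "en - (Q + L) = s \<cdot>\<^sub>m (e - (bdotX K d X N T + (lam * f\<^sup>T - lam0 * f0\<^sup>T)))"
  proof -
    have "s \<cdot>\<^sub>m e - (s \<cdot>\<^sub>m H + (s \<cdot>\<^sub>m G - s \<cdot>\<^sub>m G0)) = s \<cdot>\<^sub>m (e - (H + (G - G0)))"
      if "H \<in> carrier_mat N T" "G \<in> carrier_mat N T" "G0 \<in> carrier_mat N T" for H G G0
      using that e by (intro eq_matI) (auto simp: algebra_simps)
    from this[OF bdotX_carrier lf LF] show ?thesis
      by (simp only: en_def Q_def L_def bXn sc[OF lam f] sc[OF lam0 f0])
  qed
  then have fitn: "(frob_norm (en - (Q + L)))\<^sup>2 \<le> (frob_norm en)\<^sup>2 + \<delta>"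
    using fit by (simp add: en_def frob_norm_smult power_mult_distrib s2)
  have eQ: "\<bar>frob_inner en Q\<bar> \<le> real K * c * \<delta>"
  proof -
    have "frob_inner (Xn k) en = mat_tr (X k * e\<^sup>T) / (real N * real T)" if "k < K" for k
    proof -
      have "frob_inner (Xn k) en = s * frob_inner (X k) en" unfolding Xn_def by (rule frob_inner_smult_left[OF X[OF that]])
      also have "frob_inner (X k) en = frob_inner en (X k)" by (rule frob_inner_commute[OF X[OF that] en])
      also have "\<dots> = s * frob_inner e (X k)" unfolding en_def by (rule frob_inner_smult_left[OF e])
      also have "frob_inner e (X k) = frob_inner (X k) e" by (rule frob_inner_commute[OF e X[OF that]])
      also have "\<dots> = mat_tr (X k * e\<^sup>T)" by (rule mat_tr_mult_transpose[OF X[OF that] e, symmetric])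
      finally show ?thesis using s2 by (simp add: power2_eq_square flip: mult.assoc)
    qed
    then have "frob_inner en Q = (\<Sum>k<K. d k * (mat_tr (X k * e\<^sup>T) / (real N * real T)))"
      using frob_inner_commute[OF en Q] by (simp add: Q_def frob_inner_bdotX[OF Xn])
    also have "\<bar>\<dots>\<bar> \<le> (\<Sum>k<K. \<bar>d k * (mat_tr (X k * e\<^sup>T) / (real N * real T))\<bar>)" by (rule sum_abs)
    also have "\<dots> \<le> (\<Sum>k<K. c * \<delta>)"
      unfolding abs_mult using d_le tr c by (intro sum_mono mult_mono) (auto simp: d_def)
    finally show ?thesis by simp
  qed
  have eL: "\<bar>frob_inner en L\<bar> \<le> (\<delta> * sqrt (real (2 * R))) * frob_norm L"
  proof -
    \<comment> \<open>The difference of two products of width R becomes one product of width 2 R,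
      the source of the factor sqrt(2 R).\<close>
    define C where "C = hcat (scN lam) ((- 1) \<cdot>\<^sub>m scN lam0)"
    define F where "F = hcat (scT f) (scT f0)"
    have C: "C \<in> carrier_mat N (2 * R)" and F: "F \<in> carrier_mat T (2 * R)"
      unfolding C_def F_def mult_2
      by (rule hcat_carrier[OF scN[OF lam] smult_carrier_mat[OF scN[OF lam0]]],
          rule hcat_carrier[OF scT[OF f] scT[OF f0]])
    have "C * F\<^sup>T = scN lam * (scT f)\<^sup>T + ((- 1) \<cdot>\<^sub>m scN lam0) * (scT f0)\<^sup>T"
      unfolding C_def F_def
      by (rule hcat_mult_transpose[OF scN[OF lam] smult_carrier_mat[OF scN[OF lam0]] scT[OF f] scT[OF f0]])
    also have "((- 1) \<cdot>\<^sub>m scN lam0) * (scT f0)\<^sup>T = (- 1) \<cdot>\<^sub>m (scN lam0 * (scT f0)\<^sup>T)"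
      by (rule mult_smult_assoc_mat[OF scN[OF lam0], of _ T]) (simp add: scT[OF f0])
    also have "scN lam * (scT f)\<^sup>T + (- 1) \<cdot>\<^sub>m (scN lam0 * (scT f0)\<^sup>T) = L"
    proof -
      have "G + (- 1) \<cdot>\<^sub>m G0 = G - G0" if "G \<in> carrier_mat N T" "G0 \<in> carrier_mat N T" for G G0 :: "real mat"
        using that by (intro eq_matI) auto
      then show ?thesis
        unfolding L_def sc[OF lam f] sc[OF lam0 f0] using lf LF by simp
    qed
    finally have LCF: "L = C * F\<^sup>T" by simp
    have "\<bar>frob_inner en L\<bar> = s * \<bar>frob_inner e L\<bar>" unfolding en_def frob_inner_smult_left[OF e] using s0 by (simp add: abs_mult)
    also have "\<dots> \<le> s * (\<bar>spec_norm e\<bar> * sqrt (real (2 * R)) * frob_norm L)"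
      unfolding LCF using s0 by (intro mult_left_mono frob_inner_low_rank_le_spec_norm[OF e C F]) simp
    also have "\<dots> = (s * \<bar>spec_norm e\<bar>) * (sqrt (real (2 * R)) * frob_norm L)" by simp
    also have "\<dots> \<le> \<delta> * (sqrt (real (2 * R)) * frob_norm L)"
      using spec by (intro mult_right_mono) (simp_all add: s_def abs_divide)
    finally show ?thesis by simp
  qed
  have Q_le: "frob_norm Q \<le> real K * (c * c)"
    unfolding Q_def using d_le by (intro frob_norm_bdotX_le_uniform[OF Xn Xn_le]) (auto simp: d_def)
  \<comment> \<open>The lemma on near-minimizers is used with slack \<delta>, cross-term bounds K c
    \<delta> and \<delta> sqrt(2 R), and q0 = K c^2; the assumption on \<open>a\<close> is their
    sum, generously rounded up.\<close>
  have D_le: "frob_norm (Q + L) \<le> \<eta>"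
  proof (rule near_minimizer_small[OF en Q L fitn eQ eL Q_le _ _ _ \<eta>])
    let ?q = "sqrt (real (2 * R))"
    have nn: "0 \<le> \<delta> * ?q" "0 \<le> \<delta> * (real K * c)" "0 \<le> \<delta> * (?q * (real K * (c * c)))" using \<delta> c by auto
    have "2 * \<delta> * (1 + real K * c + ?q + ?q * (real K * (c * c))) =
        2 * \<delta> + 2 * (\<delta> * (real K * c)) + 2 * (\<delta> * ?q) + 2 * (\<delta> * (?q * (real K * (c * c))))"
      by (simp add: algebra_simps)
    with a have a': "2 * \<delta> + 2 * (\<delta> * (real K * c)) + 2 * (\<delta> * ?q) + 2 * (\<delta> * (?q * (real K * (c * c)))) \<le> a"
      by simp
    have r: "2 * (real K * c * \<delta>) = 2 * (\<delta> * (real K * c))"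
      "2 * (\<delta> * ?q) * (real K * (c * c)) = 2 * (\<delta> * (?q * (real K * (c * c))))" by simp_all
    show "0 \<le> \<delta> * ?q" by (rule nn)
    show "2 * (\<delta> * ?q) \<le> a" using a' nn \<delta> by linarith
    show "\<delta> + 2 * (real K * c * \<delta>) + 2 * (\<delta> * ?q) * (real K * (c * c)) \<le> a"
      unfolding r using a' nn \<delta> by linarith
  qed
  show ?thesis
    unfolding d_def[symmetric]
  proof (rule deviation_bound[where X = Xn and N = N and T = T and ?L0.0 = "scN lam0" and ?F0.0 = "scT f0"
        and w = w and v = v and lam = "scN lam" and f = "scT f" and s = s and R = R and ?K1.0 = K1 and \<kappa> = \<kappa>])
    show "\<kappa> * (\<Sum>k<K. (d k)\<^sup>2) \<le> (frob_norm (bdotX K d Xn N T))\<^sup>2"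
      using gram by (simp add: bXn frob_norm_smult power_mult_distrib s2 d_eq)
    show "frob_norm (scN lam0) \<le> c" "frob_norm (scT f0) \<le> c"
      unfolding scN_def scT_def using lam0_le f0_le by (auto intro!: scaled_le simp: power_divide)
    show "B * (frob_norm Z)\<^sup>2 \<le> (frob_norm (annih w * scN lam0 * Z))\<^sup>2" if "Z \<in> carrier_mat R m" for m Z
      unfolding scN_def by (rule scaled_annih_factor_lower_bound[OF lam0 w N pd_lam that])
    show "B * (frob_norm Z)\<^sup>2 \<le> (frob_norm (annih v * scT f0 * Z))\<^sup>2" if "Z \<in> carrier_mat R m" for m Z
      unfolding scT_def by (rule scaled_annih_factor_lower_bound[OF f0 v T pd_f that])
    show "Xn l $$ (i,t) = s * (w $$ (i,l) * v $$ (t,l))" if "l < K1" "i < N" "t < T" for l i t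
      using low[OF that] X[of l] that K1 by (simp add: Xn_def)
    show "b \<le> (\<Sum>r\<in>{2*R+K1+1..N}. eig_desc (bdotX K \<alpha> Xn N T * (bdotX K \<alpha> Xn N T)\<^sup>T) r)"
      if "\<forall>k. k < K1 \<or> K \<le> k \<longrightarrow> \<alpha> k = 0" "(\<Sum>k<K. (\<alpha> k)\<^sup>2) = 1" for \<alpha>
    proof -
      have "(s \<cdot>\<^sub>m A) * (s \<cdot>\<^sub>m A)\<^sup>T = (1 / (real N * real T)) \<cdot>\<^sub>m (A * A\<^sup>T)" if "A \<in> carrier_mat N T" for A
      proof -
        have AT: "A\<^sup>T \<in> carrier_mat T N" using that by simp
        have "(s \<cdot>\<^sub>m A)\<^sup>T = s \<cdot>\<^sub>m A\<^sup>T" by (intro eq_matI) auto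
        then have "(s \<cdot>\<^sub>m A) * (s \<cdot>\<^sub>m A)\<^sup>T = s \<cdot>\<^sub>m (s \<cdot>\<^sub>m (A * A\<^sup>T))"
          using mult_smult_assoc_mat[OF that smult_carrier_mat[OF AT]] mult_smult_distrib[OF that AT] by simp
        also have "\<dots> = s\<^sup>2 \<cdot>\<^sub>m (A * A\<^sup>T)"
          by (intro eq_matI) (auto simp: power2_eq_square simp del: index_mult_mat(1))
        finally show ?thesis by (simp add: s2)
      qed
      then show ?thesis using high[OF that] by (simp add: bXn)
    qed
    show "frob_norm (bdotX K d Xn N T + (scN lam * (scT f)\<^sup>T - scN lam0 * (scT f0)\<^sup>T)) \<le> \<eta>"
      using D_le by (simp add: Q_def L_def)
  qed (use K1 Xn Xn_le scN scT lam f lam0 f0 w v B b small in auto)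
qed

section \<open>Bounds read off from Gram matrices\<close>

lemma frob_norm_sq_gram_diag:
  assumes "A \<in> carrier_mat n m"
  shows "(frob_norm A)\<^sup>2 = (\<Sum>i<m. (A\<^sup>T * A) $$ (i,i))"
proof -
  have "(\<Sum>i<m. (A\<^sup>T * A) $$ (i,i)) = (\<Sum>i<m. \<Sum>k<n. (A $$ (k,i))\<^sup>2)"
    by (intro sum.cong refl transpose_mult_self_diag[OF assms]) simp
  also have "\<dots> = (\<Sum>k<n. \<Sum>i<m. (A $$ (k,i))\<^sup>2)" by (rule sum.swap)
  finally show ?thesis using assms unfolding frob_norm_square by (simp add: frob_inner_def power2_eq_square)
qed

text \<open>The squared norm is the trace of the Gram matrix, so diagonal entries within 1 of their
  limits bound it by a constant.\<close>

lemma frob_norm_sq_le_of_gram_close: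
  assumes A: "A \<in> carrier_mat n m"
    and close: "\<And>i. i < m \<Longrightarrow> \<bar>((1 / r) \<cdot>\<^sub>m (A\<^sup>T * A)) $$ (i,i) - G $$ (i,i)\<bar> \<le> 1"
  shows "(frob_norm A)\<^sup>2 / r \<le> (\<Sum>i<m. G $$ (i,i) + 1)"
proof -
  have "(frob_norm A)\<^sup>2 / r = (\<Sum>i<m. ((1 / r) \<cdot>\<^sub>m (A\<^sup>T * A)) $$ (i,i))"
    unfolding frob_norm_sq_gram_diag[OF A] sum_divide_distrib
    using A by (intro sum.cong refl) (simp del: index_mult_mat(1))
  also have "\<dots> \<le> (\<Sum>i<m. G $$ (i,i) + 1)"
  proof (rule sum_mono)
    fix i assume "i \<in> {..<m}"
    then show "((1 / r) \<cdot>\<^sub>m (A\<^sup>T * A)) $$ (i,i) \<le> G $$ (i,i) + 1" using close[of i] by simp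
  qed
  finally show ?thesis .
qed

text \<open>By 2 |x_i x_j| <= x_i^2 + x_j^2, an entrywise error \<epsilon> changes the form by at
  most \<epsilon> n |x|^2. This costs at most half of \<kappa>.\<close>

lemma quadratic_form_perturbation:
  fixes G H :: "nat \<Rightarrow> nat \<Rightarrow> real"
  assumes G: "\<kappa> * (\<Sum>i<n. (x i)\<^sup>2) \<le> (\<Sum>i<n. \<Sum>j<n. x i * G i j * x j)"
    and close: "\<And>i j. i < n \<Longrightarrow> j < n \<Longrightarrow> \<bar>H i j - G i j\<bar> \<le> \<epsilon>" and \<epsilon>: "\<epsilon> * real n \<le> \<kappa> / 2"
  shows "\<kappa> / 2 * (\<Sum>i<n. (x i)\<^sup>2) \<le> (\<Sum>i<n. \<Sum>j<n. x i * H i j * x j)"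
proof -
  have "x i * G i j * x j - x i * H i j * x j \<le> \<epsilon> * (((x i)\<^sup>2 + (x j)\<^sup>2) / 2)" if "i < n" "j < n" for i j
  proof -
    have "x i * G i j * x j - x i * H i j * x j = (G i j - H i j) * (x i * x j)" by (simp add: algebra_simps)
    also have "\<dots> \<le> \<bar>H i j - G i j\<bar> * \<bar>x i * x j\<bar>" by (metis abs_ge_self abs_minus_commute abs_mult)
    also have "\<dots> \<le> \<epsilon> * (((x i)\<^sup>2 + (x j)\<^sup>2) / 2)"
    proof (rule mult_mono)
      have "0 \<le> (\<bar>x i\<bar> - \<bar>x j\<bar>)\<^sup>2" by simp
      then show "\<bar>x i * x j\<bar> \<le> ((x i)\<^sup>2 + (x j)\<^sup>2) / 2" by (simp add: power2_diff abs_mult)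
    qed (use close[OF that] in auto)
    finally show ?thesis .
  qed
  then have "(\<Sum>i<n. \<Sum>j<n. x i * G i j * x j - x i * H i j * x j) \<le>
      (\<Sum>i<n. \<Sum>j<n. \<epsilon> * (((x i)\<^sup>2 + (x j)\<^sup>2) / 2))"
    by (intro sum_mono) auto
  also have "\<dots> = \<epsilon> * real n * (\<Sum>i<n. (x i)\<^sup>2)"
    by (simp add: sum.distrib add_divide_distrib distrib_left flip: sum_distrib_left sum_divide_distrib)
  also have "\<dots> \<le> \<kappa> / 2 * (\<Sum>i<n. (x i)\<^sup>2)"
    using \<epsilon> by (intro mult_right_mono sum_nonneg) auto
  finally show ?thesis using G by (simp add: sum_subtractf)
qed

lemma frob_norm_bdotX_sq_gram:
  assumes X: "\<And>k. k < K \<Longrightarrow> X k \<in> carrier_mat N T"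
  shows "(frob_norm (bdotX K d X N T))\<^sup>2 / r =
    (\<Sum>k<K. \<Sum>l<K. d k * ((\<Sum>i<N. \<Sum>t<T. X k $$ (i,t) * X l $$ (i,t)) / r) * d l)"
proof -
  have "(frob_norm (bdotX K d X N T))\<^sup>2 = (\<Sum>k<K. d k * frob_inner (X k) (bdotX K d X N T))"
    unfolding frob_norm_square by (rule frob_inner_bdotX[OF X])
  also have "\<dots> = (\<Sum>k<K. d k * (\<Sum>l<K. d l * frob_inner (X l) (X k)))"
  proof (intro sum.cong refl)
    fix k assume "k \<in> {..<K}"
    then have "frob_inner (X k) (bdotX K d X N T) = frob_inner (bdotX K d X N T) (X k)"
      using X by (intro frob_inner_commute[of _ N T]) auto
    also have "\<dots> = (\<Sum>l<K. d l * frob_inner (X l) (X k))" by (rule frob_inner_bdotX[OF X])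
    finally show "d k * frob_inner (X k) (bdotX K d X N T) = d k * (\<Sum>l<K. d l * frob_inner (X l) (X k))" by simp
  qed
  also have "\<dots> = (\<Sum>k<K. \<Sum>l<K. d k * (\<Sum>i<N. \<Sum>t<T. X k $$ (i,t) * X l $$ (i,t)) * d l)"
    unfolding sum_distrib_left
    by (intro sum.cong refl) (simp add: frob_inner_def carrier_matD[OF X] sum_distrib_left mult.commute mult.left_commute)
  finally show ?thesis
    by (simp only: sum_divide_distrib[of _ "{..<K}"] times_divide_eq_left times_divide_eq_right)
qed

lemma exists_small_pos:
  fixes p q x y :: real
  assumes "0 \<le> p" "0 \<le> q" "0 < x" "0 < y"
  shows "\<exists>\<eta>>0. \<eta> \<le> 1 \<and> p * \<eta> \<le> x \<and> q * \<eta> \<le> y"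
proof (intro exI conjI)
  \<comment> \<open>The denominators p + 1 and q + 1 allow p or q to vanish.\<close>
  define \<eta> where "\<eta> = min 1 (min (x / (p + 1)) (y / (q + 1)))"
  show "0 < \<eta>" "\<eta> \<le> 1" using assms by (auto simp: \<eta>_def)
  have "\<eta> \<le> x / (p + 1)" "\<eta> \<le> y / (q + 1)" by (simp_all add: \<eta>_def)
  then have "p * \<eta> \<le> p * (x / (p + 1))" "q * \<eta> \<le> q * (y / (q + 1))"
    using assms(1,2) by (auto intro: mult_left_mono simp del: times_divide_eq_right)
  moreover have "p * (x / (p + 1)) \<le> x" "q * (y / (q + 1)) \<le> y"
    using assms by (simp_all add: field_simps)
  ultimately show "p * \<eta> \<le> x" "q * \<eta> \<le> y" by linarith+
qed

text \<open>Compactness refers to the product topology on functions, so it bounds each coordinate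
  separately. The sum of the first K bounds is uniform.\<close>

lemma compact_coordinates_bounded:
  fixes S :: "(nat \<Rightarrow> real) set"
  assumes "compact S"
  obtains c where "\<And>b k. b \<in> S \<Longrightarrow> k < K \<Longrightarrow> \<bar>b k\<bar> \<le> c"
proof -
  have "\<exists>a. \<forall>b\<in>S. \<bar>b k\<bar> \<le> a" for k
  proof -
    have "continuous_on S (\<lambda>b. b k)"
      by (intro continuous_on_subset[OF continuous_on_product_coordinates]) auto
    then have "bounded ((\<lambda>b. b k) ` S)"
      using assms by (intro compact_imp_bounded compact_continuous_image)
    then show ?thesis by (auto simp: bounded_iff)
  qed
  then obtain a where a: "\<And>k b. b \<in> S \<Longrightarrow> \<bar>b k\<bar> \<le> a k" by metis
  show ?thesis
  proof (rule that)
    fix b k assume "b \<in> S" "k < K"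
    then have "\<bar>b k\<bar> \<le> \<bar>a k\<bar>" using a[of b k] by linarith
    also have "\<dots> \<le> (\<Sum>k<K. \<bar>a k\<bar>)" using \<open>k < K\<close> by (intro member_le_sum) auto
    finally show "\<bar>b k\<bar> \<le> (\<Sum>k<K. \<bar>a k\<bar>)" .
  qed
qed

theorem theorem2:
  fixes M :: "'a measure"
    and K K1 R :: nat
    and Y e lam0 f0 w v :: "nat \<Rightarrow> nat \<Rightarrow> 'a \<Rightarrow> real mat"
    and X :: "nat \<Rightarrow> nat \<Rightarrow> nat \<Rightarrow> 'a \<Rightarrow> real mat"
    and beta0 :: "nat \<Rightarrow> real"
    and Bset :: "(nat \<Rightarrow> real) set"
    and betahat :: "nat \<Rightarrow> nat \<Rightarrow> 'a \<Rightarrow> nat \<Rightarrow> real"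
  assumes prob: "prob_space M"
    and K1_le: "K1 \<le> K"
    and dims: "\<And>N T \<omega>. Y N T \<omega> \<in> carrier_mat N T \<and> e N T \<omega> \<in> carrier_mat N T
                 \<and> lam0 N T \<omega> \<in> carrier_mat N R \<and> f0 N T \<omega> \<in> carrier_mat T R
                 \<and> w N T \<omega> \<in> carrier_mat N K1 \<and> v N T \<omega> \<in> carrier_mat T K1
                 \<and> (\<forall>k<K. X k N T \<omega> \<in> carrier_mat N T)"
    and model: "\<And>N T \<omega>. \<omega> \<in> space M \<Longrightarrow>
                 Y N T \<omega> = bdotX K beta0 (\<lambda>k. X k N T \<omega>) N T
                            + lam0 N T \<omega> * transpose_mat (f0 N T \<omega>) + e N T \<omega>"
    and B_sub: "Bset \<subseteq> {b. \<forall>k\<ge>K. b k = 0}"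
    and B_compact: "compact Bset"
    and beta0_in: "beta0 \<in> Bset"
    and betahat_argmin: "\<And>N T \<omega>. \<omega> \<in> space M \<Longrightarrow> betahat N T \<omega> \<in> Bset \<and>
                 (\<forall>b\<in>Bset. LNT K R N T (Y N T \<omega>) (\<lambda>k. X k N T \<omega>) (betahat N T \<omega>)
                            \<le> LNT K R N T (Y N T \<omega>) (\<lambda>k. X k N T \<omega>) b)"
    and A1_lam: "plim_pd M R (\<lambda>N T \<omega>. (1 / real N) \<cdot>\<^sub>m (transpose_mat (lam0 N T \<omega>) * lam0 N T \<omega>))"
    and A1_f: "plim_pd M R (\<lambda>N T \<omega>. (1 / real T) \<cdot>\<^sub>m (transpose_mat (f0 N T \<omega>) * f0 N T \<omega>))"
    and A2: "\<And>k. k < K \<Longrightarrow>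
               plim_to M (\<lambda>N T \<omega>. mat_tr (X k N T \<omega> * transpose_mat (e N T \<omega>)) / (real N * real T)) 0"
    and A3: "plim_to M (\<lambda>N T \<omega>. spec_norm (e N T \<omega>) / sqrt (real N * real T)) 0"
    and A4i: "plim_pd M K (\<lambda>N T \<omega>. mat K K (\<lambda>(k,l).
                 (\<Sum>i<N. \<Sum>t<T. X k N T \<omega> $$ (i,t) * X l N T \<omega> $$ (i,t)) / (real N * real T)))"
    and A4iia: "\<exists>b>0. wpa1 M (\<lambda>N T \<omega>. \<forall>\<alpha> :: nat \<Rightarrow> real.
                 (\<forall>k. (k < K1 \<or> K \<le> k) \<longrightarrow> \<alpha> k = 0) \<and> (\<Sum>k<K. (\<alpha> k)^2) = 1 \<longrightarrow>
                 (\<Sum>r \<in> {2*R+K1+1..N}.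
                    eig_desc ((1 / (real N * real T)) \<cdot>\<^sub>m
                       (bdotX K \<alpha> (\<lambda>k. X k N T \<omega>) N T * transpose_mat (bdotX K \<alpha> (\<lambda>k. X k N T \<omega>) N T))) r)
                 \<ge> b)"
    and A4iib_rank: "\<And>N T \<omega> l. \<omega> \<in> space M \<Longrightarrow> 0 < N \<Longrightarrow> 0 < T \<Longrightarrow> l < K1 \<Longrightarrow>
                 X l N T \<omega> \<noteq> 0\<^sub>m N T \<and>
                 (\<forall>i<N. \<forall>t<T. X l N T \<omega> $$ (i,t) = w N T \<omega> $$ (i,l) * v N T \<omega> $$ (t,l))"
    and A4iib_B: "\<exists>B>0. wpa1 M (\<lambda>N T \<omega>.
                 pd_mat ((1 / real N) \<cdot>\<^sub>m (transpose_mat (lam0 N T \<omega>) * annih (w N T \<omega>) * lam0 N T \<omega>)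
                         - B \<cdot>\<^sub>m 1\<^sub>m R)
               \<and> pd_mat ((1 / real T) \<cdot>\<^sub>m (transpose_mat (f0 N T \<omega>) * annih (v N T \<omega>) * f0 N T \<omega>)
                         - B \<cdot>\<^sub>m 1\<^sub>m R))"
  shows "plim_to M (\<lambda>N T \<omega>. sqrt (\<Sum>k<K. (betahat N T \<omega> k - beta0 k)^2)) 0"
proof -
  interpret prob_space M by (rule prob)
  obtain AL where AL: "\<forall>i<R. \<forall>j<R. plim_to M (\<lambda>N T \<omega>. ((1 / real N) \<cdot>\<^sub>m ((lam0 N T \<omega>)\<^sup>T * lam0 N T \<omega>)) $$ (i,j)) (AL $$ (i,j))"
    using A1_lam unfolding plim_pd_def by blast
  obtain AF where AF: "\<forall>i<R. \<forall>j<R. plim_to M (\<lambda>N T \<omega>. ((1 / real T) \<cdot>\<^sub>m ((f0 N T \<omega>)\<^sup>T * f0 N T \<omega>)) $$ (i,j)) (AF $$ (i,j))"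
    using A1_f unfolding plim_pd_def by blast
  define H where "H N T \<omega> = mat K K (\<lambda>(k,l).
      (\<Sum>i<N. \<Sum>t<T. X k N T \<omega> $$ (i,t) * X l N T \<omega> $$ (i,t)) / (real N * real T))" for N T \<omega>
  obtain G where G: "G \<in> carrier_mat K K" "pd_mat G"
    "\<forall>i<K. \<forall>j<K. plim_to M (\<lambda>N T \<omega>. H N T \<omega> $$ (i,j)) (G $$ (i,j))"
    using A4i unfolding plim_pd_def H_def by blast
  obtain \<kappa> where \<kappa>: "0 < \<kappa>" "\<And>x. \<kappa> * (\<Sum>i<K. (x i)\<^sup>2) \<le> (\<Sum>i<K. \<Sum>j<K. x i * G $$ (i,j) * x j)"
    using pd_mat_lower_bound[OF G(1,2)] by blast
  \<comment> \<open>The first bound keeps the Gram diagonal within 1 of its limit, the second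
    preserves half of \<kappa>; K + 1 avoids dividing by zero.\<close>
  define \<gamma> where "\<gamma> = min 1 (\<kappa> / (2 * (real K + 1)))"
  have \<gamma>0: "0 < \<gamma>" "\<gamma> \<le> 1" using \<kappa> by (auto simp: \<gamma>_def)
  have "\<gamma> * real K \<le> \<kappa> / (2 * (real K + 1)) * real K" by (intro mult_right_mono) (auto simp: \<gamma>_def)
  also have "\<dots> \<le> \<kappa> / 2" using \<kappa>(1) by (simp add: field_simps)
  finally have \<gamma>K: "\<gamma> * real K \<le> \<kappa> / 2" .
  obtain b where b: "0 < b" and wpa_b: "wpa1 M (\<lambda>N T \<omega>. \<forall>\<alpha> :: nat \<Rightarrow> real.
                 (\<forall>k. (k < K1 \<or> K \<le> k) \<longrightarrow> \<alpha> k = 0) \<and> (\<Sum>k<K. (\<alpha> k)^2) = 1 \<longrightarrow>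
                 (\<Sum>r \<in> {2*R+K1+1..N}.
                    eig_desc ((1 / (real N * real T)) \<cdot>\<^sub>m
                       (bdotX K \<alpha> (\<lambda>k. X k N T \<omega>) N T * transpose_mat (bdotX K \<alpha> (\<lambda>k. X k N T \<omega>) N T))) r)
                 \<ge> b)"
    using A4iia by blast
  obtain B where B: "0 < B" and wpa_B: "wpa1 M (\<lambda>N T \<omega>.
                 pd_mat ((1 / real N) \<cdot>\<^sub>m (transpose_mat (lam0 N T \<omega>) * annih (w N T \<omega>) * lam0 N T \<omega>)
                         - B \<cdot>\<^sub>m 1\<^sub>m R)
               \<and> pd_mat ((1 / real T) \<cdot>\<^sub>m (transpose_mat (f0 N T \<omega>) * annih (v N T \<omega>) * f0 N T \<omega>)
                         - B \<cdot>\<^sub>m 1\<^sub>m R))"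
    using A4iib_B by blast
  obtain cB where cB: "\<And>b k. b \<in> Bset \<Longrightarrow> k < K \<Longrightarrow> \<bar>b k\<bar> \<le> cB"
    using compact_coordinates_bounded[OF B_compact] by blast
  define sL where "sL = (\<Sum>i<R. AL $$ (i,i) + 1)"
  define sF where "sF = (\<Sum>i<R. AF $$ (i,i) + 1)"
  \<comment> \<open>One constant for all bounds. The summand 1 ensures c <= c^2, so the same
    \<open>c\<close> bounds coordinates directly and squared norms through c^2; 2 |cB| bounds the
    difference of two points of \<open>Bset\<close>.\<close>
  define c where "c = 1 + 2 * \<bar>cB\<bar> + \<bar>sL\<bar> + \<bar>sF\<bar> + (\<Sum>k<K. \<bar>G $$ (k,k) + 1\<bar>)"
  have sG0: "0 \<le> (\<Sum>k<K. \<bar>G $$ (k,k) + 1\<bar>)" by (intro sum_nonneg) auto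
  have c1: "1 \<le> c" using sG0 by (simp add: c_def)
  have c2: "c \<le> c\<^sup>2" using c1 by (simp add: power2_eq_square)
  have "2 * cB \<le> c" "sL \<le> c" "sF \<le> c" unfolding c_def using sG0 by linarith+
  with c2 have c_ge: "2 * cB \<le> c" "sL \<le> c\<^sup>2" "sF \<le> c\<^sup>2" by linarith+
  have c_geG: "G $$ (k,k) + 1 \<le> c\<^sup>2" if "k < K" for k
  proof -
    have "\<bar>G $$ (k,k) + 1\<bar> \<le> (\<Sum>k<K. \<bar>G $$ (k,k) + 1\<bar>)"
      using that by (intro member_le_sum[of k "{..<K}" "\<lambda>k. \<bar>G $$ (k,k) + 1\<bar>"]) auto
    moreover have "(\<Sum>k<K. \<bar>G $$ (k,k) + 1\<bar>) \<le> c" by (simp add: c_def)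
    ultimately show ?thesis using c2 by linarith
  qed
  \<comment> \<open>\<open>p\<close> is the growth of the error when the high-rank part is moved
    into it, and \<open>q\<close> the total factor in the final bound.\<close>
  define p where "p = 1 + real K * c / sqrt b"
  define q where "q = (2 * (1 + c\<^sup>2 / B) / sqrt B * c + 1 + 2 * c\<^sup>2 / B) * p + 1"
  have p0: "0 \<le> p" using b c1 by (auto simp: p_def)
  have q0: "0 \<le> q" using p0 B c1 by (auto simp: q_def intro!: add_nonneg_nonneg mult_nonneg_nonneg)
  show ?thesis
    unfolding plim_to_iff_wpa1
  proof (intro allI impI)
    fix \<epsilon> :: real assume \<epsilon>: "0 < \<epsilon>"
    \<comment> \<open>The third property is the smallness required by the factor recovery; the
      fourth converts the final bound into \<epsilon>.\<close>
    obtain \<eta> where \<eta>: "0 < \<eta>" "\<eta> \<le> 1" "2 * c * p * \<eta> \<le> B * sqrt B" "q * \<eta> \<le> sqrt (\<kappa> / 2) * \<epsilon>"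
      using exists_small_pos[of "2 * c * p" q "B * sqrt B" "sqrt (\<kappa> / 2) * \<epsilon>"] p0 q0 c1 B \<kappa>(1) \<epsilon> by auto
    define m where "m = 1 + real K * c + sqrt (real (2 * R)) + sqrt (real (2 * R)) * (real K * (c * c))"
    have m0: "0 < m" using c1 by (auto simp: m_def intro!: add_pos_nonneg)
    \<comment> \<open>Chosen to give 2 \<delta> m = \<eta>^2 / 2, so that a = \<eta>^2 / 2 satisfies
      both 2 \<delta> m <= a and 2 a <= \<eta>^2.\<close>
    define \<delta> where "\<delta> = \<eta>\<^sup>2 / (4 * m)"
    have \<delta>: "0 < \<delta>" using \<eta> m0 by (simp add: \<delta>_def)
    have \<delta>m: "2 * \<delta> * m \<le> \<eta>\<^sup>2 / 2" using m0 by (simp add: \<delta>_def)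
    \<comment> \<open>Tolerance 1 is enough for the factor Gram matrices, which only have to stay
      bounded; \<delta> depends on \<epsilon>, while \<gamma> does not.\<close>
    have E1: "wpa1 M (\<lambda>N T \<omega>. \<forall>i<R. \<forall>j<R. \<bar>((1 / real N) \<cdot>\<^sub>m ((lam0 N T \<omega>)\<^sup>T * lam0 N T \<omega>)) $$ (i,j) - AL $$ (i,j)\<bar> \<le> 1)"
      by (rule plim_pd_wpa1[OF AL]) simp
    have E2: "wpa1 M (\<lambda>N T \<omega>. \<forall>i<R. \<forall>j<R. \<bar>((1 / real T) \<cdot>\<^sub>m ((f0 N T \<omega>)\<^sup>T * f0 N T \<omega>)) $$ (i,j) - AF $$ (i,j)\<bar> \<le> 1)"
      by (rule plim_pd_wpa1[OF AF]) simp
    have E3: "wpa1 M (\<lambda>N T \<omega>. \<forall>i<K. \<forall>j<K. \<bar>H N T \<omega> $$ (i,j) - G $$ (i,j)\<bar> \<le> \<gamma>)"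
      by (rule plim_pd_wpa1[OF G(3) \<gamma>0(1)])
    have E4: "wpa1 M (\<lambda>N T \<omega>. \<forall>k<K. \<bar>mat_tr (X k N T \<omega> * (e N T \<omega>)\<^sup>T) / (real N * real T) - 0\<bar> \<le> \<delta>)"
      using A2 \<delta> by (intro wpa1_all_less) (simp add: plim_to_iff_wpa1)
    have E5: "wpa1 M (\<lambda>N T \<omega>. \<bar>spec_norm (e N T \<omega>) / sqrt (real N * real T) - 0\<bar> \<le> \<delta>)"
      using A3 \<delta> unfolding plim_to_iff_wpa1 by blast
    note E = wpa1_conj[OF E1 wpa1_conj[OF E2 wpa1_conj[OF E3 wpa1_conj[OF E4 wpa1_conj[OF E5 wpa1_conj[OF wpa_b wpa_B]]]]]]
    have key: "\<bar>sqrt (\<Sum>k<K. (betahat N T \<omega> k - beta0 k)\<^sup>2) - 0\<bar> \<le> \<epsilon>"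
      if N: "0 < N" and T: "0 < T" and \<omega>: "\<omega> \<in> space M"
        and e1: "\<forall>i<R. \<forall>j<R. \<bar>((1 / real N) \<cdot>\<^sub>m ((lam0 N T \<omega>)\<^sup>T * lam0 N T \<omega>)) $$ (i,j) - AL $$ (i,j)\<bar> \<le> 1"
        and e2: "\<forall>i<R. \<forall>j<R. \<bar>((1 / real T) \<cdot>\<^sub>m ((f0 N T \<omega>)\<^sup>T * f0 N T \<omega>)) $$ (i,j) - AF $$ (i,j)\<bar> \<le> 1"
        and e3: "\<forall>i<K. \<forall>j<K. \<bar>H N T \<omega> $$ (i,j) - G $$ (i,j)\<bar> \<le> \<gamma>"
        and e4: "\<forall>k<K. \<bar>mat_tr (X k N T \<omega> * (e N T \<omega>)\<^sup>T) / (real N * real T) - 0\<bar> \<le> \<delta>"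
        and e5: "\<bar>spec_norm (e N T \<omega>) / sqrt (real N * real T) - 0\<bar> \<le> \<delta>"
        and e6: "\<forall>\<alpha> :: nat \<Rightarrow> real.
                 (\<forall>k. (k < K1 \<or> K \<le> k) \<longrightarrow> \<alpha> k = 0) \<and> (\<Sum>k<K. (\<alpha> k)^2) = 1 \<longrightarrow>
                 (\<Sum>r \<in> {2*R+K1+1..N}.
                    eig_desc ((1 / (real N * real T)) \<cdot>\<^sub>m
                       (bdotX K \<alpha> (\<lambda>k. X k N T \<omega>) N T * transpose_mat (bdotX K \<alpha> (\<lambda>k. X k N T \<omega>) N T))) r)
                 \<ge> b"
        and e7: "pd_mat ((1 / real N) \<cdot>\<^sub>m (transpose_mat (lam0 N T \<omega>) * annih (w N T \<omega>) * lam0 N T \<omega>) - B \<cdot>\<^sub>m 1\<^sub>m R)"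
          "pd_mat ((1 / real T) \<cdot>\<^sub>m (transpose_mat (f0 N T \<omega>) * annih (v N T \<omega>) * f0 N T \<omega>) - B \<cdot>\<^sub>m 1\<^sub>m R)"
      for N T \<omega>
    proof -
      have dim: "e N T \<omega> \<in> carrier_mat N T" "lam0 N T \<omega> \<in> carrier_mat N R" "f0 N T \<omega> \<in> carrier_mat T R"
        "w N T \<omega> \<in> carrier_mat N K1" "v N T \<omega> \<in> carrier_mat T K1"
        and X: "\<And>k. k < K \<Longrightarrow> X k N T \<omega> \<in> carrier_mat N T"
        using dims[of N T \<omega>] by auto
      have bh: "betahat N T \<omega> \<in> Bset" and argmin: "LNT K R N T (Y N T \<omega>) (\<lambda>k. X k N T \<omega>) (betahat N T \<omega>)
          \<le> LNT K R N T (Y N T \<omega>) (\<lambda>k. X k N T \<omega>) beta0"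
        using betahat_argmin[OF \<omega>, of N T] beta0_in by auto
      have HG: "H N T \<omega> $$ (k,l) = (\<Sum>i<N. \<Sum>t<T. X k N T \<omega> $$ (i,t) * X l N T \<omega> $$ (i,t)) / (real N * real T)"
        if "k < K" "l < K" for k l using that by (simp add: H_def)
      have "sqrt (\<kappa> / 2) * sqrt (\<Sum>k<K. (betahat N T \<omega> k - beta0 k)\<^sup>2) \<le> q * \<eta>"
        unfolding q_def p_def
      proof (rule finite_sample_bound[OF N T K1_le X dim model[OF \<omega>] argmin, where b = b and \<delta> = \<delta> and a = "\<eta>\<^sup>2 / 2"])
        show "\<bar>betahat N T \<omega> k - beta0 k\<bar> \<le> c" if "k < K" for k
          using cB[OF bh that] cB[OF beta0_in that] c_ge(1) by linarith
        show "(frob_norm (lam0 N T \<omega>))\<^sup>2 / real N \<le> c\<^sup>2"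
          using frob_norm_sq_le_of_gram_close[OF dim(2), of "real N" AL] e1 c_ge(2) by (simp add: sL_def)
        show "(frob_norm (f0 N T \<omega>))\<^sup>2 / real T \<le> c\<^sup>2"
          using frob_norm_sq_le_of_gram_close[OF dim(3), of "real T" AF] e2 c_ge(3) by (simp add: sF_def)
        show "(frob_norm (X k N T \<omega>))\<^sup>2 / (real N * real T) \<le> c\<^sup>2" if k: "k < K" for k
        proof -
          have "(frob_norm (X k N T \<omega>))\<^sup>2 / (real N * real T) = H N T \<omega> $$ (k,k)"
            unfolding frob_norm_square HG[OF k k] using X[OF k] by (simp add: frob_inner_def)
          also have "\<dots> \<le> G $$ (k,k) + 1" using e3 k \<gamma>0(2) by force
          finally show ?thesis using c_geG[OF k] by linarith
        qed
        show "\<kappa> / 2 * (\<Sum>k<K. (betahat N T \<omega> k - beta0 k)\<^sup>2)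
            \<le> (frob_norm (bdotX K (\<lambda>k. betahat N T \<omega> k - beta0 k) (\<lambda>k. X k N T \<omega>) N T))\<^sup>2 / (real N * real T)"
        proof -
          let ?d = "\<lambda>k. betahat N T \<omega> k - beta0 k"
          have "\<kappa> / 2 * (\<Sum>k<K. (?d k)\<^sup>2) \<le> (\<Sum>k<K. \<Sum>l<K. ?d k *
              ((\<Sum>i<N. \<Sum>t<T. X k N T \<omega> $$ (i,t) * X l N T \<omega> $$ (i,t)) / (real N * real T)) * ?d l)"
            using e3 HG by (intro quadratic_form_perturbation[OF \<kappa>(2) _ \<gamma>K]) auto
          also have "\<dots> = (frob_norm (bdotX K ?d (\<lambda>k. X k N T \<omega>) N T))\<^sup>2 / (real N * real T)"
            by (rule frob_norm_bdotX_sq_gram[symmetric]) (rule X)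
          finally show ?thesis .
        qed
        show "\<bar>mat_tr (X k N T \<omega> * (e N T \<omega>)\<^sup>T) / (real N * real T)\<bar> \<le> \<delta>" if "k < K" for k
          using e4 that by simp
        show "\<bar>spec_norm (e N T \<omega>) / sqrt (real N * real T)\<bar> \<le> \<delta>" using e5 by simp
        show "X l N T \<omega> $$ (i,t) = w N T \<omega> $$ (i,l) * v N T \<omega> $$ (t,l)" if "l < K1" "i < N" "t < T" for l i t
          using A4iib_rank[OF \<omega> N T that(1)] that by blast
        show "b \<le> (\<Sum>r\<in>{2*R+K1+1..N}. eig_desc ((1 / (real N * real T)) \<cdot>\<^sub>m
            (bdotX K \<alpha> (\<lambda>k. X k N T \<omega>) N T * (bdotX K \<alpha> (\<lambda>k. X k N T \<omega>) N T)\<^sup>T)) r)"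
          if "\<forall>k. k < K1 \<or> K \<le> k \<longrightarrow> \<alpha> k = 0" "(\<Sum>k<K. (\<alpha> k)\<^sup>2) = 1" for \<alpha>
          using e6 that by blast
        show "2 * \<delta> * (1 + real K * c + sqrt (real (2 * R)) + sqrt (real (2 * R)) * (real K * (c * c))) \<le> \<eta>\<^sup>2 / 2"
          using \<delta>m unfolding m_def .
        show "2 * c * ((1 + real K * c / sqrt b) * \<eta>) \<le> B * sqrt B"
          using \<eta>(3) unfolding p_def by (simp only: mult.assoc)
      qed (use e7 B b c1 \<delta> \<eta> in auto)
      also have "\<dots> \<le> sqrt (\<kappa> / 2) * \<epsilon>" by (rule \<eta>(4))
      finally have "sqrt (\<Sum>k<K. (betahat N T \<omega> k - beta0 k)\<^sup>2) \<le> \<epsilon>"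
        using \<kappa>(1) by (simp add: mult_le_cancel_left_pos)
      moreover have "0 \<le> sqrt (\<Sum>k<K. (betahat N T \<omega> k - beta0 k)\<^sup>2)"
        by (intro real_sqrt_ge_zero sum_nonneg) auto
      ultimately show ?thesis by simp
    qed
    show "wpa1 M (\<lambda>N T \<omega>. \<bar>sqrt (\<Sum>k<K. (betahat N T \<omega> k - beta0 k)\<^sup>2) - 0\<bar> \<le> \<epsilon>)"
      by (rule wpa1_mono[OF E], elim conjE, rule key; assumption)
  qed
qed

end
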